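(* Let $(W,S)$ be a Coxeter group with $S$ finite and let $I\subset S$ be such that $W_I$ is finite. Then $\tilde w_I\in\mathbf{Q}[v^{\pm1}]_{(v-1)}H_W$.
   Context: $W_I$ is the subgroup generated by $I$; when it is finite, $w_I$ is its longest element. $H_W$ is the Hecke algebra of $W$: the quotient of the group ring $\mathbf{Z}[v^{\pm1}]B_W$ of the braid group of $W$ (generators $\beta_s$, $s\in S$, and the braid relations) by the ideal generated by $(\beta_s-v)(\beta_s+v^{-1})$ for $s\in S$; $T_s$ is the image of $\beta_s$. $H_I\subset H_W$ is the Hecke algebra of $(W_I,I)$, the subalgebra generated by $T_s$, $s\in I$. $R$ is the completion of $\mathbf{Q}[v^{\pm1}]$ at the ideal $(v-1)$, and $AH=A\otimes_{\mathbf{Z}[v^{\pm1}]}H$ for a $\mathbf{Z}[v^{\pm1}]$-algebra $A$. $\mathbf{Q}[v^{\pm1}]_{(v-1)}\subset R$ is the localization of $\mathbf{Q}[v^{\pm1}]$ at the prime ideal $(v-1)$. For $I\subset S$ with $W_I$ finite, $\tilde w_I$ is the unique element of $RH_I\subset RH_W$ such that $\tilde w_I^2=1$, $(\tilde w_I)_{|v=1}=w_I$ (image in $RH_I/(v-1)=\mathbf{Q}W_I$, where $T_s\mapsto s$), and $\tilde w_IT_s\tilde w_I^{-1}=T_{w_Isw_I}$ for all $s\in I$ (such an element exists and is unique). *)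

theory Defs
  imports
    "HOL-Algebra.Algebra"
    "HOL-Algebra.Algebraic_Closure_Type"
    "HOL-Library.Poly_Mapping"
    "HOL-Computational_Algebra.Formal_Power_Series"
begin

unbundle fps_syntax

section \<open>Group presentations and Coxeter systems\<close>

text \<open>A letter \<open>(x, True)\<close> stands for the generator \<open>x\<close> and \<open>(x, False)\<close> for its inverse.\<close>

type_synonym 'a word = "('a \<times> bool) list"

abbreviation words :: "'a set \<Rightarrow> 'a word set" where
  "words Y \<equiv> lists (Y \<times> UNIV)"

definition eval_word :: "('a, 'm) monoid_scheme \<Rightarrow> 'a word \<Rightarrow> 'a" where
  "eval_word G u =
     foldr (\<lambda>(x, b) g. (if b then x else inv\<^bsub>G\<^esub> x) \<otimes>\<^bsub>G\<^esub> g) u \<one>\<^bsub>G\<^esub>"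

text \<open>Equality of words in the group with generators \<open>Y\<close> and relations \<open>u = w\<close>, for
  \<open>(u, w) \<in> R\<close>.\<close>

inductive pres_eq :: "'a set \<Rightarrow> ('a word \<times> 'a word) set \<Rightarrow> 'a word \<Rightarrow> 'a word \<Rightarrow> bool"
  for Y :: "'a set" and R :: "('a word \<times> 'a word) set" where
  refl: "u \<in> words Y \<Longrightarrow> pres_eq Y R u u"
| sym: "pres_eq Y R u w \<Longrightarrow> pres_eq Y R w u"
| trans: "pres_eq Y R u w \<Longrightarrow> pres_eq Y R w z \<Longrightarrow> pres_eq Y R u z"
| append: "pres_eq Y R u w \<Longrightarrow> pres_eq Y R u' w' \<Longrightarrow> pres_eq Y R (u @ u') (w @ w')"
| cancel: "x \<in> Y \<Longrightarrow> pres_eq Y R [(x, b), (x, \<not> b)] []"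
| relation: "(u, w) \<in> R \<Longrightarrow> u \<in> words Y \<Longrightarrow> w \<in> words Y \<Longrightarrow> pres_eq Y R u w"

definition pres_class :: "'a set \<Rightarrow> ('a word \<times> 'a word) set \<Rightarrow> 'a word \<Rightarrow> 'a word set" where
  "pres_class Y R u = {w. pres_eq Y R u w}"

definition presented_group ::
    "'a set \<Rightarrow> ('a word \<times> 'a word) set \<Rightarrow> 'a word set monoid" where
  "presented_group Y R =
     \<lparr>carrier = pres_class Y R ` words Y,
      monoid.mult = (\<lambda>C D. \<Union>u\<in>C. \<Union>w\<in>D. pres_class Y R (u @ w)),
      monoid.one = pres_class Y R []\<rparr>"

definition has_presentation ::
    "('a, 'm) monoid_scheme \<Rightarrow> 'a set \<Rightarrow> ('a word \<times> 'a word) set \<Rightarrow> bool" where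
  "has_presentation G Y R \<longleftrightarrow>
     generate G Y = carrier G \<and>
     (\<forall>u\<in>words Y. \<forall>w\<in>words Y. eval_word G u = eval_word G w \<longleftrightarrow> pres_eq Y R u w)"

text \<open>\<open>m(s,t)\<close> is the order of \<open>s t\<close>. By the convention of \<^const>\<open>group.ord\<close> it is \<open>0\<close> when
  that order is infinite, and the relations below are then trivial, as they should be.\<close>

definition coxeter_mat :: "('a, 'm) monoid_scheme \<Rightarrow> 'a \<Rightarrow> 'a \<Rightarrow> nat" where
  "coxeter_mat W s t = group.ord W (s \<otimes>\<^bsub>W\<^esub> t)"

definition coxeter_relations ::
    "('a, 'm) monoid_scheme \<Rightarrow> 'a set \<Rightarrow> ('a word \<times> 'a word) set" where
  "coxeter_relations W S =
     {(concat (replicate (coxeter_mat W s t) [(s, True), (t, True)]), []) | s t. s \<in> S \<and> t \<in> S}"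

locale coxeter_system = group W for W :: "('a, 'm) monoid_scheme" (structure) +
  fixes S :: "'a set"
  assumes generators_in_carrier: "S \<subseteq> carrier W"
    and generators_order_two: "s \<in> S \<Longrightarrow> ord s = 2"
    and coxeter_presentation: "has_presentation W S (coxeter_relations W S)"

abbreviation parabolic :: "('a, 'm) monoid_scheme \<Rightarrow> 'a set \<Rightarrow> 'a set" where
  "parabolic W I \<equiv> generate W I"

definition word_length :: "('a, 'm) monoid_scheme \<Rightarrow> 'a set \<Rightarrow> 'a \<Rightarrow> nat" where
  "word_length G Y g = (LEAST n. \<exists>u\<in>words Y. length u = n \<and> eval_word G u = g)"

definition longest_element :: "('a, 'm) monoid_scheme \<Rightarrow> 'a set \<Rightarrow> 'a" where
  "longest_element W I =
     (THE w. w \<in> parabolic W I \<and> (\<forall>u\<in>parabolic W I. word_length W I u \<le> word_length W I w))"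

fun alternating_word :: "nat \<Rightarrow> 'a \<Rightarrow> 'a \<Rightarrow> 'a word" where
  "alternating_word 0 s t = []"
| "alternating_word (Suc n) s t = (s, True) # alternating_word n t s"

definition braid_relations ::
    "('a, 'm) monoid_scheme \<Rightarrow> 'a set \<Rightarrow> ('a word \<times> 'a word) set" where
  "braid_relations W S =
     {(alternating_word (coxeter_mat W s t) s t, alternating_word (coxeter_mat W s t) t s)
       | s t. s \<in> S \<and> t \<in> S}"

definition braid_group :: "('a, 'm) monoid_scheme \<Rightarrow> 'a set \<Rightarrow> 'a word set monoid" where
  "braid_group W S = presented_group S (braid_relations W S)"

definition braid_gen :: "('a, 'm) monoid_scheme \<Rightarrow> 'a set \<Rightarrow> 'a \<Rightarrow> 'a word set" where
  "braid_gen W S s = pres_class S (braid_relations W S) [(s, True)]"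


section \<open>Monoid rings and tensor products of algebras\<close>

definition monoid_ring :: "('g, 'm) monoid_scheme \<Rightarrow> ('g \<Rightarrow>\<^sub>0 'k::comm_ring_1) ring" where
  "monoid_ring G =
     \<lparr>carrier = {f. Poly_Mapping.keys f \<subseteq> carrier G},
      monoid.mult = (\<lambda>f g. \<Sum>x\<in>Poly_Mapping.keys f. \<Sum>y\<in>Poly_Mapping.keys g.
                Poly_Mapping.single (x \<otimes>\<^bsub>G\<^esub> y) (Poly_Mapping.lookup f x * Poly_Mapping.lookup g y)),
      monoid.one = Poly_Mapping.single \<one>\<^bsub>G\<^esub> 1,
      ring.zero = 0,
      ring.add = (+)\<rparr>"

text \<open>Let \<open>\<alpha>\<close> and \<open>\<beta>\<close> be ring homomorphisms from the commutative ring \<open>C\<close> to the centres of the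
  rings \<open>A\<close> and \<open>B\<close>. The usual construction of \<open>A \<otimes>\<^sub>C B\<close> divides the free abelian group on
  \<open>A \<times> B\<close> by the subgroup generated by the elements below. This free abelian group is the
  integral monoid ring of the multiplicative monoid \<open>A \<times> B\<close>, and that subgroup is already a
  two-sided ideal, so that dividing by the ideal generated gives \<open>A \<otimes>\<^sub>C B\<close> as a ring, with
  \<open>(a \<otimes> b) (a' \<otimes> b') = a a' \<otimes> b b'\<close>.\<close>

definition tensor_relators ::
    "('c, 'i) ring_scheme \<Rightarrow> ('c \<Rightarrow> 'x) \<Rightarrow> ('x, 'j) ring_scheme \<Rightarrow> ('c \<Rightarrow> 'y) \<Rightarrow>
     ('y, 'k) ring_scheme \<Rightarrow> ('x \<times> 'y \<Rightarrow>\<^sub>0 int) set" where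
  "tensor_relators C \<alpha> A \<beta> B =
     (let e = (\<lambda>a b. Poly_Mapping.single (a, b) 1) in
       {e (a \<oplus>\<^bsub>A\<^esub> a') b - e a b - e a' b
         | a a' b. a \<in> carrier A \<and> a' \<in> carrier A \<and> b \<in> carrier B}
     \<union> {e a (b \<oplus>\<^bsub>B\<^esub> b') - e a b - e a b'
         | a b b'. a \<in> carrier A \<and> b \<in> carrier B \<and> b' \<in> carrier B}
     \<union> {e (\<alpha> c \<otimes>\<^bsub>A\<^esub> a) b - e a (\<beta> c \<otimes>\<^bsub>B\<^esub> b)
         | c a b. c \<in> carrier C \<and> a \<in> carrier A \<and> b \<in> carrier B})"

definition tensor_ideal ::
    "('c, 'i) ring_scheme \<Rightarrow> ('c \<Rightarrow> 'x) \<Rightarrow> ('x, 'j) ring_scheme \<Rightarrow> ('c \<Rightarrow> 'y) \<Rightarrow>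
     ('y, 'k) ring_scheme \<Rightarrow> ('x \<times> 'y \<Rightarrow>\<^sub>0 int) set" where
  "tensor_ideal C \<alpha> A \<beta> B = Idl\<^bsub>monoid_ring (A \<times>\<times> B)\<^esub> (tensor_relators C \<alpha> A \<beta> B)"

definition tensor_algebra ::
    "('c, 'i) ring_scheme \<Rightarrow> ('c \<Rightarrow> 'x) \<Rightarrow> ('x, 'j) ring_scheme \<Rightarrow> ('c \<Rightarrow> 'y) \<Rightarrow>
     ('y, 'k) ring_scheme \<Rightarrow> ('x \<times> 'y \<Rightarrow>\<^sub>0 int) set ring" where
  "tensor_algebra C \<alpha> A \<beta> B = monoid_ring (A \<times>\<times> B) Quot tensor_ideal C \<alpha> A \<beta> B"

definition pure_tensor ::
    "('c, 'i) ring_scheme \<Rightarrow> ('c \<Rightarrow> 'x) \<Rightarrow> ('x, 'j) ring_scheme \<Rightarrow> ('c \<Rightarrow> 'y) \<Rightarrow>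
     ('y, 'k) ring_scheme \<Rightarrow> 'x \<Rightarrow> 'y \<Rightarrow> ('x \<times> 'y \<Rightarrow>\<^sub>0 int) set" where
  "pure_tensor C \<alpha> A \<beta> B a b =
     tensor_ideal C \<alpha> A \<beta> B +>\<^bsub>monoid_ring (A \<times>\<times> B)\<^esub> Poly_Mapping.single (a, b) 1"


section \<open>Laurent polynomials, their completion and localization at \<open>v - 1\<close>\<close>

text \<open>\<open>k[v\<^sup>\<plusminus>\<^sup>1]\<close> is the type \<open>int \<Rightarrow>\<^sub>0 k\<close>, with \<open>single n c\<close> for \<open>c v\<^sup>n\<close>; the multiplication of
  \<^theory>\<open>HOL-Library.Poly_Mapping\<close> is the convolution product.\<close>

type_synonym 'k laurent = "int \<Rightarrow>\<^sub>0 'k"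

definition vpow :: "int \<Rightarrow> 'k::comm_ring_1 laurent" where
  "vpow n = Poly_Mapping.single n 1"

abbreviation v :: "'k::comm_ring_1 laurent" where
  "v \<equiv> vpow 1"

text \<open>The completion \<open>R\<close> of \<open>\<rat>[v\<^sup>\<plusminus>\<^sup>1]\<close> at \<open>(v - 1)\<close> is \<open>\<rat>[[X]]\<close> with \<open>X = v - 1\<close>. The lemmas
  \<open>completion_*\<close> below justify this: \<open>laurent_to_R\<close> is a ring homomorphism and induces
  isomorphisms \<open>\<rat>[v\<^sup>\<plusminus>\<^sup>1] / (v - 1)\<^sup>n \<rightarrow> \<rat>[[X]] / X\<^sup>n\<close>, and every compatible family in the inverse
  limit of these rings has a unique limit in \<open>\<rat>[[X]]\<close>.\<close>

definition laurent_to_R :: "rat laurent \<Rightarrow> rat fps" where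
  "laurent_to_R p =
     (\<Sum>n\<in>Poly_Mapping.keys p. fps_const (Poly_Mapping.lookup p n) * (1 + fps_X) powi n)"

definition int_laurent_to_R :: "int laurent \<Rightarrow> rat fps" where
  "int_laurent_to_R p = laurent_to_R (Poly_Mapping.map of_int p)"

definition localization_in_R :: "rat fps set" where
  "localization_in_R =
     {f. \<exists>p q. \<not> (v - 1) dvd q \<and> f * laurent_to_R q = laurent_to_R p}"

lemma laurent_induct [case_names single sum]:
  fixes p :: "rat laurent"
  assumes single: "\<And>n c. P (Poly_Mapping.single n c)"
    and sum: "\<And>f g. P f \<Longrightarrow> P g \<Longrightarrow> P (f + g)"
  shows "P p"
proof (induction p rule: update_induct)
  case const
  show ?case using single[of 0 0] by simp
next
  case (update f a b)
  have "Poly_Mapping.update a b f = f + Poly_Mapping.single a b"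
    using update by (intro poly_mapping_eqI)
      (auto simp: lookup_update lookup_add lookup_single in_keys_iff when_def)
  then show ?case using sum[OF update.IH single] by simp
qed

lemma laurent_to_R_extend:
  assumes "finite A" "Poly_Mapping.keys p \<subseteq> A"
  shows "laurent_to_R p =
    (\<Sum>n\<in>A. fps_const (Poly_Mapping.lookup p n) * (1 + fps_X) powi n)"
  unfolding laurent_to_R_def
  by (rule sum.mono_neutral_left) (use assms in \<open>auto simp: in_keys_iff\<close>)

lemma completion_hom_add: "laurent_to_R (p + q) = laurent_to_R p + laurent_to_R q"
proof -
  let ?A = "Poly_Mapping.keys p \<union> Poly_Mapping.keys q"
  have "Poly_Mapping.keys (p + q) \<subseteq> ?A"
    by (rule Poly_Mapping.keys_add)
  then show ?thesis
    using laurent_to_R_extend[of ?A "p + q"] laurent_to_R_extend[of ?A p]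
      laurent_to_R_extend[of ?A q]
    by (simp add: lookup_add sum.distrib[symmetric] algebra_simps flip: fps_const_add)
qed

lemma completion_single:
  "laurent_to_R (Poly_Mapping.single n c) = fps_const c * (1 + fps_X) powi n"
  by (simp add: laurent_to_R_def)

lemma one_plus_X_powi_add:
  "(1 + fps_X :: rat fps) powi (m + n) = (1 + fps_X) powi m * (1 + fps_X) powi n"
proof -
  define q where "q = (1 + fps_X :: rat fps)"
  have inv: "q * inverse q = 1"
    unfolding q_def by (rule inverse_mult_eq_1') simp
  have step: "q powi (k + 1) = q * q powi k" for k
  proof (cases "k \<ge> 0")
    case True
    then have "nat (k + 1) = Suc (nat k)" by simp
    then show ?thesis using True by (simp add: power_int_def)
  next
    case False
    define j where "j = nat (- k - 1)"
    have k: "nat (- k) = Suc j" using False unfolding j_def by simp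
    have k1: "q powi (k + 1) = inverse q ^ j"
    proof (cases "k = -1")
      case True
      then show ?thesis by (simp add: j_def)
    next
      case False
      with \<open>\<not> k \<ge> 0\<close> have "\<not> k + 1 \<ge> 0" by simp
      moreover have "nat (- (k + 1)) = j" unfolding j_def by simp
      ultimately show ?thesis by (simp only: power_int_def if_False)
    qed
    have "q powi k = inverse q * inverse q ^ j"
      using False k by (simp add: power_int_def)
    then have "q * q powi k = (q * inverse q) * inverse q ^ j"
      by (simp only: mult.assoc)
    then show ?thesis unfolding k1 inv by simp
  qed
  have step': "q powi (k - 1) = inverse q * q powi k" for k
  proof -
    have "inverse q * q powi k = (q * inverse q) * q powi (k - 1)"
      unfolding step[of "k - 1", unfolded diff_add_cancel] by (simp only: ac_simps)
    then show ?thesis unfolding inv by simp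
  qed
  have "q powi (m + n) = q powi m * q powi n"
  proof (induction m rule: int_induct[where k = 0])
    case base
    show ?case by simp
  next
    case (step1 i)
    have "q powi (i + 1 + n) = q * q powi (i + n)"
      using step[of "i + n"] by (simp only: ac_simps)
    then show ?case using step1 step[of i] by (simp only: mult.assoc)
  next
    case (step2 i)
    have "q powi (i - 1 + n) = inverse q * q powi (i + n)"
      using step'[of "i + n"] by (simp only: diff_add_eq)
    then show ?case using step2 step'[of i] by (simp only: mult.assoc)
  qed
  then show ?thesis unfolding q_def .
qed

lemma completion_hom_mult: "laurent_to_R (p * q) = laurent_to_R p * laurent_to_R q"
proof -
  have zero: "laurent_to_R 0 = 0" by (simp add: laurent_to_R_def)
  have hom_single: "laurent_to_R (Poly_Mapping.single m c * q) =
      laurent_to_R (Poly_Mapping.single m c) * laurent_to_R q" for m c q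
  proof (induction q rule: laurent_induct)
    case (single k d)
    show ?case
      by (simp only: mult_single completion_single one_plus_X_powi_add flip: fps_const_mult)
        (simp only: ac_simps)
  next
    case (sum f g)
    then show ?case by (simp add: algebra_simps completion_hom_add)
  qed
  show ?thesis
  proof (induction p rule: laurent_induct)
    case (single k d)
    then show ?case by (rule hom_single)
  next
    case (sum f g)
    then show ?case by (simp add: algebra_simps completion_hom_add)
  qed
qed

lemma completion_hom_one: "laurent_to_R 1 = 1"
  using completion_single[of 0 1] by (simp add: single_one)

lemma completion_v: "laurent_to_R (v - 1) = fps_X"
proof -
  have "laurent_to_R (v - 1) + laurent_to_R 1 = laurent_to_R v"
    by (simp flip: completion_hom_add)
  then show ?thesis
    by (simp add: completion_hom_one vpow_def completion_single)
qed

lemma laurent_division: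
  fixes p :: "rat laurent"
  obtains g c where "p = (v - 1) * g + Poly_Mapping.single 0 c"
proof -
  have dvd: "(v - 1) dvd (vpow n - 1 :: rat laurent)" for n
  proof (induction n rule: int_induct[where k = 0])
    case base
    show ?case by (simp add: vpow_def single_one)
  next
    case (step1 i)
    have eq: "vpow (i + 1) - 1 = v * (vpow i - 1) + (v - 1 :: rat laurent)"
      by (simp add: vpow_def algebra_simps mult_single)
    show ?case unfolding eq using step1 by (intro dvd_add dvd_mult dvd_refl)
  next
    case (step2 i)
    have eq: "vpow (i - 1) - 1 = vpow (-1) * (vpow i - 1) - vpow (-1) * (v - 1 :: rat laurent)"
      by (simp add: vpow_def algebra_simps mult_single)
    show ?case unfolding eq
      by (rule dvd_diff[OF dvd_mult[OF step2(2)] dvd_mult[OF dvd_refl]])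
  qed
  have "\<exists>c. (v - 1) dvd (p - Poly_Mapping.single 0 c)"
  proof (induction p rule: laurent_induct)
    case (single n c)
    have "Poly_Mapping.single n c - Poly_Mapping.single 0 c =
        Poly_Mapping.single 0 c * (vpow n - 1)"
      by (simp add: vpow_def algebra_simps mult_single)
    then show ?case using dvd[of n] by (metis dvd_mult)
  next
    case (sum f g)
    then obtain c d where "(v - 1) dvd (f - Poly_Mapping.single 0 c)"
      "(v - 1) dvd (g - Poly_Mapping.single 0 d)" by blast
    then have "(v - 1) dvd ((f - Poly_Mapping.single 0 c) + (g - Poly_Mapping.single 0 d))"
      by (rule dvd_add)
    then have "(v - 1) dvd (f + g - Poly_Mapping.single 0 (c + d))"
      by (simp add: single_add algebra_simps)
    then show ?case by blast
  qed
  then obtain c g where "p - Poly_Mapping.single 0 c = (v - 1) * g" by (auto elim: dvdE)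
  then show thesis using that[of g c] by (simp add: algebra_simps)
qed

lemma completion_dvd_iff: "fps_X ^ n dvd laurent_to_R p \<longleftrightarrow> (v - 1) ^ n dvd p"
proof
  assume "(v - 1) ^ n dvd p"
  then obtain g where "p = (v - 1) ^ n * g" by (auto elim: dvdE)
  moreover have "laurent_to_R ((v - 1) ^ n) = fps_X ^ n"
    by (induction n) (simp_all add: completion_hom_one completion_hom_mult completion_v)
  ultimately show "fps_X ^ n dvd laurent_to_R p" by (simp add: completion_hom_mult)
next
  show "fps_X ^ n dvd laurent_to_R p \<Longrightarrow> (v - 1) ^ n dvd p"
  proof (induction n arbitrary: p)
    case 0
    show ?case by simp
  next
    case (Suc n)
    obtain g c where p: "p = (v - 1) * g + Poly_Mapping.single 0 c" by (rule laurent_division)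
    have eq: "laurent_to_R p = fps_X * laurent_to_R g + fps_const c"
      by (simp only: p completion_hom_add completion_hom_mult completion_v completion_single)
        simp
    obtain h where h: "laurent_to_R p = fps_X ^ Suc n * h" using Suc.prems by (auto elim: dvdE)
    have "laurent_to_R p $ 0 = 0" unfolding h by simp
    then have c: "c = 0" unfolding eq by simp
    have "fps_X * laurent_to_R g = fps_X * (fps_X ^ n * h)"
      using h eq c by (simp add: mult.assoc)
    then have "laurent_to_R g = fps_X ^ n * h" by simp
    then have "(v - 1) ^ n dvd g" using Suc.IH by simp
    then show ?case using p c by (simp add: mult_dvd_mono)
  qed
qed

lemma fps_X_power_dvd_iff_nth:
  "fps_X ^ n dvd (f :: rat fps) \<longleftrightarrow> (\<forall>i<n. f $ i = 0)"
proof
  show "fps_X ^ n dvd f \<Longrightarrow> \<forall>i<n. f $ i = 0"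
    by (auto elim!: dvdE simp: fps_X_power_mult_nth)
next
  assume "\<forall>i<n. f $ i = 0"
  then have "f = fps_X ^ n * fps_shift n f"
    by (auto simp: fps_eq_iff fps_X_power_mult_nth)
  then show "fps_X ^ n dvd f" by (metis dvd_triv_left)
qed

lemma completion_dense: "\<exists>p. fps_X ^ n dvd f - laurent_to_R p"
proof (induction n)
  case 0
  show ?case by simp
next
  case (Suc n)
  then obtain p h where p: "f - laurent_to_R p = fps_X ^ n * h" by (auto elim: dvdE)
  let ?p = "p + (v - 1) ^ n * Poly_Mapping.single 0 (h $ 0)"
  have pow: "laurent_to_R ((v - 1) ^ n) = fps_X ^ n"
    by (induction n) (simp_all add: completion_hom_one completion_hom_mult completion_v)
  have "f - laurent_to_R ?p = fps_X ^ n * (h - fps_const (h $ 0))"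
    using p by (simp add: completion_hom_add completion_hom_mult pow completion_single
        algebra_simps)
  moreover have "fps_X dvd h - fps_const (h $ 0)"
    using fps_X_power_dvd_iff_nth[of 1 "h - fps_const (h $ 0)"] by simp
  ultimately have "fps_X ^ Suc n dvd f - laurent_to_R ?p"
    by (metis mult_dvd_mono dvd_refl power_Suc2)
  then show ?case by blast
qed

lemma completion_limit:
  assumes "\<And>n. (v - 1) ^ n dvd p (Suc n) - p n"
  shows "\<exists>!f. \<forall>n. fps_X ^ n dvd f - laurent_to_R (p n)"
proof -
  have minus: "laurent_to_R (a - b) = laurent_to_R a - laurent_to_R b" for a b
    using completion_hom_add[of "a - b" b] by simp
  have "fps_X ^ n dvd laurent_to_R (p (Suc n)) - laurent_to_R (p n)" for n
    using assms[of n] by (simp add: completion_dvd_iff flip: minus)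
  then have step: "laurent_to_R (p (Suc n)) $ i = laurent_to_R (p n) $ i" if "i < n" for i n
    using that by (auto simp: fps_X_power_dvd_iff_nth)
  have stable: "laurent_to_R (p n) $ i = laurent_to_R (p (Suc i)) $ i" if "i < n" for i n
    using that
  proof (induction n)
    case 0
    then show ?case by simp
  next
    case (Suc n)
    then show ?case using step[of i n] by (cases "i = n") auto
  qed
  show ?thesis
  proof (rule ex1I)
    show "\<forall>n. fps_X ^ n dvd Abs_fps (\<lambda>i. laurent_to_R (p (Suc i)) $ i) - laurent_to_R (p n)"
      by (simp add: fps_X_power_dvd_iff_nth) (intro allI impI, rule stable[symmetric])
  next
    fix f
    assume "\<forall>n. fps_X ^ n dvd f - laurent_to_R (p n)"
    then have "f $ i = laurent_to_R (p (Suc i)) $ i" for i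
      by (auto simp: fps_X_power_dvd_iff_nth)
    then show "f = Abs_fps (\<lambda>i. laurent_to_R (p (Suc i)) $ i)"
      by (simp add: fps_eq_iff)
  qed
qed


section \<open>Hecke algebras\<close>

definition braid_group_ring ::
    "('a, 'm) monoid_scheme \<Rightarrow> 'a set \<Rightarrow> ('a word set \<Rightarrow>\<^sub>0 int laurent) ring" where
  "braid_group_ring W S = monoid_ring (braid_group W S)"

definition hecke_ideal ::
    "('a, 'm) monoid_scheme \<Rightarrow> 'a set \<Rightarrow> ('a word set \<Rightarrow>\<^sub>0 int laurent) set" where
  "hecke_ideal W S =
     (let c = Poly_Mapping.single \<one>\<^bsub>braid_group W S\<^esub>;
          b = (\<lambda>s. Poly_Mapping.single (braid_gen W S s) 1)
      in Idl\<^bsub>braid_group_ring W S\<^esub>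
           {(b s - c v) \<otimes>\<^bsub>braid_group_ring W S\<^esub> (b s + c (vpow (- 1))) | s. s \<in> S})"

definition hecke ::
    "('a, 'm) monoid_scheme \<Rightarrow> 'a set \<Rightarrow> ('a word set \<Rightarrow>\<^sub>0 int laurent) set ring" where
  "hecke W S = braid_group_ring W S Quot hecke_ideal W S"

definition hecke_scalar ::
    "('a, 'm) monoid_scheme \<Rightarrow> 'a set \<Rightarrow> int laurent \<Rightarrow> ('a word set \<Rightarrow>\<^sub>0 int laurent) set" where
  "hecke_scalar W S c =
     hecke_ideal W S +>\<^bsub>braid_group_ring W S\<^esub> Poly_Mapping.single \<one>\<^bsub>braid_group W S\<^esub> c"

definition hecke_T ::
    "('a, 'm) monoid_scheme \<Rightarrow> 'a set \<Rightarrow> 'a \<Rightarrow> ('a word set \<Rightarrow>\<^sub>0 int laurent) set" where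
  "hecke_T W S s =
     hecke_ideal W S +>\<^bsub>braid_group_ring W S\<^esub> Poly_Mapping.single (braid_gen W S s) 1"

definition hecke_sub ::
    "('a, 'm) monoid_scheme \<Rightarrow> 'a set \<Rightarrow> 'a set \<Rightarrow> ('a word set \<Rightarrow>\<^sub>0 int laurent) set set" where
  "hecke_sub W S I =
     generate_ring (hecke W S) (hecke_scalar W S ` UNIV \<union> hecke_T W S ` I)"

type_synonym 'a R_hecke_elem =
  "(rat fps \<times> ('a word set \<Rightarrow>\<^sub>0 int laurent) set \<Rightarrow>\<^sub>0 int) set"

definition R_hecke :: "('a, 'm) monoid_scheme \<Rightarrow> 'a set \<Rightarrow> 'a R_hecke_elem ring" where
  "R_hecke W S =
     tensor_algebra ring_of_type_algebra int_laurent_to_R ring_of_type_algebra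
       (hecke_scalar W S) (hecke W S)"

definition R_tensor ::
    "('a, 'm) monoid_scheme \<Rightarrow> 'a set \<Rightarrow> rat fps \<Rightarrow>
     ('a word set \<Rightarrow>\<^sub>0 int laurent) set \<Rightarrow> 'a R_hecke_elem" where
  "R_tensor W S =
     pure_tensor ring_of_type_algebra int_laurent_to_R ring_of_type_algebra
       (hecke_scalar W S) (hecke W S)"

text \<open>\<open>sub_span W S A K\<close> is \<open>A K \<subseteq> R H\<^sub>W\<close>, the image of \<open>A \<otimes> K\<close>, for subrings \<open>A \<subseteq> R\<close> and
  \<open>K \<subseteq> H\<^sub>W\<close>. In particular \<open>sub_span W S UNIV (hecke_sub W S I)\<close> is \<open>R H\<^sub>I\<close>.\<close>

definition sub_span ::
    "('a, 'm) monoid_scheme \<Rightarrow> 'a set \<Rightarrow> rat fps set \<Rightarrow>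
     ('a word set \<Rightarrow>\<^sub>0 int laurent) set set \<Rightarrow> 'a R_hecke_elem set" where
  "sub_span W S A K =
     generate (add_monoid (R_hecke W S)) {R_tensor W S a h | a h. a \<in> A \<and> h \<in> K}"

definition R_T :: "('a, 'm) monoid_scheme \<Rightarrow> 'a set \<Rightarrow> 'a \<Rightarrow> 'a R_hecke_elem" where
  "R_T W S s = R_tensor W S 1 (hecke_T W S s)"

text \<open>Specialization at \<open>v = 1\<close>, the ring homomorphism from \<open>R H\<^sub>W\<close> to \<open>R H\<^sub>W / (v - 1) = \<rat>W\<close> with
  \<open>T\<^sub>s \<mapsto> s\<close>. It restricts to \<open>R H\<^sub>I \<rightarrow> R H\<^sub>I / (v - 1) = \<rat>W\<^sub>I \<subseteq> \<rat>W\<close>.\<close>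

definition at_v_eq_1 ::
    "('a, 'm) monoid_scheme \<Rightarrow> 'a set \<Rightarrow> 'a R_hecke_elem \<Rightarrow> ('a \<Rightarrow>\<^sub>0 rat)" where
  "at_v_eq_1 W S =
     (THE \<phi>. \<phi> \<in> ring_hom (R_hecke W S) (monoid_ring W) \<and>
        \<phi> \<in> extensional (carrier (R_hecke W S)) \<and>
        (\<forall>r. \<phi> (R_tensor W S r \<one>\<^bsub>hecke W S\<^esub>) = Poly_Mapping.single \<one>\<^bsub>W\<^esub> (r $ 0)) \<and>
        (\<forall>s\<in>S. \<phi> (R_T W S s) = Poly_Mapping.single s 1))"

text \<open>Here \<open>w\<^sub>I s w\<^sub>I\<close> lies in \<open>I\<close> for \<open>s \<in> I\<close>, so \<^const>\<open>R_T\<close> is applied to elements of \<open>S\<close>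
  only.\<close>

definition is_tilde_w ::
    "('a, 'm) monoid_scheme \<Rightarrow> 'a set \<Rightarrow> 'a set \<Rightarrow> 'a R_hecke_elem \<Rightarrow> bool" where
  "is_tilde_w W S I x \<longleftrightarrow>
     (let w = longest_element W I in
       x \<in> sub_span W S UNIV (hecke_sub W S I) \<and>
       x \<otimes>\<^bsub>R_hecke W S\<^esub> x = \<one>\<^bsub>R_hecke W S\<^esub> \<and>
       at_v_eq_1 W S x = Poly_Mapping.single w 1 \<and>
       (\<forall>s\<in>I. x \<otimes>\<^bsub>R_hecke W S\<^esub> R_T W S s \<otimes>\<^bsub>R_hecke W S\<^esub> inv\<^bsub>R_hecke W S\<^esub> x =
          R_T W S (w \<otimes>\<^bsub>W\<^esub> s \<otimes>\<^bsub>W\<^esub> w)))"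

definition tilde_w :: "('a, 'm) monoid_scheme \<Rightarrow> 'a set \<Rightarrow> 'a set \<Rightarrow> 'a R_hecke_elem" where
  "tilde_w W S I = (THE x. is_tilde_w W S I x)"

end

theory Submission
  imports Defs "Jordan_Normal_Form.Schur_Decomposition" "HOL-Library.Function_Algebras"
begin

text \<open>Let \<open>z = T w\<^sub>I\<^sup>2\<close>, where \<open>T w\<close> is the standard basis element of \<open>w\<close>. It is central in
  \<open>H\<^sub>I\<close> and specializes to \<open>1\<close> at \<open>v = 1\<close>, and \<open>T w\<^sub>I y\<^sup>-\<^sup>1\<close> is the element sought
  once \<open>y\<close> is a square root of \<open>z\<close> that is a polynomial in \<open>z\<close> and specializes to \<open>1\<close>.
  Such a \<open>y\<close> has coefficients in the localization because \<open>z\<close> is a root of a product of factors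
  \<open>t - v\<^sup>2\<^sup>k\<close>: modulo such a product \<open>t\<close> has a square root over the localization, by Newton's
  method.

  That the eigenvalues of \<open>z\<close> are even powers of \<open>v\<close> is seen after specializing \<open>v\<close> to complex
  numbers. On an eigenspace of \<open>z\<close>, which is stable under \<open>H\<^sub>I\<close>, the determinant of each
  \<open>T s\<close> is up to sign a power of \<open>v\<close>; hence some power of the eigenvalue is an even power of
  \<open>v\<close>. As \<open>z\<close> is the identity both at \<open>v = 1\<close> and at \<open>v = -1\<close>, the eigenvalue itself is one.

  If \<open>x\<close> and \<open>y\<close> both have the properties of the element sought, then \<open>u = y x\<close> commutes with
  \<open>H\<^sub>I\<close>, \<open>u\<^sup>2 = 1\<close>, and \<open>u\<close> specializes to \<open>1\<close>; Nakayama's lemma gives \<open>u = 1\<close>.\<close>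

section \<open>The reflection cocycle and the exchange condition\<close>

text \<open>The obstacle is that the localization is not complete: \<open>1 + fps_X\<close> has a
  square root in R but none in the localization. So it matters that the eigenvalues of
  \<open>z\<close> are even powers of v. The evenness arises because a word of \<open>z\<close> runs
  twice through a word of the longest element, so that determinants of \<open>z\<close> are squares.

  Determinants control only the d-th power of an eigenvalue, d being the dimension of its
  eigenspace; this leaves open a root of unity and a divisibility of exponents. Substituting v =
  u^D, where D is the factorial of the order of W_I, makes the eigenvalue a monomial in u up to a
  root of unity, and both questions become statements about zeros of a Laurent polynomial in u.

  The spectral argument takes place on functions on W_I, where the generators act by explicit
  formulas over any commutative ring. The same formulas make sense over the complex numbers and over
  R, and \<open>Theta\<close> carries the resulting identity into the algebra. Linear independence
  enters modulo v - 1, as the independence of group elements in QW.\<close>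

fun mprod :: "('b, 'm) monoid_scheme \<Rightarrow> 'b list \<Rightarrow> 'b" where
  "mprod G [] = \<one>\<^bsub>G\<^esub>"
| "mprod G (x # xs) = x \<otimes>\<^bsub>G\<^esub> mprod G xs"

lemma (in monoid) mprod_closed [simp, intro]: "xs \<in> lists (carrier G) \<Longrightarrow> mprod G xs \<in> carrier G"
  by (induction xs) auto

lemma (in monoid) mprod_append:
  "xs \<in> lists (carrier G) \<Longrightarrow> ys \<in> lists (carrier G) \<Longrightarrow>
    mprod G (xs @ ys) = mprod G xs \<otimes> mprod G ys"
  by (induction xs) (auto simp: m_assoc)

text \<open>List version of \<open>alternating_word\<close>, so that the two letters can be replaced
  by elements of any monoid and multiplied by \<open>mprod\<close>.\<close>

fun alternating :: "nat \<Rightarrow> 'a \<Rightarrow> 'a \<Rightarrow> 'a list" where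
  "alternating 0 s t = []"
| "alternating (Suc n) s t = s # alternating n t s"

lemma length_alternating [simp]: "length (alternating n s t) = n"
  by (induction n arbitrary: s t) auto

lemma alternating_in_lists [simp, intro]: "s \<in> A \<Longrightarrow> t \<in> A \<Longrightarrow> alternating n s t \<in> lists A"
  by (induction n arbitrary: s t) auto

lemma alternating_word_eq: "alternating_word n s t = map (\<lambda>s. (s, True)) (alternating n s t)"
  by (induction n arbitrary: s t) auto

lemma map_alternating: "map f (alternating n s t) = alternating n (f s) (f t)"
  by (induction n arbitrary: s t) auto

lemma alternating_double:
  "alternating (2 * k) s t = concat (replicate k [s, t])"
  by (induction k) auto

lemma pres_eq_words: "pres_eq Y R u w \<Longrightarrow> u \<in> words Y \<and> w \<in> words Y"
  by (induction rule: pres_eq.induct) auto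

text \<open>Counts the \<open>i\<close> with \<open>r = s\<^sub>1 \<dots> s\<^sub>i \<dots> s\<^sub>1\<close>. The parity depends only on the element that the word
  represents, and this yields the exchange condition.\<close>

fun refl_count :: "('a, 'm) monoid_scheme \<Rightarrow> 'a list \<Rightarrow> 'a \<Rightarrow> nat" where
  "refl_count G [] r = 0"
| "refl_count G (s # us) r = of_bool (r = s) + refl_count G us (s \<otimes>\<^bsub>G\<^esub> r \<otimes>\<^bsub>G\<^esub> s)"

context coxeter_system
begin

lemma gen_closed [simp, intro]: "s \<in> S \<Longrightarrow> s \<in> carrier W"
  using generators_in_carrier by auto

lemma lists_gen_closed: "us \<in> lists S \<Longrightarrow> us \<in> lists (carrier W)"
  using generators_in_carrier by auto

lemma mprod_gen_closed [simp, intro]: "us \<in> lists S \<Longrightarrow> mprod W us \<in> carrier W"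
  by (rule mprod_closed[OF lists_gen_closed])

lemma gen_square: "s \<in> S \<Longrightarrow> s \<otimes> s = \<one>"
  using pow_ord_eq_1[of s] generators_order_two[of s] by (simp add: numeral_2_eq_2)

lemma gen_square_mult: "s \<in> S \<Longrightarrow> x \<in> carrier W \<Longrightarrow> s \<otimes> (s \<otimes> x) = x"
  by (simp add: gen_square flip: m_assoc)

lemma gen_inv: "s \<in> S \<Longrightarrow> inv s = s"
  using gen_square inv_equality by auto

lemma eval_word_eq_mprod: "u \<in> words S \<Longrightarrow> eval_word W u = mprod W (map fst u)"
  by (induction u) (auto simp: eval_word_def gen_inv)

lemma pres_eq_eval:
  "pres_eq S (coxeter_relations W S) u w \<Longrightarrow> mprod W (map fst u) = mprod W (map fst w)"
  using coxeter_presentation pres_eq_words[of S "coxeter_relations W S" u w]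
  by (auto simp: has_presentation_def eval_word_eq_mprod[symmetric])

text \<open>Reading off a letter \<open>s\<close> conjugates \<open>r\<close> by \<open>s\<close>,
  so reading off all of \<open>us\<close> conjugates by its product. This is the cocycle identity
  behind \<open>descent_mult\<close>.\<close>

lemma refl_count_append:
  assumes "us \<in> lists S" "r \<in> carrier W"
  shows "refl_count W (us @ ws) r =
    refl_count W us r + refl_count W ws (inv (mprod W us) \<otimes> r \<otimes> mprod W us)"
  using assms
proof (induction us arbitrary: r)
  case (Cons s us)
  then have "mprod W us \<in> carrier W" using lists_gen_closed by auto
  with Cons show ?case by (simp add: inv_mult_group gen_inv m_assoc)
qed simp

lemma gen_pow_commute:
  assumes "s \<in> S" "t \<in> S"
  shows "s \<otimes> (t \<otimes> s) [^] (i::nat) = (s \<otimes> t) [^] i \<otimes> s"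
proof (induction i)
  case (Suc i)
  have "s \<otimes> (t \<otimes> s) [^] Suc i = (s \<otimes> (t \<otimes> s) [^] i) \<otimes> (t \<otimes> s)"
    using assms by (simp add: m_assoc)
  also have "\<dots> = (s \<otimes> t) [^] Suc i \<otimes> s"
    unfolding Suc using assms by (simp add: m_assoc)
  finally show ?case .
qed (use assms in simp)

lemma pow_mult_gen_conj:
  assumes "s \<in> S" "t \<in> S" "r \<in> carrier W"
  shows "s \<otimes> r \<otimes> s = (t \<otimes> s) [^] (i::nat) \<otimes> t \<longleftrightarrow> r = (s \<otimes> t) [^] Suc i \<otimes> s"
proof -
  have c: "s \<otimes> ((t \<otimes> s) [^] i \<otimes> t) \<otimes> s = (s \<otimes> t) [^] Suc i \<otimes> s"
    using gen_pow_commute[OF assms(1,2), of i] assms by (simp flip: m_assoc)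
  show ?thesis
  proof
    assume "s \<otimes> r \<otimes> s = (t \<otimes> s) [^] i \<otimes> t"
    then have "s \<otimes> (s \<otimes> r \<otimes> s) \<otimes> s = (s \<otimes> t) [^] Suc i \<otimes> s" using c by simp
    then show "r = (s \<otimes> t) [^] Suc i \<otimes> s"
      using assms by (simp add: m_assoc gen_square gen_square_mult)
  next
    assume "r = (s \<otimes> t) [^] Suc i \<otimes> s"
    then show "s \<otimes> r \<otimes> s = (t \<otimes> s) [^] i \<otimes> t"
      unfolding c[symmetric] using assms by (simp add: m_assoc gen_square gen_square_mult)
  qed
qed

text \<open>The reflections met along the word s t s ... are the elements (st)^i s, in this order.
  Both the parity of the Coxeter relations and \<open>reduced_alternating_prefix\<close> rest on
  this list.\<close>

lemma refl_count_alternating: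
  assumes "s \<in> S" "t \<in> S" "r \<in> carrier W"
  shows "refl_count W (alternating k s t) r = (\<Sum>i<k. of_bool (r = (s \<otimes> t) [^] i \<otimes> s))"
  using assms
proof (induction k arbitrary: s t r)
  case (Suc k)
  have "(\<Sum>i<k. of_bool (s \<otimes> r \<otimes> s = (t \<otimes> s) [^] i \<otimes> t)) =
      (\<Sum>i<k. of_bool (r = (s \<otimes> t) [^] Suc i \<otimes> s) :: nat)"
    using Suc.prems by (intro sum.cong) (auto simp: pow_mult_gen_conj simp del: nat_pow_Suc)
  with Suc show ?case by (simp add: sum.lessThan_Suc_shift del: nat_pow_Suc sum.lessThan_Suc)
qed simp

text \<open>The list (st)^i s is periodic in i with period the order of st, and the word has twice
  that length, so each reflection is met in pairs. For infinite order the word is empty.\<close>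

lemma refl_count_relation_even:
  assumes "s \<in> S" "t \<in> S" "r \<in> carrier W"
  shows "even (refl_count W (concat (replicate (ord (s \<otimes> t)) [s, t])) r)"
proof -
  define m where "m = ord (s \<otimes> t)"
  define g where "g i = (of_bool (r = (s \<otimes> t) [^] i \<otimes> s) :: nat)" for i :: nat
  have "(\<Sum>i<n + m. g i) = (\<Sum>i<n. g i) + (\<Sum>i<m. g (i + n))" for n
    by (induction m) (simp_all add: add.commute)
  from this[of m] have "(\<Sum>i<2*m. g i) = (\<Sum>i<m. g i) + (\<Sum>i<m. g (i + m))"
    by (simp only: mult_2)
  moreover have "g (i + m) = g i" for i
    unfolding g_def m_def using assms pow_ord_eq_1[of "s \<otimes> t"] by (simp flip: nat_pow_mult)
  ultimately have "even (\<Sum>i<2*m. g i)" by simp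
  then show ?thesis
    using refl_count_alternating[OF assms, of "2*m"] by (simp add: g_def m_def alternating_double)
qed

text \<open>Every rule of \<open>pres_eq\<close> preserves the parity: a cancelled pair counts its
  letter twice, Coxeter relations are even, and concatenation follows from the cocycle identity
  because equivalent words have equal products.\<close>

lemma refl_count_parity:
  "pres_eq S (coxeter_relations W S) u w \<Longrightarrow> r \<in> carrier W \<Longrightarrow>
    even (refl_count W (map fst u) r) \<longleftrightarrow> even (refl_count W (map fst w) r)"
proof (induction arbitrary: r rule: pres_eq.induct)
  case (append u w u' w')
  have l: "map fst u \<in> lists S" "map fst w \<in> lists S"
    using pres_eq_words[OF append(1)] by (auto simp: in_lists_conv_set)
  then have "mprod W (map fst u) \<in> carrier W" using lists_gen_closed by blast
  then show ?case
    using l append.prems append.IH pres_eq_eval[OF append(1)] by (simp add: refl_count_append)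
next
  case (cancel x b)
  then have "x = x \<otimes> r \<otimes> x \<longleftrightarrow> r = x"
    by (metis gen_closed gen_square gen_square_mult m_assoc m_closed r_one)
  with cancel show ?case by (auto simp: of_bool_def)
next
  case (relation u w)
  then obtain s t where st: "s \<in> S" "t \<in> S" "w = []"
    and u: "u = concat (replicate (coxeter_mat W s t) [(s, True), (t, True)])"
    by (auto simp: coxeter_relations_def)
  have "map fst u = concat (replicate (ord (s \<otimes> t)) [s, t])"
    unfolding u coxeter_mat_def by (simp add: map_concat)
  then show ?case using refl_count_relation_even[OF st(1,2) relation.prems] st(3) by simp
qed auto

lemma refl_count_parity_mprod:
  assumes "us \<in> lists S" "ws \<in> lists S" "mprod W us = mprod W ws" "r \<in> carrier W"
  shows "even (refl_count W us r) \<longleftrightarrow> even (refl_count W ws r)"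
proof -
  let ?f = "map (\<lambda>s. (s, True))"
  have w: "?f us \<in> words S" "?f ws \<in> words S" using assms by auto
  have [simp]: "map fst (?f us) = us" "map fst (?f ws) = ws" by (simp_all add: comp_def)
  have "eval_word W (?f us) = eval_word W (?f ws)"
    using assms(3) by (simp only: eval_word_eq_mprod[OF w(1)] eval_word_eq_mprod[OF w(2)]
        \<open>map fst (?f us) = us\<close> \<open>map fst (?f ws) = ws\<close>)
  then have "pres_eq S (coxeter_relations W S) (?f us) (?f ws)"
    using coxeter_presentation w by (auto simp: has_presentation_def)
  from refl_count_parity[OF this assms(4)] show ?thesis by (simp add: comp_def)
qed

text \<open>If \<open>r\<close> is the i-th reflection of the word, multiplication by
  \<open>r\<close> on the left cancels the i-th letter.\<close>

lemma refl_count_deletion: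
  assumes "us \<in> lists S" "r \<in> carrier W" "refl_count W us r > 0"
  shows "\<exists>xs y zs. us = xs @ y # zs \<and> r \<otimes> mprod W us = mprod W (xs @ zs)"
  using assms
proof (induction arbitrary: r rule: lists.induct)
  case (Cons s us)
  have s: "s \<in> S" and c: "mprod W us \<in> carrier W" using Cons.hyps by auto
  show ?case
  proof (cases "r = s")
    case True
    then show ?thesis using s c
      by (intro exI[of _ "[]"] exI[of _ s] exI[of _ us]) (simp add: gen_square_mult)
  next
    case False
    then have "refl_count W us (s \<otimes> r \<otimes> s) > 0" using Cons.prems by simp
    moreover have "s \<otimes> r \<otimes> s \<in> carrier W" using s Cons.prems by simp
    ultimately obtain xs y zs where x: "us = xs @ y # zs"
      "s \<otimes> r \<otimes> s \<otimes> mprod W us = mprod W (xs @ zs)" using Cons.IH by blast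
    have "r \<otimes> mprod W (s # us) = s \<otimes> (s \<otimes> r \<otimes> s \<otimes> mprod W us)"
      using Cons.prems s c by (simp add: m_assoc gen_square_mult)
    then show ?thesis unfolding x(2) using x(1)
      by (intro exI[of _ "s # xs"] exI[of _ y] exI[of _ zs]) simp
  qed
qed simp

lemma mprod_rev:
  "us \<in> lists S \<Longrightarrow> mprod W (rev us) = inv (mprod W us)"
proof (induction us)
  case (Cons s us)
  then have "us \<in> lists (carrier W)" "rev us \<in> lists (carrier W)" using lists_gen_closed by auto
  with Cons show ?case by (simp add: mprod_append inv_mult_group gen_inv)
qed simp

text \<open>The quotient of the two alternating products of length k is (st)^k, which is trivial
  when k is the order of st.\<close>

lemma mprod_alternating_swap:
  assumes "s \<in> S" "t \<in> S"
  shows "mprod W (alternating (ord (s \<otimes> t)) s t) = mprod W (alternating (ord (s \<otimes> t)) t s)"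
proof -
  have cl: "mprod W (alternating k s t) \<in> carrier W" if "s \<in> S" "t \<in> S" for k s t
    using that by auto
  have "mprod W (alternating k s t) \<otimes> inv (mprod W (alternating k t s)) = (s \<otimes> t) [^] k"
    if "s \<in> S" "t \<in> S" for k s t
    using that
  proof (induction k arbitrary: s t)
    case (Suc k)
    have "mprod W (alternating (Suc k) s t) \<otimes> inv (mprod W (alternating (Suc k) t s)) =
      s \<otimes> (mprod W (alternating k t s) \<otimes> inv (mprod W (alternating k s t))) \<otimes> t"
      using Suc.prems cl[of s t k] cl[of t s k] by (simp add: inv_mult_group gen_inv m_assoc)
    also have "\<dots> = s \<otimes> (t \<otimes> s) [^] k \<otimes> t" using Suc.IH[of t s] Suc.prems by simp
    also have "\<dots> = (s \<otimes> t) [^] Suc k"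
      using Suc.prems by (simp add: gen_pow_commute m_assoc)
    finally show ?case .
  qed simp
  from this[OF assms, of "ord (s \<otimes> t)"] show ?thesis
    using assms cl[OF assms] cl[OF assms(2,1)] by (simp add: pow_ord_eq_1 inv_solve_right')
qed

end

section \<open>Length, descents and reduced words in a parabolic subgroup\<close>

locale coxeter_parabolic = coxeter_system W S for W :: "('a, 'm) monoid_scheme" (structure) and S +
  fixes I :: "'a set"
  assumes I_subset: "I \<subseteq> S"
begin

abbreviation WI where "WI \<equiv> parabolic W I"

lemma I_gen: "s \<in> I \<Longrightarrow> s \<in> S" and I_closed [simp]: "s \<in> I \<Longrightarrow> s \<in> carrier W"
  using I_subset by auto

lemma lists_I_gen: "us \<in> lists I \<Longrightarrow> us \<in> lists S"
  using I_subset by auto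

lemma mprod_I_closed [simp]: "us \<in> lists I \<Longrightarrow> mprod W us \<in> carrier W"
  by (rule mprod_gen_closed[OF lists_I_gen])

lemma WI_closed [simp]: "w \<in> WI \<Longrightarrow> w \<in> carrier W"
  using generate_incl[of I] I_subset generators_in_carrier by blast

lemma I_subset_carrier: "I \<subseteq> carrier W"
  using I_subset generators_in_carrier by blast

lemma WI_subgroup: "subgroup WI W"
  by (rule generate_is_subgroup[OF I_subset_carrier])

lemma WI_mult [simp]: "x \<in> WI \<Longrightarrow> y \<in> WI \<Longrightarrow> x \<otimes> y \<in> WI"
  by (rule subgroup.m_closed[OF WI_subgroup])

lemma WI_inv [simp]: "x \<in> WI \<Longrightarrow> inv x \<in> WI"
  by (rule subgroup.m_inv_closed[OF WI_subgroup])

lemma WI_one [simp]: "\<one> \<in> WI"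
  by (rule subgroup.one_closed[OF WI_subgroup])

lemma I_WI [simp]: "s \<in> I \<Longrightarrow> s \<in> WI"
  by (rule generate.incl)

lemma mprod_WI [simp]: "us \<in> lists I \<Longrightarrow> mprod W us \<in> WI"
  by (induction us) auto

lemma I_square [simp]: "s \<in> I \<Longrightarrow> s \<otimes> s = \<one>"
  using gen_square[OF I_gen] .

lemma I_inv [simp]: "s \<in> I \<Longrightarrow> inv s = s"
  using gen_inv[OF I_gen] .

lemma I_square_mult [simp]: "s \<in> I \<Longrightarrow> x \<in> carrier W \<Longrightarrow> s \<otimes> (s \<otimes> x) = x"
  using gen_square_mult[OF I_gen] .

lemma mprod_append_I:
  "us \<in> lists I \<Longrightarrow> ws \<in> lists I \<Longrightarrow> mprod W (us @ ws) = mprod W us \<otimes> mprod W ws"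
  using I_subset_carrier by (intro mprod_append) auto

lemma WI_word: "w \<in> WI \<Longrightarrow> \<exists>us. us \<in> lists I \<and> mprod W us = w"
proof (induction rule: generate.induct)
  case one
  show ?case by (intro exI[of _ "[]"]) simp
next
  case (incl s)
  then show ?case by (intro exI[of _ "[s]"]) simp
next
  case (inv s)
  then show ?case by (intro exI[of _ "[s]"]) simp
next
  case (eng x y)
  then obtain us ws where "us \<in> lists I" "mprod W us = x" "ws \<in> lists I" "mprod W ws = y" by blast
  then show ?case by (intro exI[of _ "us @ ws"]) (auto simp: mprod_append_I)
qed

text \<open>Length over \<open>I\<close> by words without formal inverses, which suffice because the
  letters are involutions; \<open>len_eq_word_length\<close> identifies it with
  \<open>word_length W I\<close>.\<close>

definition len :: "'a \<Rightarrow> nat" where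
  "len w = (LEAST n. \<exists>us. us \<in> lists I \<and> mprod W us = w \<and> length us = n)"

definition reduced :: "'a list \<Rightarrow> bool" where
  "reduced us \<longleftrightarrow> us \<in> lists I \<and> length us = len (mprod W us)"

definition descent :: "'a \<Rightarrow> 'a \<Rightarrow> bool" where
  "descent w r \<longleftrightarrow> odd (refl_count W (SOME us. us \<in> lists I \<and> mprod W us = w) r)"

lemma reduced_lists: "reduced us \<Longrightarrow> us \<in> lists I"
  by (simp add: reduced_def)

lemma ex_reduced: "w \<in> WI \<Longrightarrow> \<exists>us. reduced us \<and> mprod W us = w"
proof -
  assume "w \<in> WI"
  then have "\<exists>n us. us \<in> lists I \<and> mprod W us = w \<and> length us = n" using WI_word by blast
  then have "\<exists>us. us \<in> lists I \<and> mprod W us = w \<and> length us = len w"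
    unfolding len_def by (rule LeastI_ex)
  then show ?thesis by (auto simp: reduced_def)
qed

lemma len_le: "us \<in> lists I \<Longrightarrow> len (mprod W us) \<le> length us"
  unfolding len_def by (rule Least_le) auto

lemma reducedI: "us \<in> lists I \<Longrightarrow> length us \<le> len (mprod W us) \<Longrightarrow> reduced us"
  using len_le[of us] by (simp add: reduced_def)

lemma len_eq_word_length: "w \<in> WI \<Longrightarrow> word_length W I w = len w"
proof -
  have e: "eval_word W u = mprod W (map fst u)" if "u \<in> words I" for u
    using that I_subset by (intro eval_word_eq_mprod) auto
  have "(\<exists>u\<in>words I. length u = n \<and> eval_word W u = w) \<longleftrightarrow>
      (\<exists>us. us \<in> lists I \<and> mprod W us = w \<and> length us = n)" for n
  proof
    assume "\<exists>u\<in>words I. length u = n \<and> eval_word W u = w"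
    then obtain u where u: "u \<in> words I" "length u = n" "eval_word W u = w" by blast
    then show "\<exists>us. us \<in> lists I \<and> mprod W us = w \<and> length us = n"
      using e[OF u(1)] by (intro exI[of _ "map fst u"]) (auto simp: in_lists_conv_set)
  next
    assume "\<exists>us. us \<in> lists I \<and> mprod W us = w \<and> length us = n"
    then obtain us where us: "us \<in> lists I" "mprod W us = w" "length us = n" by blast
    let ?u = "map (\<lambda>s. (s, True)) us"
    have "?u \<in> words I" using us(1) by auto
    with us e[of ?u] show "\<exists>u\<in>words I. length u = n \<and> eval_word W u = w"
      by (intro bexI[of _ ?u]) (simp_all add: comp_def)
  qed
  then show ?thesis by (simp add: word_length_def len_def)
qed

lemma descent_mprod:
  assumes "us \<in> lists I" "r \<in> carrier W"
  shows "descent (mprod W us) r \<longleftrightarrow> odd (refl_count W us r)"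
proof -
  define ws where "ws = (SOME ws. ws \<in> lists I \<and> mprod W ws = mprod W us)"
  have "ws \<in> lists I \<and> mprod W ws = mprod W us"
    unfolding ws_def by (rule someI[of _ us]) (use assms in simp)
  then show ?thesis
    using refl_count_parity_mprod[of ws us r] assms lists_I_gen
    by (simp add: descent_def flip: ws_def)
qed

lemma descent_mult:
  assumes "x \<in> WI" "y \<in> WI" "r \<in> carrier W"
  shows "descent (x \<otimes> y) r \<longleftrightarrow> descent x r \<noteq> descent y (inv x \<otimes> r \<otimes> x)"
proof -
  obtain us ws where u: "us \<in> lists I" "mprod W us = x" "ws \<in> lists I" "mprod W ws = y"
    using WI_word assms by blast
  have "descent (mprod W (us @ ws)) r \<longleftrightarrow> odd (refl_count W (us @ ws) r)"
    using u assms by (intro descent_mprod) auto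
  moreover have "descent (mprod W us) r \<longleftrightarrow> odd (refl_count W us r)"
    using u assms by (intro descent_mprod) auto
  moreover have "descent (mprod W ws) (inv x \<otimes> r \<otimes> x) \<longleftrightarrow>
      odd (refl_count W ws (inv x \<otimes> r \<otimes> x))"
    using u assms by (intro descent_mprod) auto
  ultimately show ?thesis
    using u assms lists_I_gen[OF u(1)] by (simp add: mprod_append_I refl_count_append)
qed

lemma descent_gen: "s \<in> I \<Longrightarrow> r \<in> carrier W \<Longrightarrow> descent s r \<longleftrightarrow> r = s"
  using descent_mprod[of "[s]" r] by simp

lemma descent_gen_mult: "s \<in> I \<Longrightarrow> w \<in> WI \<Longrightarrow> descent (s \<otimes> w) s \<longleftrightarrow> \<not> descent w s"
  by (simp add: descent_mult descent_gen m_assoc)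

text \<open>By the cocycle identity only the reflection w t w^-1 changes its status when
  \<open>w\<close> is multiplied by \<open>t\<close> on the right, and this reflection is
  \<open>s\<close> exactly when s w = w t.\<close>

lemma descent_mult_gen:
  assumes "s \<in> I" "t \<in> I" "w \<in> WI"
  shows "descent (w \<otimes> t) s \<longleftrightarrow> descent w s \<noteq> (s \<otimes> w = w \<otimes> t)"
proof -
  have "inv w \<otimes> s \<otimes> w = t \<longleftrightarrow> s \<otimes> w = w \<otimes> t"
    using assms by (simp add: m_assoc inv_solve_left')
  then show ?thesis using assms by (simp add: descent_mult descent_gen)
qed

lemma descent_deletion:
  assumes "us \<in> lists I" "r \<in> carrier W" "descent (mprod W us) r"
  shows "\<exists>xs y zs. us = xs @ y # zs \<and> r \<otimes> mprod W us = mprod W (xs @ zs)"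
  using assms lists_I_gen refl_count_deletion[of us r] descent_mprod[of us r] by (auto elim: oddE)

lemma len_gen_mult_le: "s \<in> I \<Longrightarrow> w \<in> WI \<Longrightarrow> len (s \<otimes> w) \<le> Suc (len w)"
proof -
  assume "s \<in> I" "w \<in> WI"
  then obtain us where us: "us \<in> lists I" "length us = len w" "mprod W us = w"
    using ex_reduced unfolding reduced_def by metis
  then show "len (s \<otimes> w) \<le> Suc (len w)" using len_le[of "s # us"] \<open>s \<in> I\<close> by simp
qed

text \<open>An odd count is positive, so deletion yields a word of s w with one letter fewer; the
  other inequality is \<open>len_gen_mult_le\<close>.\<close>

lemma descent_len:
  assumes "s \<in> I" "w \<in> WI" "descent w s"
  shows "len w = Suc (len (s \<otimes> w))"
proof -
  obtain us where us: "reduced us" "mprod W us = w" using ex_reduced assms by blast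
  then obtain xs y zs where x: "us = xs @ y # zs" "s \<otimes> w = mprod W (xs @ zs)"
    using descent_deletion[of us s] assms reduced_lists[of us] by auto
  have "len (s \<otimes> w) \<le> length (xs @ zs)"
    unfolding x using reduced_lists[OF us(1)] x by (intro len_le) auto
  moreover have "len w = length us" using us by (simp add: reduced_def)
  moreover have "len w \<le> Suc (len (s \<otimes> w))"
    using len_gen_mult_le[of s "s \<otimes> w"] assms by simp
  ultimately show ?thesis using x by simp
qed

lemma not_descent_len:
  assumes "s \<in> I" "w \<in> WI" "\<not> descent w s"
  shows "len (s \<otimes> w) = Suc (len w)"
  using descent_len[of s "s \<otimes> w"] assms by (simp add: descent_gen_mult)

lemma descent_iff_len: "s \<in> I \<Longrightarrow> w \<in> WI \<Longrightarrow> descent w s \<longleftrightarrow> len (s \<otimes> w) < len w"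
  using descent_len[of s w] not_descent_len[of s w] by fastforce

lemma reduced_Cons:
  assumes "reduced (s # us)"
  shows "reduced us" "s \<in> I" "us \<in> lists I" "descent (s \<otimes> mprod W us) s" "\<not> descent (mprod W us) s"
proof -
  show *: "s \<in> I" "us \<in> lists I" using assms by (auto simp: reduced_def)
  have "Suc (length us) = len (s \<otimes> mprod W us)" using assms by (simp add: reduced_def)
  also have "\<dots> \<le> Suc (len (mprod W us))" using * by (intro len_gen_mult_le) auto
  finally show "reduced us" using * by (intro reducedI) auto
  then have "len (mprod W us) < len (s \<otimes> mprod W us)"
    using assms by (simp add: reduced_def)
  then show "\<not> descent (mprod W us) s"
    using * by (simp add: descent_iff_len)
  then show "descent (s \<otimes> mprod W us) s" using * by (simp add: descent_gen_mult)
qed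

lemma Cons_reduced:
  assumes "s \<in> I" "reduced us" "\<not> descent (mprod W us) s"
  shows "reduced (s # us)"
  using assms not_descent_len[of s "mprod W us"] by (auto simp: reduced_def)

lemma reduced_appendD: "reduced (us @ ws) \<Longrightarrow> reduced ws"
  by (induction us) (auto dest: reduced_Cons)

text \<open>The deleted letter must lie in \<open>xs\<close>: as \<open>s\<close> is no descent of
  the product of \<open>us\<close>, the cocycle identity makes the conjugate of \<open>s\<close> by
  that product a descent of the product of \<open>xs\<close>.\<close>

lemma exchange_suffix:
  assumes "s \<in> I" "us \<in> lists I" "xs \<in> lists I"
    and "descent (mprod W (us @ xs)) s" "\<not> descent (mprod W us) s"
  shows "\<exists>ys. ys \<in> lists I \<and> Suc (length ys) = length xs \<and>
    mprod W (s # us @ ys) = mprod W (us @ xs)"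
proof -
  let ?u = "mprod W us"
  define r where "r = inv ?u \<otimes> s \<otimes> ?u"
  have r: "r \<in> carrier W" using assms by (simp add: r_def)
  have "descent (mprod W xs) r"
    using assms by (simp add: mprod_append_I descent_mult r_def)
  then obtain bs y cs where x: "xs = bs @ y # cs" "r \<otimes> mprod W xs = mprod W (bs @ cs)"
    using descent_deletion[OF assms(3) r] by blast
  have l: "bs @ cs \<in> lists I" using assms x by auto
  have "s \<otimes> (?u \<otimes> mprod W (bs @ cs)) = s \<otimes> (?u \<otimes> (r \<otimes> mprod W xs))"
    by (simp only: x(2))
  also have "\<dots> = s \<otimes> (?u \<otimes> inv ?u \<otimes> s \<otimes> ?u \<otimes> mprod W xs)"
    unfolding r_def using assms by (simp only: m_assoc m_closed inv_closed I_closed mprod_I_closed)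
  also have "\<dots> = ?u \<otimes> mprod W xs"
    using assms by (simp add: m_assoc)
  finally show ?thesis
    using assms l x by (intro exI[of _ "bs @ cs"]) (simp add: mprod_append_I)
qed

text \<open>A word of \<open>w\<close> that starts with an alternating word in two left descents of \<open>w\<close> can be
  lengthened by exchange: the letter deleted cannot lie in the alternating part, as the order of
  \<open>s t\<close> is not yet reached.\<close>

lemma reduced_alternating_prefix:
  assumes "s \<in> I" "t \<in> I" "s \<noteq> t" "w \<in> WI" "descent w s" "descent w t"
    and "j \<le> ord (s \<otimes> t) \<or> ord (s \<otimes> t) = 0"
  shows "\<exists>xs. reduced (alternating j s t @ xs) \<and> mprod W (alternating j s t @ xs) = w"
  using assms
proof (induction j arbitrary: s t)
  case 0
  then show ?case using ex_reduced by auto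
next
  case (Suc j)
  note st = \<open>s \<in> I\<close> \<open>t \<in> I\<close>
  have ord_swap: "ord (t \<otimes> s) = ord (s \<otimes> t)"
    using st ord_inv[of "s \<otimes> t"] by (simp add: inv_mult_group)
  with Suc.IH[of t s] Suc.prems obtain xs
    where xs: "reduced (alternating j t s @ xs)" "mprod W (alternating j t s @ xs) = w"
    by (auto simp: )
  let ?a = "alternating j t s"
  have a: "?a \<in> lists I" "xs \<in> lists I" using reduced_lists[OF xs(1)] by auto
  have "s \<noteq> (t \<otimes> s) [^] i \<otimes> t" if "i < j" for i
  proof
    assume "s = (t \<otimes> s) [^] i \<otimes> t"
    then have "s \<otimes> s = (t \<otimes> s) [^] i \<otimes> t \<otimes> s" by simp
    then have "(t \<otimes> s) [^] Suc i = \<one>" using st by (simp add: m_assoc)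
    then have "ord (t \<otimes> s) dvd Suc i" using st pow_eq_id[of "t \<otimes> s" "Suc i"] by simp
    with \<open>i < j\<close> Suc.prems(7) show False unfolding ord_swap by (auto dest: dvd_imp_le)
  qed
  then have zero: "refl_count W ?a s = 0"
    using st I_gen by (simp add: refl_count_alternating)
  then have "\<not> descent (mprod W ?a) s" using a st by (simp add: descent_mprod)
  then obtain ys where ys: "ys \<in> lists I" "Suc (length ys) = length xs"
      "mprod W (alternating (Suc j) s t @ ys) = w"
    using exchange_suffix[of s ?a xs] a st Suc.prems xs(2) by auto
  have "length (alternating (Suc j) s t @ ys) = length (?a @ xs)" using ys by simp
  also have "\<dots> = len w" using xs by (simp add: reduced_def)
  finally have "reduced (alternating (Suc j) s t @ ys)"
    using ys st by (simp add: reduced_def)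
  then show ?case using ys by blast
qed

text \<open>For infinite order, \<open>w\<close> would have a reduced word beginning with an
  alternating word longer than \<open>len w\<close>.\<close>

lemma descent_pair_ord:
  assumes "s \<in> I" "t \<in> I" "s \<noteq> t" "w \<in> WI" "descent w s" "descent w t"
  shows "ord (s \<otimes> t) \<noteq> 0"
proof
  assume "ord (s \<otimes> t) = 0"
  then obtain xs where "reduced (alternating (Suc (len w)) s t @ xs)"
      "mprod W (alternating (Suc (len w)) s t @ xs) = w"
    using reduced_alternating_prefix[of s t w "Suc (len w)"] assms by blast
  then show False by (auto simp: reduced_def)
qed

text \<open>Reduced words of \<open>w\<close> with the same first letter are compared by induction.
  If the first letters differ, both are descents, so \<open>w\<close> also has reduced words that
  begin with either alternating word of full length and share the tail; one braid relation links
  these two.\<close>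

theorem matsumoto:
  fixes T :: "'a \<Rightarrow> 'b" and M :: "('b, 'c) monoid_scheme"
  assumes M: "monoid M" and T: "\<And>s. s \<in> I \<Longrightarrow> T s \<in> carrier M"
    and braid: "\<And>s t. s \<in> I \<Longrightarrow> t \<in> I \<Longrightarrow>
      mprod M (alternating (ord (s \<otimes> t)) (T s) (T t)) = mprod M (alternating (ord (s \<otimes> t)) (T t) (T s))"
    and "reduced us" "reduced ws" "mprod W us = mprod W ws"
  shows "mprod M (map T us) = mprod M (map T ws)"
  using assms(4-)
proof (induction "length us" arbitrary: us ws)
  case 0
  then have "length ws = 0" by (simp add: reduced_def)
  with 0 show ?case by simp
next
  case (Suc n)
  interpret M: monoid M by fact
  obtain s us' where us: "us = s # us'" using Suc(2) by (cases us) auto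
  have "length ws = Suc n" using Suc by (simp add: reduced_def)
  then obtain t ws' where ws: "ws = t # ws'" by (cases ws) auto
  define w where "w = mprod W us"
  have len: "length us' = n" "length ws' = n" using Suc(2) us \<open>length ws = Suc n\<close> ws by auto
  note u = reduced_Cons[OF Suc(3)[unfolded us]] and v = reduced_Cons[OF Suc(4)[unfolded ws]]
  have w: "w = s \<otimes> mprod W us'" "w = t \<otimes> mprod W ws'" "w \<in> WI"
    using Suc.prems us ws u v by (auto simp: w_def simp del: in_listsI in_lists_conv_set)
  have step: "mprod M (map T (r # xs)) = mprod M (map T (r # ys))"
    if "reduced (r # xs)" "reduced (r # ys)" "mprod W (r # xs) = w" "mprod W (r # ys) = w" for r xs ys
  proof -
    note a = reduced_Cons[OF that(1)] and b = reduced_Cons[OF that(2)]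
    have "mprod W xs = mprod W ys"
      using that(3,4) a b by (metis I_closed I_square_mult mprod_I_closed mprod.simps(2))
    moreover have "length xs = n"
      using that(1,3) Suc(2) Suc(3) by (simp add: reduced_def w_def)
    ultimately have "mprod M (map T xs) = mprod M (map T ys)"
      using Suc(1)[of xs ys] a b by simp
    then show ?thesis by simp
  qed
  show ?case
  proof (cases "s = t")
    case True
    then show ?thesis using step[of s us' ws'] Suc.prems us ws by (simp add: w_def)
  next
    case False
    let ?m = "ord (s \<otimes> t)"
    have d: "descent w s" "descent w t" using u v w by auto
    have m: "?m \<noteq> 0" using descent_pair_ord[of s t w] u v w d False by blast
    obtain xs where xs: "reduced (alternating ?m s t @ xs)" "mprod W (alternating ?m s t @ xs) = w"
      using reduced_alternating_prefix[of s t w ?m] u v w d False by blast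
    have xl: "xs \<in> lists I" using reduced_lists[OF xs(1)] by auto
    have Txs: "map T xs \<in> lists (carrier M)" using xl T by (auto simp: in_lists_conv_set)
    have e: "mprod W (alternating ?m t s @ xs) = w"
      using xs(2) xl u v mprod_alternating_swap[of s t] I_gen by (simp add: mprod_append_I)
    have r: "reduced (alternating ?m t s @ xs)"
      using e xs xl u v by (simp add: reduced_def)
    obtain k where k: "?m = Suc k" using m by (cases ?m) auto
    have "mprod M (map T us) = mprod M (map T (alternating ?m s t @ xs))"
      using step[of s us' "alternating k t s @ xs"] xs Suc(3) us k by (simp add: w_def)
    also have "\<dots> = mprod M (map T (alternating ?m t s @ xs))"
      using Txs T u v braid[of s t] by (simp add: M.mprod_append map_alternating)
    also have "\<dots> = mprod M (map T ws)"
      using step[of t ws' "alternating k s t @ xs"] r e Suc.prems ws k by (simp add: w_def)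
    finally show ?thesis .
  qed
qed

text \<open>The letters of \<open>us\<close> are put in front one at a time, from the last to the
  first. Each exchange takes a letter from the tail, since the prefix with the new letter is
  reduced, and so the length stays that of \<open>w\<close>.\<close>

lemma reduced_extends:
  assumes w: "w \<in> WI" "\<And>s. s \<in> I \<Longrightarrow> descent w s" and "reduced us"
  shows "\<exists>xs. reduced (us @ xs) \<and> mprod W (us @ xs) = w"
  using assms(3)
proof (induction us)
  case Nil
  then show ?case using ex_reduced[OF w(1)] by simp
next
  case (Cons s us)
  note s = reduced_Cons[OF Cons.prems]
  obtain xs where xs: "reduced (us @ xs)" "mprod W (us @ xs) = w" using Cons.IH s by blast
  have l: "us \<in> lists I" "xs \<in> lists I" using reduced_lists[OF xs(1)] by auto
  obtain ys where ys: "ys \<in> lists I" "Suc (length ys) = length xs"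
      "mprod W (s # us @ ys) = mprod W (us @ xs)"
    using exchange_suffix[of s us xs] s l xs w(2) by auto
  have "length (s # us @ ys) = len w" using xs ys by (simp add: reduced_def)
  moreover have "mprod W ((s # us) @ ys) = w" using ys xs by simp
  ultimately show ?case using ys l s by (intro exI[of _ ys]) (simp add: reduced_def)
qed

lemma longest_factor:
  assumes w: "w \<in> WI" "\<And>s. s \<in> I \<Longrightarrow> descent w s" and x: "x \<in> WI"
  shows "\<exists>y\<in>WI. w = x \<otimes> y \<and> len w = len x + len y"
proof -
  obtain us where us: "reduced us" "mprod W us = x" using ex_reduced x by blast
  obtain xs where xs: "reduced (us @ xs)" "mprod W (us @ xs) = w"
    using reduced_extends[of w us] assms us by blast
  have l: "us \<in> lists I" "xs \<in> lists I" using reduced_lists[OF xs(1)] by auto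
  have "len (mprod W xs) = length xs" using reduced_appendD[OF xs(1)] by (simp add: reduced_def)
  then show ?thesis
    using us xs l by (intro bexI[of _ "mprod W xs"]) (auto simp: reduced_def mprod_append_I)
qed

lemma len_one [simp]: "len \<one> = 0"
  using len_le[of "[]"] by simp

lemma len_zero_iff: "x \<in> WI \<Longrightarrow> len x = 0 \<longleftrightarrow> x = \<one>"
  using ex_reduced[of x] by (auto simp: reduced_def)

lemma len_one_gen: "x \<in> WI \<Longrightarrow> len x = 1 \<Longrightarrow> x \<in> I"
  using ex_reduced[of x] by (auto simp: reduced_def length_Suc_conv)

lemma len_inv [simp]:
  assumes "x \<in> WI"
  shows "len (inv x) = len x"
proof -
  have le: "len (inv x) \<le> len x" if x: "x \<in> WI" for x
  proof -
    obtain us where us: "reduced us" "mprod W us = x" using ex_reduced[OF x] by blast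
    then have "mprod W (rev us) = inv x"
      using mprod_rev[of us] reduced_lists[of us] lists_I_gen by auto
    then show ?thesis
      using us reduced_lists[of us] len_le[of "rev us"]
      by (simp add: reduced_def in_lists_conv_set del: in_listsI)
  qed
  from le[of x] le[of "inv x"] assms show ?thesis by simp
qed

end

section \<open>The longest element of a finite parabolic subgroup\<close>

locale finite_coxeter_parabolic = coxeter_parabolic +
  assumes finite_WI: "finite WI"
begin

text \<open>An element of maximal length has all of \<open>I\<close> as descents, so every
  \<open>x\<close> divides it with additive lengths; if \<open>x\<close> is maximal too, the
  cofactor has length 0. This gives the \<open>THE\<close> in \<open>longest_element\<close> its
  meaning.\<close>

lemma ex1_longest: "\<exists>!w. w \<in> WI \<and> (\<forall>u\<in>WI. word_length W I u \<le> word_length W I w)"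
proof -
  have "Max (len ` WI) \<in> len ` WI" using finite_WI WI_one by (intro Max_in) blast+
  then obtain w where "w \<in> WI" "len w = Max (len ` WI)" by auto
  then have w: "w \<in> WI" "\<And>u. u \<in> WI \<Longrightarrow> len u \<le> len w" using finite_WI by auto
  have desc: "descent w s" if "s \<in> I" for s
    using w(2)[of "s \<otimes> w"] w(1) not_descent_len[of s w] that by fastforce
  show ?thesis
  proof (intro ex1I[of _ w] conjI ballI)
    fix x assume x: "x \<in> WI \<and> (\<forall>u\<in>WI. word_length W I u \<le> word_length W I x)"
    then obtain y where y: "y \<in> WI" "w = x \<otimes> y" "len w = len x + len y"
      using longest_factor[of w x] w(1) desc by blast
    moreover have "len w \<le> len x" using x w by (auto simp: len_eq_word_length)
    ultimately have "len y = 0" by simp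
    then show "x = w" using y x by (simp add: len_zero_iff)
  qed (use w in \<open>auto simp: len_eq_word_length\<close>)
qed

definition w0 where "w0 = longest_element W I"

lemma w0_WI [simp]: "w0 \<in> WI" and w0_max: "u \<in> WI \<Longrightarrow> len u \<le> len w0"
  using theI'[OF ex1_longest] by (auto simp: w0_def longest_element_def len_eq_word_length)

lemma w0_eqI:
  assumes "w \<in> WI" "len w0 \<le> len w"
  shows "w = w0"
proof -
  have "\<forall>u\<in>WI. word_length W I u \<le> word_length W I w"
    using assms w0_max by (auto simp: len_eq_word_length intro: order_trans)
  then have "longest_element W I = w"
    unfolding longest_element_def using assms by (intro the1_equality[OF ex1_longest]) auto
  then show ?thesis by (simp add: w0_def)
qed

lemma w0_descent: "s \<in> I \<Longrightarrow> descent w0 s"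
  using w0_max[of "s \<otimes> w0"] not_descent_len[of s w0] by fastforce

lemma w0_inv [simp]: "inv w0 = w0"
  by (rule w0_eqI) auto

lemma w0_square [simp]: "w0 \<otimes> w0 = \<one>"
  using r_inv[of w0] by simp

lemma w0_square_mult [simp]: "x \<in> carrier W \<Longrightarrow> w0 \<otimes> (w0 \<otimes> x) = x"
  by (simp flip: m_assoc)

text \<open>The cofactor y in w0 = (s w0) y has length 1, so it lies in \<open>I\<close>; solving
  for it gives y = w0 s w0.\<close>

lemma w0_conj:
  assumes "s \<in> I"
  shows "w0 \<otimes> s \<otimes> w0 \<in> I" "s \<otimes> w0 = w0 \<otimes> (w0 \<otimes> s \<otimes> w0)"
    "len w0 = Suc (len (s \<otimes> w0))"
proof -
  show l: "len w0 = Suc (len (s \<otimes> w0))"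
    using descent_len[of s w0] w0_descent assms by simp
  obtain y where y: "y \<in> WI" "w0 = s \<otimes> w0 \<otimes> y" "len w0 = len (s \<otimes> w0) + len y"
    using longest_factor[of w0 "s \<otimes> w0"] w0_descent assms by auto
  then have "y \<in> I" using l by (intro len_one_gen) auto
  have "w0 \<otimes> s \<otimes> (s \<otimes> w0 \<otimes> y) = y"
    using assms y(1) by (simp add: m_assoc)
  then have "w0 \<otimes> s \<otimes> w0 = y" using y(2) by simp
  then show "w0 \<otimes> s \<otimes> w0 \<in> I" using \<open>y \<in> I\<close> by simp
  show "s \<otimes> w0 = w0 \<otimes> (w0 \<otimes> s \<otimes> w0)"
    using assms by (simp add: m_assoc)
qed

text \<open>Reduced words of the longest element may be chosen to begin with any given letter and to
  end with its conjugate; this makes \<open>T\<close> of the longest element intertwine \<open>T s\<close> and its conjugate.\<close>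

lemma longest_intertwines:
  fixes T :: "'a \<Rightarrow> 'c" and M :: "('c, 'd) monoid_scheme"
  assumes M: "monoid M" and T: "\<And>s. s \<in> I \<Longrightarrow> T s \<in> carrier M"
    and braid: "\<And>us ws. reduced us \<Longrightarrow> reduced ws \<Longrightarrow> mprod W us = mprod W ws \<Longrightarrow>
      mprod M (map T us) = mprod M (map T ws)"
    and us: "reduced us" "mprod W us = w0" and s: "s \<in> I"
  shows "T s \<otimes>\<^bsub>M\<^esub> mprod M (map T us) = mprod M (map T us) \<otimes>\<^bsub>M\<^esub> T (w0 \<otimes> s \<otimes> w0)"
proof -
  interpret M: monoid M by fact
  let ?t = "w0 \<otimes> s \<otimes> w0"
  obtain xs where xs: "reduced xs" "mprod W xs = s \<otimes> w0" using ex_reduced[of "s \<otimes> w0"] s by auto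
  note xl = reduced_lists[OF xs(1)]
  note c = w0_conj[OF s]
  have Txs: "map T xs \<in> lists (carrier M)" using xl T by (auto simp: in_lists_conv_set)
  have e: "mprod W (s # xs) = w0" "mprod W (xs @ [?t]) = w0"
    using xs xl c(1) s by (simp_all add: mprod_append_I m_assoc)
  have "reduced (s # xs)" "reduced (xs @ [?t])"
    using e xl c xs s by (simp_all add: reduced_def)
  then have "mprod M (map T us) = T s \<otimes>\<^bsub>M\<^esub> mprod M (map T xs)"
      "mprod M (map T us) = mprod M (map T xs) \<otimes>\<^bsub>M\<^esub> T ?t"
    using braid[of us "s # xs"] braid[of us "xs @ [?t]"] us e T c(1) Txs
    by (simp_all add: M.mprod_append)
  then show ?thesis
    using T[OF s] T[OF c(1)] M.mprod_closed[OF Txs] M.m_assoc[of "T s" "mprod M (map T xs)" "T ?t"]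
    by simp
qed

section \<open>The left regular representation of the generic algebra\<close>

definition supp :: "('a \<Rightarrow> 'k::comm_ring_1) \<Rightarrow> bool" where
  "supp f \<longleftrightarrow> (\<forall>x. x \<notin> WI \<longrightarrow> f x = 0)"

definition delta :: "'a \<Rightarrow> 'a \<Rightarrow> 'k::comm_ring_1" where
  "delta w = (\<lambda>x. if x = w then 1 else 0)"

text \<open>T_s acting on the coefficient function of a combination of the T_w. It collects the
  coefficient of T_x from the rules T_s T_w = T_(sw) if \<open>s\<close> is no descent of w, and T_s
  T_w = T_(sw) + q T_w otherwise; \<open>q\<close> plays the role of v - v^-1.\<close>

definition lmul :: "'k::comm_ring_1 \<Rightarrow> 'a \<Rightarrow> ('a \<Rightarrow> 'k) \<Rightarrow> 'a \<Rightarrow> 'k" where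
  "lmul q s f = (\<lambda>x. if x \<in> WI then f (s \<otimes> x) + (if descent x s then q * f x else 0) else 0)"

text \<open>Right multiplication by T_t in the same coordinates. It moves identities between left
  multiplications from \<open>delta \<one>\<close> to all other basis functions.\<close>

definition rmul :: "'k::comm_ring_1 \<Rightarrow> 'a \<Rightarrow> ('a \<Rightarrow> 'k) \<Rightarrow> 'a \<Rightarrow> 'k" where
  "rmul q t f = (\<lambda>x. if x \<in> WI then f (x \<otimes> t) + (if descent (inv x) t then q * f x else 0) else 0)"

lemma supp_delta [simp]: "w \<in> WI \<Longrightarrow> supp (delta w)"
  by (auto simp: supp_def delta_def)

lemma supp_lmul [simp]: "supp (lmul q s f)"
  by (simp add: supp_def lmul_def)

lemma supp_foldr_lmul [simp]: "supp f \<Longrightarrow> supp (foldr (lmul q) us f)"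
  by (induction us) auto

lemma descent_inv_gen_mult:
  assumes "s \<in> I" "t \<in> I" "x \<in> WI"
  shows "descent (inv (s \<otimes> x)) t \<longleftrightarrow> descent (inv x) t \<noteq> (s \<otimes> x = x \<otimes> t)"
proof -
  have "t \<otimes> inv x = inv x \<otimes> s \<longleftrightarrow> inv (x \<otimes> t) = inv (s \<otimes> x)"
    using assms by (simp add: inv_mult_group)
  also have "\<dots> \<longleftrightarrow> s \<otimes> x = x \<otimes> t" using assms by (metis I_closed WI_closed inv_inv m_closed)
  finally show ?thesis
    using assms descent_mult_gen[of t s "inv x"] by (simp add: inv_mult_group)
qed

lemma descent_inv_eq:
  assumes "s \<in> I" "t \<in> I" "x \<in> WI" "s \<otimes> x = x \<otimes> t"
  shows "descent (inv x) t \<longleftrightarrow> descent x s"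
proof -
  have "inv (x \<otimes> t) = t \<otimes> inv x" using assms by (simp add: inv_mult_group)
  then have "len (t \<otimes> inv x) = len (x \<otimes> t)" using assms by (metis I_WI WI_mult len_inv)
  then show ?thesis using assms by (simp add: descent_iff_len)
qed

text \<open>The two operators interact only at points with s x = x t. There the left descent by
  \<open>s\<close> and the right descent by \<open>t\<close> agree at x, and both are reversed at s
  x.\<close>

lemma lmul_rmul_commute:
  assumes "s \<in> I" "t \<in> I"
  shows "lmul q s (rmul q t f) = rmul q t (lmul q s f)"
proof
  fix x
  show "lmul q s (rmul q t f) x = rmul q t (lmul q s f) x"
  proof (cases "x \<in> WI")
    case True
    then show ?thesis
      using assms descent_inv_gen_mult[of s t x] descent_mult_gen[of s t x] descent_inv_eq[of s t x]
      by (auto simp: lmul_def rmul_def m_assoc algebra_simps)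
  qed (simp add: lmul_def rmul_def)
qed

lemma foldr_lmul_rmul_commute:
  "us \<in> lists I \<Longrightarrow> t \<in> I \<Longrightarrow> foldr (lmul q) us (rmul q t f) = rmul q t (foldr (lmul q) us f)"
  by (induction us) (auto simp: lmul_rmul_commute)

lemma lmul_delta:
  assumes "s \<in> I" "w \<in> WI" "\<not> descent w s"
  shows "lmul q s (delta w) = delta (s \<otimes> w)"
proof
  fix x
  have "s \<otimes> x = w \<longleftrightarrow> x = s \<otimes> w" if "x \<in> WI" using that assms by auto
  then show "lmul q s (delta w) x = delta (s \<otimes> w) x"
    using assms by (auto simp: lmul_def delta_def)
qed

lemma rmul_delta:
  assumes "t \<in> I" "w \<in> WI" "\<not> descent (inv w) t"
  shows "rmul q t (delta w) = delta (w \<otimes> t)"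
proof
  fix x
  have "x \<otimes> t = w \<longleftrightarrow> x = w \<otimes> t" if "x \<in> WI"
    using that assms by (auto simp: m_assoc)
  then show "rmul q t (delta w) x = delta (w \<otimes> t) x"
    using assms by (auto simp: rmul_def delta_def)
qed

lemma foldr_lmul_delta: "reduced us \<Longrightarrow> foldr (lmul q) us (delta \<one>) = delta (mprod W us)"
proof (induction us)
  case (Cons s us)
  with reduced_Cons[OF Cons.prems] show ?case by (simp add: lmul_delta)
qed simp

lemma lmul_sum:
  assumes "finite A"
  shows "lmul q s (\<lambda>x. \<Sum>w\<in>A. c w * g w x) = (\<lambda>x. \<Sum>w\<in>A. c w * lmul q s (g w) x)"
proof
  fix x
  show "lmul q s (\<lambda>x. \<Sum>w\<in>A. c w * g w x) x = (\<Sum>w\<in>A. c w * lmul q s (g w) x)"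
    by (cases "x \<in> WI"; cases "descent x s")
      (simp_all add: lmul_def sum.distrib distrib_left sum_distrib_left mult.left_commute)
qed

lemma foldr_lmul_sum:
  "finite A \<Longrightarrow> foldr (lmul q) us (\<lambda>x. \<Sum>w\<in>A. c w * g w x) = (\<lambda>x. \<Sum>w\<in>A. c w * foldr (lmul q) us (g w) x)"
  by (induction us) (auto simp: lmul_sum)

lemma delta_expansion: "supp f \<Longrightarrow> f = (\<lambda>x. \<Sum>w\<in>WI. f w * delta w x)"
  using finite_WI by (auto simp: supp_def delta_def fun_eq_iff if_distrib[of "\<lambda>y. _ * y"] sum.delta' cong: if_cong)

text \<open>Left multiplications commute with right multiplications, so that they are determined by
  their values at \<open>\<one>\<close>.\<close>

lemma foldr_lmul_eqI:
  assumes "us \<in> lists I" "ws \<in> lists I"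
    and one: "foldr (lmul q) us (delta \<one>) = foldr (lmul q) ws (delta \<one>)" and "supp f"
  shows "foldr (lmul q) us f = foldr (lmul q) ws f"
proof -
  have d: "foldr (lmul q) us (delta w) = foldr (lmul q) ws (delta w)" if "w \<in> WI" for w
    using that
  proof (induction "len w" arbitrary: w rule: less_induct)
    case less
    show ?case
    proof (cases "w = \<one>")
      case False
      then have "inv w \<noteq> \<one>" using less.prems by (metis WI_closed inv_inv inv_one)
      obtain vs where vs: "reduced vs" "mprod W vs = inv w" using ex_reduced[of "inv w"] less.prems by auto
      with \<open>inv w \<noteq> \<one>\<close> obtain t vs' where t: "vs = t # vs'" by (cases vs) auto
      have tI: "t \<in> I" "descent (inv w) t" using reduced_Cons[of t vs'] vs t by auto
      define y where "y = w \<otimes> t"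
      have y: "y \<in> WI" "y \<otimes> t = w" "inv y = t \<otimes> inv w"
        using less.prems tI by (auto simp: y_def m_assoc inv_mult_group)
      have "len (inv w) = Suc (len (inv y))" using descent_len[of t "inv w"] tI less.prems y by simp
      then have "len y < len w" using y(1) less.prems by simp
      then have IH: "foldr (lmul q) us (delta y) = foldr (lmul q) ws (delta y)" using less.hyps y by simp
      have "\<not> descent (inv y) t" using descent_gen_mult[of t "inv w"] tI less.prems y by simp
      then have "delta w = rmul q t (delta y)" using rmul_delta[of t y q] tI y by simp
      then show ?thesis using IH foldr_lmul_rmul_commute assms(1,2) tI by metis
    qed (use one in simp)
  qed
  show ?thesis
    using foldr_lmul_sum[OF finite_WI, of q us f delta] foldr_lmul_sum[OF finite_WI, of q ws f delta] d
    unfolding delta_expansion[OF assms(4), symmetric] by (auto simp: fun_eq_iff)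
qed

text \<open>Both words send \<open>delta \<one>\<close> to the delta function of their common
  product, and \<open>foldr_lmul_eqI\<close> spreads the equality to all functions supported on
  \<open>WI\<close>. Thus the braid relations for \<open>lmul\<close> come from the commuting right
  action.\<close>

lemma foldr_lmul_reduced:
  fixes q :: "'k::comm_ring_1"
  assumes "reduced us" "reduced ws" "mprod W us = mprod W ws"
  shows "foldr (lmul q) us = foldr (lmul q) ws"
proof (cases "us = []")
  case True
  have "length ws = length us" using assms unfolding reduced_def by metis
  with True show ?thesis by simp
next
  case False
  have "length ws = length us" using assms unfolding reduced_def by metis
  with False have F: "ws \<noteq> []" by auto
  \<comment> \<open>The innermost operator reads its argument on \<open>WI\<close> alone, so a
    nonempty word does not see values elsewhere. The empty word does, whence the case
    distinction.\<close>
  have restrict: "foldr (lmul q) vs f = foldr (lmul q) vs (\<lambda>x. if x \<in> WI then f x else 0)"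
    if "vs \<noteq> []" "vs \<in> lists I" for vs and f :: "'a \<Rightarrow> 'k"
  proof -
    obtain vs' s where vs: "vs = vs' @ [s]" using \<open>vs \<noteq> []\<close> by (metis append_butlast_last_id)
    then have s: "s \<in> I" using \<open>vs \<in> lists I\<close> by auto
    have e: "lmul q s f = lmul q s (\<lambda>x. if x \<in> WI then f x else 0)"
      unfolding lmul_def using s by (intro ext) simp
    have a: "foldr (lmul q) vs g = foldr (lmul q) vs' (lmul q s g)" for g
      by (simp add: vs)
    show ?thesis unfolding a by (rule arg_cong[OF e])
  qed
  show ?thesis
  proof
    fix f :: "'a \<Rightarrow> 'k"
    let ?f = "\<lambda>x. if x \<in> WI then f x else 0"
    have l: "us \<in> lists I" "ws \<in> lists I" using assms reduced_lists by blast+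
    have "supp ?f" by (simp add: supp_def)
    then have e: "foldr (lmul q) us ?f = foldr (lmul q) ws ?f"
      by (rule foldr_lmul_eqI[OF l, rotated]) (simp only: foldr_lmul_delta[OF assms(1)]
          foldr_lmul_delta[OF assms(2)] assms(3))
    have "foldr (lmul q) us f = foldr (lmul q) us ?f" by (rule restrict[OF False l(1)])
    also note e
    also have "foldr (lmul q) ws ?f = foldr (lmul q) ws f" by (rule restrict[OF F l(2), symmetric])
    finally show "foldr (lmul q) us f = foldr (lmul q) ws f" .
  qed
qed

definition w0_word :: "'a list" where
  "w0_word = (SOME us. reduced us \<and> mprod W us = w0)"

lemma w0_word: "reduced w0_word" "mprod W w0_word = w0" "w0_word \<in> lists I" "length w0_word = len w0"
proof -
  have "reduced w0_word \<and> mprod W w0_word = w0"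
    unfolding w0_word_def by (rule someI_ex) (simp add: ex_reduced)
  then show "reduced w0_word" "mprod W w0_word = w0" "w0_word \<in> lists I" "length w0_word = len w0"
    by (auto simp: reduced_def)
qed

text \<open>Left multiplication by the square of T_w0, the image of the full twist of the braid
  group of W_I.\<close>

definition full_twist :: "'k::comm_ring_1 \<Rightarrow> ('a \<Rightarrow> 'k) \<Rightarrow> 'a \<Rightarrow> 'k" where
  "full_twist q = foldr (lmul q) (w0_word @ w0_word)"

lemma foldr_lmul_w0:
  assumes "s \<in> I"
  shows "lmul q s (foldr (lmul q) w0_word (f :: 'a \<Rightarrow> 'k::comm_ring_1)) = foldr (lmul q) w0_word (lmul q (w0 \<otimes> s \<otimes> w0) f)"
proof -
  \<comment> \<open>Self-maps under composition, the monoid to which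
    \<open>longest_intertwines\<close> is applied.\<close>
  define M :: "(('a \<Rightarrow> 'k) \<Rightarrow> ('a \<Rightarrow> 'k)) monoid"
    where "M = \<lparr>carrier = UNIV, monoid.mult = (\<circ>), monoid.one = id\<rparr>"
  have M: "monoid M" by unfold_locales (auto simp: M_def)
  have fold: "mprod M (map (lmul q) us) = foldr (lmul q) us" for us
    by (induction us) (auto simp: M_def)
  have "lmul q s \<otimes>\<^bsub>M\<^esub> mprod M (map (lmul q) w0_word) =
      mprod M (map (lmul q) w0_word) \<otimes>\<^bsub>M\<^esub> lmul q (w0 \<otimes> s \<otimes> w0)"
    using w0_word foldr_lmul_reduced assms
    by (intro longest_intertwines[OF M]) (auto simp: fold, auto simp: M_def)
  then show ?thesis unfolding fold by (auto simp: M_def fun_eq_iff)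
qed

lemma full_twist_commute:
  assumes "s \<in> I"
  shows "lmul q s (full_twist q f) = full_twist q (lmul q s f)"
proof -
  have "w0 \<otimes> (w0 \<otimes> s \<otimes> w0) \<otimes> w0 = s" using assms by (simp add: m_assoc)
  then show ?thesis
    using assms w0_conj(1)[OF assms] by (simp add: full_twist_def foldr_lmul_w0)
qed

lemma lmul_square:
  assumes "s \<in> I" "supp f"
  shows "lmul q s (lmul q s f) = (\<lambda>x. f x + q * lmul q s f x)"
proof
  fix x
  show "lmul q s (lmul q s f) x = f x + q * lmul q s f x"
    using assms by (cases "x \<in> WI")
      (auto simp: lmul_def supp_def descent_gen_mult algebra_simps)
qed

text \<open>At q = 0 the extra term disappears and T_s becomes translation by \<open>s\<close>. This
  covers v = 1 and v = -1 at once.\<close>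

lemma foldr_lmul_zero:
  "us \<in> lists I \<Longrightarrow> x \<in> WI \<Longrightarrow> foldr (lmul 0) us f x = f (inv (mprod W us) \<otimes> x)"
proof (induction us arbitrary: x)
  case (Cons s us)
  then show ?case by (auto simp: lmul_def inv_mult_group m_assoc)
qed simp

lemma full_twist_zero:
  assumes "supp f"
  shows "full_twist 0 f = f"
proof
  fix x
  show "full_twist 0 f x = f x"
  proof (cases "x \<in> WI")
    case True
    then show ?thesis
      using w0_word by (simp add: full_twist_def foldr_lmul_zero del: foldr_append)
        (simp add: mprod_append_I)
  next
    case False
    moreover have "supp (full_twist 0 f)" using assms by (simp add: full_twist_def)
    ultimately show ?thesis using assms by (simp add: supp_def)
  qed
qed

lemma supp_full_twist [simp]: "supp f \<Longrightarrow> supp (full_twist q f)"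
  by (simp add: full_twist_def)

lemma full_twist_sum:
  "finite A \<Longrightarrow> full_twist q (\<lambda>x. \<Sum>w\<in>A. c w * g w x) = (\<lambda>x. \<Sum>w\<in>A. c w * full_twist q (g w) x)"
  unfolding full_twist_def by (rule foldr_lmul_sum)

end

section \<open>Determinants on invariant subspaces\<close>

lemma prod_list_two_values:
  fixes c c' :: "'k::comm_ring_1"
  assumes "set as \<subseteq> {c, - c'}"
  shows "\<exists>a b. a + b = length as \<and> prod_list as = c ^ a * (- c') ^ b"
  using assms
proof (induction as)
  case (Cons x as)
  then obtain a b where ab: "a + b = length as" "prod_list as = c ^ a * (- c') ^ b" by auto
  consider "x = c" | "x = - c'" using Cons.prems by auto
  then show ?case
  proof cases
    case 1
    then show ?thesis using ab by (intro exI[of _ "Suc a"] exI[of _ b]) (simp add: mult.assoc)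
  next
    case 2
    then show ?thesis using ab
      by (intro exI[of _ a] exI[of _ "Suc b"]) (simp add: mult.left_commute)
  qed
qed auto

text \<open>The relation says (A - c)(A + c') = 0, so every eigenvalue is \<open>c\<close> or
  \<open>- c'\<close>. Triangularization makes the determinant the product of the eigenvalues with
  multiplicity.\<close>

lemma det_quadratic:
  fixes A :: "complex mat"
  assumes A: "A \<in> carrier_mat d d" and "c * c' = 1"
    and quad: "A * A = 1\<^sub>m d + (c - c') \<cdot>\<^sub>m A"
  shows "\<exists>a b. a + b = d \<and> det A = c ^ a * (- c') ^ b"
proof -
  obtain as where as: "char_poly A = (\<Prod>a\<leftarrow>as. [:- a, 1:])" "length as = d"
    using char_poly_factorized[OF A] by blast
  obtain B P Q where BPQ: "schur_decomposition A as = (B, P, Q)" by (metis prod_cases3)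
  from schur_decomposition[OF A as(1) BPQ]
  have B: "upper_triangular B" "similar_mat A B" "diag_mat B = as" and "similar_mat_wit A B P Q"
    by (auto simp: similar_mat_def)
  then have Bc: "B \<in> carrier_mat d d" using similar_mat_witD2[OF A] by blast
  have "det A = prod_list as"
    using det_similar[OF B(2)] det_upper_triangular[OF B(1) Bc] B(3) by simp
  moreover have "set as \<subseteq> {c, - c'}"
  proof
    fix a
    assume "a \<in> set as"
    then have "poly (char_poly A) a = 0"
      unfolding as by (auto simp: poly_prod_list prod_list_zero_iff)
    then have "eigenvalue A a" using eigenvalue_root_char_poly[OF A] by simp
    then obtain x where x: "x \<in> carrier_vec d" "x \<noteq> 0\<^sub>v d" "A *\<^sub>v x = a \<cdot>\<^sub>v x"
      using A by (auto simp: eigenvalue_def eigenvector_def)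
    have "(A * A) *\<^sub>v x = A *\<^sub>v (A *\<^sub>v x)"
      using A x(1) by (intro assoc_mult_mat_vec)
    also have "\<dots> = (a * a) \<cdot>\<^sub>v x"
      using x(1) A unfolding x(3) by (simp add: mult_mat_vec[of A d d] x(3) smult_smult_assoc)
    finally have sq: "(A * A) *\<^sub>v x = (a * a) \<cdot>\<^sub>v x" .
    have "((c - c') \<cdot>\<^sub>m A) *\<^sub>v x = (c - c') \<cdot>\<^sub>v (A *\<^sub>v x)"
      using x(1) A by (intro eq_vecI) (auto simp: scalar_prod_def sum_distrib_left mult.assoc)
    moreover have "(1\<^sub>m d + (c - c') \<cdot>\<^sub>m A) *\<^sub>v x = 1\<^sub>m d *\<^sub>v x + ((c - c') \<cdot>\<^sub>m A) *\<^sub>v x"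
      using x(1) A by (intro add_mult_distrib_mat_vec) auto
    ultimately have "(1\<^sub>m d + (c - c') \<cdot>\<^sub>m A) *\<^sub>v x = (1 + (c - c') * a) \<cdot>\<^sub>v x"
      using x(1) unfolding x(3) by (auto intro!: eq_vecI simp: algebra_simps)
    then have e: "(a * a) \<cdot>\<^sub>v x = (1 + (c - c') * a) \<cdot>\<^sub>v x"
      using sq quad by simp
    obtain i where i: "i < d" "vec_index x i \<noteq> 0" using x(1,2) by (metis carrier_vecD eq_vecI index_zero_vec)
    have "vec_index ((a * a) \<cdot>\<^sub>v x) i = vec_index ((1 + (c - c') * a) \<cdot>\<^sub>v x) i" using e by simp
    then have "a * a = 1 + (c - c') * a" using i x(1) by simp
    then have "(a - c) * (a + c') = 0" using \<open>c * c' = 1\<close> by (simp add: algebra_simps)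
    then show "a \<in> {c, - c'}" by (auto simp: eq_neg_iff_add_eq_0)
  qed
  ultimately show ?thesis using prod_list_two_values[of as c c'] as(2) by auto
qed

text \<open>Determinants on \<open>U\<close> are compared: the composite is the scalar
  \<open>l\<close>, so its determinant is l^d with d = dim U, while each factor contributes some c^a
  (- c')^b with a + b = d. Running through \<open>fs\<close> twice squares the product and removes
  the signs. The bound on d allows a uniform choice of exponent later.\<close>

lemma scalar_power_of_invariant_subspace:
  fixes scale :: "complex \<Rightarrow> 'b::ab_group_add \<Rightarrow> 'b" and c c' :: complex
  assumes "vector_space scale"
  assumes U: "Modules.module.subspace scale U" "U \<subseteq> Modules.module.span scale T" "finite T" "x \<in> U" "x \<noteq> 0"
    and lin: "\<And>f. f \<in> set fs \<Longrightarrow> Vector_Spaces.linear scale scale f"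
    and inv: "\<And>f x. f \<in> set fs \<Longrightarrow> x \<in> U \<Longrightarrow> f x \<in> U"
    and quad: "\<And>f x. f \<in> set fs \<Longrightarrow> x \<in> U \<Longrightarrow> f (f x) = x + scale (c - c') (f x)"
    and vw: "c * c' = 1"
    and eig: "\<And>x. x \<in> U \<Longrightarrow> foldr (\<lambda>f. f) (fs @ fs) x = scale l x"
  shows "\<exists>d a b. 0 < d \<and> d \<le> card T \<and> a + b = d * length fs \<and> l ^ d = (c ^ a * c' ^ b)\<^sup>2"
proof -
  interpret vector_space scale by fact
  interpret vector_space_pair scale scale ..
  obtain B where B: "B \<subseteq> U" "independent B" "U \<subseteq> span B" using maximal_independent_subset by blast
  have fin: "finite B" "card B \<le> card T"
    using independent_span_bound[OF U(3) B(2)] B(1) U(2) by auto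
  have UB: "U = span B" using B U(1) span_minimal by blast
  have "B \<noteq> {}" using U(4,5) UB by auto
  define d where "d = card B"
  have d: "0 < d" using \<open>B \<noteq> {}\<close> fin by (simp add: d_def card_gt_0_iff)
  obtain e where e: "bij_betw e {0..<d} B" using ex_bij_betw_nat_finite[OF fin(1)] d_def by blast
  have eB: "e i \<in> B" if "i < d" for i using e that by (auto simp: bij_betw_def)
  have eU: "e i \<in> U" if "i < d" for i using eB[OF that] B(1) by auto
  let ?r = "representation B"
  define M where "M f = mat d d (\<lambda>(i, j). ?r (f (e j)) (e i))" for f
  have M: "M f \<in> carrier_mat d d" for f by (simp add: M_def)
  have M_mult: "M (\<lambda>x. f (g x)) = M f * M g"
    if f: "Vector_Spaces.linear scale scale f" "\<And>x. x \<in> U \<Longrightarrow> f x \<in> U"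
      and g: "\<And>x. x \<in> U \<Longrightarrow> g x \<in> U" for f g
  proof (rule eq_matI)
    fix i j
    assume "i < dim_row (M f * M g)" "j < dim_col (M f * M g)"
    then have ij: "i < d" "j < d" by (simp_all add: M_def)
    have gU: "g (e j) \<in> span B" using g[OF eU[OF ij(2)]] UB by simp
    have "f (g (e j)) = f (\<Sum>b\<in>B. scale (?r (g (e j)) b) b)"
      using sum_representation_eq[OF B(2) gU fin(1)] by simp
    also have "\<dots> = (\<Sum>b\<in>B. scale (?r (g (e j)) b) (f b))"
      using f(1) by (simp add: linear_sum linear_scale)
    finally have "f (g (e j)) = (\<Sum>b\<in>B. scale (?r (g (e j)) b) (f b))" .
    moreover have "?r (\<Sum>b\<in>B. scale (?r (g (e j)) b) (f b)) = (\<lambda>z. \<Sum>b\<in>B. ?r (scale (?r (g (e j)) b) (f b)) z)"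
      using f(2) B UB by (intro representation_sum) (auto intro!: span_scale)
    ultimately have "?r (f (g (e j))) (e i) = (\<Sum>b\<in>B. ?r (scale (?r (g (e j)) b) (f b)) (e i))"
      by simp
    also have "\<dots> = (\<Sum>b\<in>B. ?r (g (e j)) b * ?r (f b) (e i))"
      using f(2) B UB by (intro sum.cong) (auto simp: representation_scale)
    also have "\<dots> = (\<Sum>k=0..<d. ?r (g (e j)) (e k) * ?r (f (e k)) (e i))"
      using sum.reindex_bij_betw[OF e, of "\<lambda>b. ?r (g (e j)) b * ?r (f b) (e i)"] by simp
    also have "\<dots> = (M f * M g) $$ (i, j)"
      using ij by (simp add: M_def scalar_prod_def mult.commute)
    finally show "M (\<lambda>x. f (g x)) $$ (i, j) = (M f * M g) $$ (i, j)" using ij by (simp add: M_def)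
  qed (simp_all add: M_def)
  have rb: "?r (e j) (e i) = (if i = j then 1 else 0)" if "i < d" "j < d" for i j
    using representation_basis[OF B(2) eB[OF that(2)]] e that
    by (auto simp: bij_betw_def inj_on_def)
  have M_scale: "M (scale k) = k \<cdot>\<^sub>m 1\<^sub>m d" for k
    using eU UB by (intro eq_matI) (auto simp: M_def representation_scale[OF B(2)] rb)
  have det_M: "\<exists>a b. a + b = d \<and> det (M f) = c ^ a * (- c') ^ b" if f: "f \<in> set fs" for f
  proof (rule det_quadratic[OF M vw])
    have "M f * M f = M (\<lambda>x. f (f x))" 
      by (rule M_mult[OF lin[OF f] inv[OF f] inv[OF f], symmetric])
    also have "\<dots> = 1\<^sub>m d + (c - c') \<cdot>\<^sub>m M f"
    proof (rule eq_matI)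
      fix i j
      assume "i < dim_row (1\<^sub>m d + (c - c') \<cdot>\<^sub>m M f)" "j < dim_col (1\<^sub>m d + (c - c') \<cdot>\<^sub>m M f)"
      then have ij: "i < d" "j < d" by (simp_all add: M_def)
      have s: "e j \<in> span B" "f (e j) \<in> span B" using eU[OF ij(2)] inv[OF f eU[OF ij(2)]] UB by simp_all
      have "?r (f (f (e j))) (e i) = ?r (e j) (e i) + (c - c') * ?r (f (e j)) (e i)"
        unfolding quad[OF f eU[OF ij(2)]] representation_add[OF B(2) span_scale[OF s(2)] s(1)]
          representation_scale[OF B(2) s(2)] by simp
      then show "M (\<lambda>x. f (f x)) $$ (i, j) = (1\<^sub>m d + (c - c') \<cdot>\<^sub>m M f) $$ (i, j)"
        using ij by (simp add: M_def rb)
    qed (simp_all add: M_def)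
    finally show "M f * M f = 1\<^sub>m d + (c - c') \<cdot>\<^sub>m M f" .
  qed
  have fold: "det (M (foldr (\<lambda>f. f) gs)) = (\<Prod>f\<leftarrow>gs. det (M f)) \<and>
      (\<forall>x\<in>U. foldr (\<lambda>f. f) gs x \<in> U)" if "set gs \<subseteq> set fs" for gs
    using that
  proof (induction gs)
    case Nil
    have "M (\<lambda>x. x) = 1\<^sub>m d" by (intro eq_matI) (auto simp: M_def rb)
    then show ?case by (simp add: id_def)
  next
    case (Cons f gs)
    then have f: "f \<in> set fs" by simp
    have gU: "\<And>x. x \<in> U \<Longrightarrow> foldr (\<lambda>f. f) gs x \<in> U" using Cons by auto
    have "M (foldr (\<lambda>f. f) (f # gs)) = M f * M (foldr (\<lambda>f. f) gs)"
      unfolding foldr.simps comp_def by (rule M_mult[OF lin[OF f] inv[OF f] gU])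
    then have "det (M (foldr (\<lambda>f. f) (f # gs))) = (\<Prod>f\<leftarrow>f # gs. det (M f))"
      using det_mult[OF M M] Cons by simp
    moreover have "\<forall>x\<in>U. foldr (\<lambda>f. f) (f # gs) x \<in> U" using gU inv[OF f] by simp
    ultimately show ?case by blast
  qed
  have "\<exists>a b. a + b = d * length gs \<and> (\<Prod>f\<leftarrow>gs. det (M f)) = c ^ a * (- c') ^ b"
    if "set gs \<subseteq> set fs" for gs
    using that
  proof (induction gs)
    case (Cons f gs)
    then obtain a b where ab: "a + b = d * length gs" "(\<Prod>f\<leftarrow>gs. det (M f)) = c ^ a * (- c') ^ b"
      by auto
    obtain a' b' where ab': "a' + b' = d" "det (M f) = c ^ a' * (- c') ^ b'"
      using det_M[of f] Cons.prems by auto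
    have "(\<Prod>f\<leftarrow>f # gs. det (M f)) = c ^ (a' + a) * (- c') ^ (b' + b)"
      using ab ab' by (simp only: list.map prod_list.Cons power_add) (simp only: mult_ac)
    moreover have "(a' + a) + (b' + b) = d * length (f # gs)" using ab(1) ab'(1) by simp
    ultimately show ?case by blast
  qed simp
  from this[of fs] obtain a b where ab: "a + b = d * length fs" "(\<Prod>f\<leftarrow>fs. det (M f)) = c ^ a * (- c') ^ b"
    by blast
  have "M (foldr (\<lambda>f. f) (fs @ fs)) = M (scale l)"
    using eU eig by (intro eq_matI) (auto simp: M_def simp del: foldr_append)
  then have "det (M (foldr (\<lambda>f. f) (fs @ fs))) = l ^ d" by (simp add: M_scale)
  then have "l ^ d = (c ^ a * (- c') ^ b)\<^sup>2"
    using fold[of "fs @ fs"] ab(2) by (simp add: power2_eq_square)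
  moreover have "((- c') ^ b)\<^sup>2 = (c' ^ b)\<^sup>2" by (simp flip: power_mult add: mult.commute[of b])
  ultimately have "l ^ d = (c ^ a * c' ^ b)\<^sup>2" by (simp only: power_mult_distrib)
  moreover have "d \<le> card T" using fin d_def by simp
  ultimately show ?thesis using ab(1) d by blast
qed

text \<open>The vector \<open>x\<close> is killed by g(Z) for some polynomial g of degree at most
  \<open>card T\<close>. Splitting off the roots of g one by one produces eigenvectors, whose
  eigenvalues lie in \<open>ls\<close>, so one application of the product over \<open>ls\<close>
  accounts for each root.\<close>

lemma annihilator:
  fixes scale :: "complex \<Rightarrow> 'b::ab_group_add \<Rightarrow> 'b"
  assumes "vector_space scale"
  assumes V: "finite T" "x \<in> Modules.module.span scale T"
    and lin: "Vector_Spaces.linear scale scale Z"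
    and inv: "\<And>x. x \<in> Modules.module.span scale T \<Longrightarrow> Z x \<in> Modules.module.span scale T"
    and eig: "\<And>l y. y \<in> Modules.module.span scale T \<Longrightarrow> y \<noteq> 0 \<Longrightarrow> Z y = scale l y \<Longrightarrow> l \<in> set ls"
  shows "(foldr (\<lambda>l y. Z y - scale l y) ls ^^ card T) x = 0"
proof -
  interpret vector_space scale by fact
  interpret vector_space_pair scale scale ..
  define st where "st l y = Z y - scale l y" for l y
  define P where "P = foldr st ls"
  let ?V = "span T"
  have st_lin: "Vector_Spaces.linear scale scale (st l)" for l
    using lin unfolding st_def by (intro linear_compose_sub linear_scale_self) 
  have P_gen: "Vector_Spaces.linear scale scale (foldr st ks) \<and>
      (\<forall>y\<in>?V. foldr st ks y \<in> ?V) \<and> (\<forall>l y. st l (foldr st ks y) = foldr st ks (st l y)) \<and>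
      (\<forall>l y. l \<in> set ks \<longrightarrow> st l y = 0 \<longrightarrow> foldr st ks y = 0)" for ks
  proof (induction ks)
    case Nil
    then show ?case using linear_id by (simp add: id_def)
  next
    case (Cons k ks)
    have c: "st l (st k y) = st k (st l y)" for l y
      unfolding st_def using lin
      by (simp add: linear_diff linear_scale scale_right_diff_distrib algebra_simps)
    have "Vector_Spaces.linear scale scale (st k \<circ> foldr st ks)"
      using Cons st_lin by (intro Vector_Spaces.linear_compose[OF _ st_lin]) auto
    moreover have "st k y \<in> ?V" if "y \<in> ?V" for y
      using that inv by (auto simp: st_def intro!: span_diff span_scale)
    moreover have "foldr st (k # ks) y = 0" if "l \<in> set (k # ks)" "st l y = 0" for l y
    proof (cases "l = k")
      case True
      have "foldr st (k # ks) y = foldr st ks (st k y)" using Cons by simp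
      moreover have "foldr st ks 0 = 0" using Cons linear_0 by blast
      ultimately show ?thesis using that True by simp
    next
      case False
      then have "foldr st ks y = 0" using that Cons by auto
      then show ?thesis using linear_0[OF st_lin] by simp
    qed
    ultimately show ?case using Cons c by (simp add: comp_def)
  qed
  have P: "Vector_Spaces.linear scale scale P" "\<And>y. y \<in> ?V \<Longrightarrow> P y \<in> ?V" "\<And>l y. st l (P y) = P (st l y)"
      "\<And>l y. l \<in> set ls \<Longrightarrow> st l y = 0 \<Longrightarrow> P y = 0"
    using P_gen[of ls] by (auto simp: P_def)
  have Pk: "(P ^^ k) y \<in> ?V" if "y \<in> ?V" for k y using that P(2) by (induction k) auto
  have Pst: "st l ((P ^^ k) y) = (P ^^ k) (st l y)" for l k y using P(3) by (induction k) auto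
  have P0: "(P ^^ k) 0 = 0" for k using linear_0[OF P(1)] by (induction k) auto
  \<comment> \<open>This is g(Z) y. By \<open>ev_bound\<close> the sum may run beyond the degree,
    which helps where only a degree bound is at hand.\<close>
  define ev where "ev g y = (\<Sum>i\<le>Polynomial.degree g. scale (poly.coeff g i) ((Z ^^ i) y))" for g y
  have ev_bound: "ev g y = (\<Sum>i\<le>n. scale (poly.coeff g i) ((Z ^^ i) y))" if "Polynomial.degree g \<le> n" for g n y
    unfolding ev_def using that
    by (intro sum.mono_neutral_left) (auto simp: Polynomial.coeff_eq_0)
  have Zk: "(Z ^^ k) (st l y) = (Z ^^ Suc k) y - scale l ((Z ^^ k) y)" for k l y
    using lin by (induction k) (auto simp: st_def linear_diff linear_scale)
  have step: "ev ([:- m, 1:] * h) y = ev h (st m y)" for m h y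
  proof -
    let ?n = "Polynomial.degree h"
    have "Polynomial.degree ([:- m, 1:] * h) \<le> Suc ?n"
      using Polynomial.degree_mult_le[of "[:- m, 1:]" h] by simp
    then have "ev ([:- m, 1:] * h) y = (\<Sum>i\<le>Suc ?n. scale (poly.coeff ([:- m, 1:] * h) i) ((Z ^^ i) y))"
      by (rule ev_bound)
    also have "\<dots> = (\<Sum>i\<le>Suc ?n. scale (poly.coeff (pCons 0 h) i) ((Z ^^ i) y)) -
        (\<Sum>i\<le>Suc ?n. scale (m * poly.coeff h i) ((Z ^^ i) y))"
      by (simp add: sum_subtractf[symmetric] scale_left_diff_distrib del: sum.atMost_Suc)
    also have "(\<Sum>i\<le>Suc ?n. scale (poly.coeff (pCons 0 h) i) ((Z ^^ i) y)) =
        (\<Sum>i\<le>?n. scale (poly.coeff h i) ((Z ^^ Suc i) y))"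
      by (simp add: sum.atMost_Suc_shift del: sum.atMost_Suc funpow.simps)
    also have "(\<Sum>i\<le>Suc ?n. scale (m * poly.coeff h i) ((Z ^^ i) y)) =
        (\<Sum>i\<le>?n. scale (poly.coeff h i) (scale m ((Z ^^ i) y)))"
      by (simp add: Polynomial.coeff_eq_0 mult.commute)
    finally show ?thesis
      by (simp add: ev_def Zk sum_subtractf scale_right_diff_distrib del: funpow.simps)
  qed
  \<comment> \<open>With g = (t - m) h, the induction hypothesis for h and (Z - m) y shows that P^k
    y is zero or an eigenvector for m; in both cases one more \<open>P\<close> kills it.\<close>
  have main: "(P ^^ k) y = 0" if "g \<noteq> 0" "Polynomial.degree g = k" "y \<in> ?V" "ev g y = 0" for k g y
    using that
  proof (induction k arbitrary: g y)
    case 0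
    then obtain c where "g = [:c:]" "c \<noteq> 0" by (auto elim: degree_eq_zeroE)
    then show ?case using 0 by (simp add: ev_def)
  next
    case (Suc k)
    then have "\<not> constant (poly g)" by (simp add: constant_degree)
    then obtain m where "poly g m = 0" using fundamental_theorem_of_algebra by blast
    then obtain h where h: "g = [:- m, 1:] * h" by (auto simp: poly_eq_0_iff_dvd)
    have h0: "h \<noteq> 0" using Suc.prems(1) h by auto
    moreover have "Polynomial.degree h = k"
      using Suc.prems(2) Polynomial.degree_mult_eq[of "[:- m, 1:]" h] h0 unfolding h
      by (simp del: mult_pCons_left)
    moreover have "st m y \<in> ?V" using Suc.prems(3) inv by (auto simp: st_def intro!: span_diff span_scale)
    ultimately have "(P ^^ k) (st m y) = 0" using Suc.IH[of h "st m y"] Suc.prems(4) step h by simp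
    then have s: "st m ((P ^^ k) y) = 0" by (simp add: Pst)
    show ?case
    proof (cases "(P ^^ k) y = 0")
      case True
      then show ?thesis using linear_0[OF P(1)] by simp
    next
      case False
      then have "m \<in> set ls" using s Pk[OF Suc.prems(3)] by (intro eig) (auto simp: st_def)
      then show ?thesis using P(4) s by simp
    qed
  qed
  let ?n = "card T"
  \<comment> \<open>Among the \<open>card T + 1\<close> vectors x, Z x, Z^2 x, ... either two
    coincide, which gives t^j - t^i, or all are distinct and hence linearly dependent.\<close>
  obtain g where g: "g \<noteq> 0" "Polynomial.degree g \<le> ?n" "ev g x = 0"
  proof (cases "inj_on (\<lambda>i. (Z ^^ i) x) {..?n}")
    case False
    then obtain i j where ij: "i < j" "j \<le> ?n" "(Z ^^ i) x = (Z ^^ j) x"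
      by (auto simp: inj_on_def) (metis linorder_neqE_nat)
    let ?g = "Polynomial.monom 1 j - Polynomial.monom 1 i :: complex poly"
    have "poly.coeff ?g j = 1" using ij by simp
    then have "?g \<noteq> 0" by (metis Polynomial.coeff_0 zero_neq_one)
    moreover have deg: "Polynomial.degree ?g \<le> ?n"
      using ij by (intro Polynomial.degree_diff_le) (auto intro: order_trans[OF Polynomial.degree_monom_le])
    moreover have "ev ?g x = 0"
      unfolding ev_bound[OF deg] using ij
      by (simp add: scale_left_diff_distrib sum_subtractf if_distrib[of "\<lambda>c. scale c _"] cong: if_cong)
    ultimately show ?thesis by (rule that)
  next
    case True
    let ?S = "(\<lambda>i. (Z ^^ i) x) ` {..?n}"
    have "(Z ^^ i) x \<in> ?V" for i using V(2) inv by (induction i) auto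
    moreover have "card ?S = Suc ?n" using True by (simp add: card_image)
    ultimately have "dependent ?S" using independent_span_bound[OF V(1), of ?S] by auto
    then obtain u y where u: "y \<in> ?S" "u y \<noteq> 0" "(\<Sum>y\<in>?S. scale (u y) y) = 0"
      by (auto simp: dependent_finite)
    let ?g = "\<Sum>i\<le>?n. Polynomial.monom (u ((Z ^^ i) x)) i"
    have co: "poly.coeff ?g i = (if i \<le> ?n then u ((Z ^^ i) x) else 0)" for i
      by (auto simp: Polynomial.coeff_sum sum.delta)
    obtain i where "i \<le> ?n" "y = (Z ^^ i) x" using u(1) by auto
    then have "?g \<noteq> 0" using u(2) co[of i] by (metis Polynomial.coeff_0)
    moreover have deg: "Polynomial.degree ?g \<le> ?n"
      by (rule Polynomial.degree_le) (simp add: co)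
    moreover have "ev ?g x = 0"
      unfolding ev_bound[OF deg] using u(3) True by (simp add: co sum.reindex)
    ultimately show ?thesis by (rule that)
  qed
  have "(P ^^ Polynomial.degree g) x = 0" using main[OF g(1) HOL.refl V(2) g(3)] .
  \<comment> \<open>The degree of g may be smaller than \<open>card T\<close>; the remaining
    applications of \<open>P\<close> keep 0.\<close>
  then have "(P ^^ (?n - Polynomial.degree g + Polynomial.degree g)) x = 0"
    by (simp only: funpow_add comp_apply P0)
  then show ?thesis using g(2) by (simp add: P_def st_def[abs_def])
qed

section \<open>Eigenvalues of the full twist\<close>

text \<open>Laurent polynomials regarded as functions. Clearing a denominator u^K is enough for the
  identity principle \<open>laurent_fun_eq_0\<close>.\<close>

definition laurent_fun :: "(complex \<Rightarrow> complex) \<Rightarrow> bool" where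
  "laurent_fun g \<longleftrightarrow> (\<exists>K p. \<forall>u. u \<noteq> 0 \<longrightarrow> g u * u ^ K = poly p u)"

lemma laurent_fun_const [simp]: "laurent_fun (\<lambda>u. a)"
  unfolding laurent_fun_def by (intro exI[of _ 0] exI[of _ "[:a:]"]) simp

lemma laurent_fun_ident [simp]: "laurent_fun (\<lambda>u. u)"
  unfolding laurent_fun_def by (intro exI[of _ 0] exI[of _ "[:0, 1:]"]) simp

lemma laurent_fun_inverse [simp]: "laurent_fun inverse"
  unfolding laurent_fun_def by (intro exI[of _ 1] exI[of _ 1]) simp

lemma laurent_fun_add:
  assumes "laurent_fun g" "laurent_fun h"
  shows "laurent_fun (\<lambda>u. g u + h u)"
proof -
  obtain K p L r where "\<And>u. u \<noteq> 0 \<Longrightarrow> g u * u ^ K = poly p u" "\<And>u. u \<noteq> 0 \<Longrightarrow> h u * u ^ L = poly r u"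
    using assms unfolding laurent_fun_def by blast
  then have "(g u + h u) * u ^ (K + L) = poly (p * Polynomial.monom 1 L + r * Polynomial.monom 1 K) u" if "u \<noteq> 0" for u
    using that by (simp add: poly_monom power_add algebra_simps flip: mult.assoc)
  then show ?thesis unfolding laurent_fun_def by blast
qed

lemma laurent_fun_mult:
  assumes "laurent_fun g" "laurent_fun h"
  shows "laurent_fun (\<lambda>u. g u * h u)"
proof -
  obtain K p L r where *: "\<And>u. u \<noteq> 0 \<Longrightarrow> g u * u ^ K = poly p u" "\<And>u. u \<noteq> 0 \<Longrightarrow> h u * u ^ L = poly r u"
    using assms unfolding laurent_fun_def by blast
  have "(g u * h u) * u ^ (K + L) = poly (p * r) u" if "u \<noteq> 0" for u
  proof -
    have "(g u * h u) * u ^ (K + L) = (g u * u ^ K) * (h u * u ^ L)" by (simp add: power_add)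
    then show ?thesis using * that by simp
  qed
  then show ?thesis unfolding laurent_fun_def by blast
qed

lemma laurent_fun_diff: "laurent_fun g \<Longrightarrow> laurent_fun h \<Longrightarrow> laurent_fun (\<lambda>u. g u - h u)"
  using laurent_fun_add[of g "\<lambda>u. (- 1) * h u"] laurent_fun_mult[of "\<lambda>u. - 1" h] by simp

lemma laurent_fun_power: "laurent_fun g \<Longrightarrow> laurent_fun (\<lambda>u. g u ^ n)"
  by (induction n) (simp_all add: laurent_fun_mult)

lemma laurent_fun_sum: "(\<And>i. i \<in> A \<Longrightarrow> laurent_fun (g i)) \<Longrightarrow> laurent_fun (\<lambda>u. \<Sum>i\<in>A. g i u)"
  by (induction A rule: infinite_finite_induct) (simp_all add: laurent_fun_add)

lemma laurent_fun_prod: "(\<And>i. i \<in> A \<Longrightarrow> laurent_fun (g i)) \<Longrightarrow> laurent_fun (\<lambda>u. \<Prod>i\<in>A. g i u)"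
  by (induction A rule: infinite_finite_induct) (simp_all add: laurent_fun_mult)

lemma laurent_fun_comp_power:
  assumes "laurent_fun g"
  shows "laurent_fun (\<lambda>u. g (u ^ D))"
proof -
  obtain K p where *: "\<And>u. u \<noteq> 0 \<Longrightarrow> g u * u ^ K = poly p u" using assms unfolding laurent_fun_def by blast
  have "g (u ^ D) * u ^ (D * K) = poly (p \<circ>\<^sub>p Polynomial.monom 1 D) u" if "u \<noteq> 0" for u
    using *[of "u ^ D"] that by (simp add: poly_pcompose poly_monom power_mult)
  then show ?thesis unfolding laurent_fun_def by blast
qed

lemma laurent_fun_eq_0:
  assumes "laurent_fun g" "infinite {u. u \<noteq> 0 \<and> g u = 0}" "u \<noteq> 0"
  shows "g u = 0"
proof -
  obtain K p where *: "\<And>u. u \<noteq> 0 \<Longrightarrow> g u * u ^ K = poly p u" using assms(1) unfolding laurent_fun_def by blast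
  have "{u. u \<noteq> 0 \<and> g u = 0} \<subseteq> {u. poly p u = 0}" using * by force
  then have "p = 0" using assms(2) poly_roots_finite[of p] finite_subset by blast
  then show ?thesis using *[OF assms(3)] assms(3) by simp
qed

lemma laurent_fun_det:
  assumes "\<And>i j. i < n \<Longrightarrow> j < n \<Longrightarrow> laurent_fun (\<lambda>u. A u i j)"
  shows "laurent_fun (\<lambda>u. det (mat n n (\<lambda>(i, j). A u i j)))"
proof -
  have "laurent_fun (\<lambda>u. \<Sum>p | p permutes {0..<n}. signof p * (\<Prod>i = 0..<n. A u i (p i)))"
    using assms by (intro laurent_fun_sum laurent_fun_mult laurent_fun_const laurent_fun_prod)
      (use permutes_in_image in fastforce)+
  also have "(\<lambda>u. \<Sum>p | p permutes {0..<n}. signof p * (\<Prod>i = 0..<n. A u i (p i))) =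
      (\<lambda>u. det (mat n n (\<lambda>(i, j). A u i j)))"
    by (intro ext, subst det_def'[of _ n])
      (use permutes_in_image in \<open>fastforce intro!: sum.cong prod.cong arg_cong2[where f = "(*)"]\<close>)+
  finally show ?thesis .
qed

text \<open>Transfers identities from infinitely many complex values of \<open>v\<close> to \<open>R\<close>.\<close>

definition laurent_rel :: "rat fps \<Rightarrow> (complex \<Rightarrow> complex) \<Rightarrow> bool" where
  "laurent_rel r g \<longleftrightarrow> (\<exists>(p :: int poly) K. r * (1 + fps_X) ^ K = poly (map_poly of_int p) (1 + fps_X) \<and>
     (\<forall>u. u \<noteq> 0 \<longrightarrow> g u * u ^ K = poly (map_poly of_int p) u))"

lemma laurent_relE:
  assumes "laurent_rel r g"
  obtains p :: "int poly" and K where "r * (1 + fps_X) ^ K = poly (map_poly of_int p) (1 + fps_X)"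
    "\<And>u. u \<noteq> 0 \<Longrightarrow> g u * u ^ K = poly (map_poly of_int p) u"
  using assms unfolding laurent_rel_def by blast

lemma laurent_relI:
  "r * (1 + fps_X) ^ K = poly (map_poly of_int (p :: int poly)) (1 + fps_X) \<Longrightarrow>
    (\<And>u. u \<noteq> 0 \<Longrightarrow> g u * u ^ K = poly (map_poly of_int p) u) \<Longrightarrow> laurent_rel r g"
  unfolding laurent_rel_def by blast

lemma laurent_rel_0: "laurent_rel 0 (\<lambda>u. 0)"
  by (rule laurent_relI[of _ 0 0]) simp_all

lemma laurent_rel_1: "laurent_rel 1 (\<lambda>u. 1)"
  by (rule laurent_relI[of _ 0 1]) simp_all

lemma laurent_rel_ident: "laurent_rel (1 + fps_X) (\<lambda>u. u)"
  by (rule laurent_relI[of _ 0 "[:0, 1:]"]) simp_all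

lemma laurent_rel_inverse: "laurent_rel (inverse (1 + fps_X)) inverse"
  by (rule laurent_relI[of _ 1 1]) (simp_all add: inverse_mult_eq_1)

lemma laurent_rel_add:
  assumes "laurent_rel r g" "laurent_rel s h"
  shows "laurent_rel (r + s) (\<lambda>u. g u + h u)"
proof -
  obtain p K where p: "r * (1 + fps_X) ^ K = poly (map_poly of_int (p :: int poly)) (1 + fps_X)"
    "\<And>u. u \<noteq> 0 \<Longrightarrow> g u * u ^ K = poly (map_poly of_int p) u" using assms(1) laurent_relE by metis
  obtain t L where t: "s * (1 + fps_X) ^ L = poly (map_poly of_int (t :: int poly)) (1 + fps_X)"
    "\<And>u. u \<noteq> 0 \<Longrightarrow> h u * u ^ L = poly (map_poly of_int t) u" using assms(2) laurent_relE by metis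
  have alg: "(x + y) * z ^ (K + L) = (x * z ^ K) * z ^ L + (y * z ^ L) * z ^ K"
    for x y z :: "'k::comm_ring_1" by (simp add: power_add algebra_simps)
  show ?thesis
    by (rule laurent_relI[of _ "K + L" "p * Polynomial.monom 1 L + t * Polynomial.monom 1 K"])
      (simp_all add: alg p t hom_distribs of_int_hom.map_poly_hom_monom poly_monom)
qed

lemma laurent_rel_mult:
  assumes "laurent_rel r g" "laurent_rel s h"
  shows "laurent_rel (r * s) (\<lambda>u. g u * h u)"
proof -
  obtain p K where p: "r * (1 + fps_X) ^ K = poly (map_poly of_int (p :: int poly)) (1 + fps_X)"
    "\<And>u. u \<noteq> 0 \<Longrightarrow> g u * u ^ K = poly (map_poly of_int p) u" using assms(1) laurent_relE by metis
  obtain t L where t: "s * (1 + fps_X) ^ L = poly (map_poly of_int (t :: int poly)) (1 + fps_X)"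
    "\<And>u. u \<noteq> 0 \<Longrightarrow> h u * u ^ L = poly (map_poly of_int t) u" using assms(2) laurent_relE by metis
  have alg: "(x * y) * z ^ (K + L) = (x * z ^ K) * (y * z ^ L)"
    for x y z :: "'k::comm_ring_1" by (simp add: power_add algebra_simps)
  show ?thesis
    by (rule laurent_relI[of _ "K + L" "p * t"]) (simp_all add: alg p t hom_distribs)
qed

lemma laurent_rel_diff: "laurent_rel r g \<Longrightarrow> laurent_rel s h \<Longrightarrow> laurent_rel (r - s) (\<lambda>u. g u - h u)"
proof -
  assume r: "laurent_rel r g" and s: "laurent_rel s h"
  have "laurent_rel (- 1) (\<lambda>u. - 1)" by (rule laurent_relI[of _ 0 "- 1"]) (simp_all add: hom_distribs)
  from laurent_rel_add[OF r laurent_rel_mult[OF this s]] show ?thesis by simp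
qed

lemma laurent_rel_power: "laurent_rel r g \<Longrightarrow> laurent_rel (r ^ n) (\<lambda>u. g u ^ n)"
  by (induction n) (simp_all add: laurent_rel_mult laurent_rel_1)

text \<open>The common numerator \<open>p\<close> has integer coefficients and can be read over the
  complex numbers as well as over R. Infinitely many zeros make it vanish, and 1 + X is not a zero
  divisor.\<close>

lemma laurent_rel_eq_0:
  assumes "laurent_rel r g" "infinite {u. u \<noteq> 0 \<and> g u = 0}"
  shows "r = 0"
proof -
  obtain p K where p: "r * (1 + fps_X) ^ K = poly (map_poly of_int (p :: int poly)) (1 + fps_X)"
    "\<And>u. u \<noteq> 0 \<Longrightarrow> g u * u ^ K = poly (map_poly of_int p) u" using assms(1) laurent_relE by metis
  have "{u. u \<noteq> 0 \<and> g u = 0} \<subseteq> {u. poly (map_poly of_int p) u = (0 :: complex)}" using p by force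
  then have "map_poly of_int p = (0 :: complex poly)"
    using assms(2) poly_roots_finite finite_subset by blast
  then have "p = 0" by simp
  moreover have "(1 + fps_X :: rat fps) \<noteq> 0"
  proof
    assume "(1 + fps_X :: rat fps) = 0"
    then have "(1 + fps_X :: rat fps) $ 0 = 0" by simp
    then show False by simp
  qed
  ultimately show ?thesis using p(1) by simp
qed

lemma sum_fun_apply: "(\<Sum>i\<in>A. f i) x = (\<Sum>i\<in>A. f i x)"
  for f :: "'i \<Rightarrow> 'b \<Rightarrow> 'c::comm_monoid_add"
  by (induction A rule: infinite_finite_induct) simp_all

definition fscale :: "complex \<Rightarrow> ('b \<Rightarrow> complex) \<Rightarrow> 'b \<Rightarrow> complex" where
  "fscale c f = (\<lambda>x. c * f x)"

lemma vector_space_fscale: "vector_space fscale"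
  by unfold_locales (auto simp: fscale_def fun_eq_iff algebra_simps)

section \<open>The spectrum of the full twist on functions on W_I\<close>

context finite_coxeter_parabolic
begin

lemma lmul_apply:
  "lmul q s f x = (if x \<in> WI then f (s \<otimes> x) + (if descent x s then q * f x else 0) else 0)"
  by (simp add: lmul_def)

lemma linear_lmul: "Vector_Spaces.linear fscale fscale (lmul q s)"
proof -
  interpret vector_space "fscale :: _ \<Rightarrow> ('a \<Rightarrow> complex) \<Rightarrow> _" by (rule vector_space_fscale)
  show ?thesis
    by unfold_locales (auto simp: lmul_def fscale_def fun_eq_iff algebra_simps)
qed

lemma linear_full_twist: "Vector_Spaces.linear fscale fscale (full_twist q)"
proof -
  have "Vector_Spaces.linear fscale fscale (foldr (lmul q) us)" for us
  proof (induction us)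
    case Nil
    interpret vector_space "fscale :: _ \<Rightarrow> ('a \<Rightarrow> complex) \<Rightarrow> _" by (rule vector_space_fscale)
    show ?case using linear_id by (simp add: id_def)
  next
    case (Cons s us)
    then show ?case using Vector_Spaces.linear_compose[OF Cons linear_lmul] by (simp add: comp_def)
  qed
  then show ?thesis unfolding full_twist_def .
qed

lemma span_delta: "Modules.module.span fscale (delta ` WI) = {f :: 'a \<Rightarrow> complex. supp f}"
proof -
  interpret vector_space "fscale :: _ \<Rightarrow> ('a \<Rightarrow> complex) \<Rightarrow> _" by (rule vector_space_fscale)
  have sub: "subspace {f :: 'a \<Rightarrow> complex. supp f}"
    by (auto simp: subspace_def supp_def fscale_def)
  show ?thesis
  proof
    show "span (delta ` WI) \<subseteq> {f :: 'a \<Rightarrow> complex. supp f}"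
      using sub by (intro span_minimal) auto
  next
    show "{f :: 'a \<Rightarrow> complex. supp f} \<subseteq> span (delta ` WI)"
    proof
      fix f :: "'a \<Rightarrow> complex"
      assume "f \<in> {f. supp f}"
      then have f: "supp f" by simp
      have "(\<lambda>x. \<Sum>w\<in>WI. f w * delta w x) = (\<Sum>w\<in>WI. fscale (f w) (delta w))"
        by (simp add: fscale_def fun_eq_iff sum_fun_apply)
      then have "f = (\<Sum>w\<in>WI. fscale (f w) (delta w))"
        unfolding delta_expansion[OF f, symmetric] .
      also have "\<dots> \<in> span (delta ` WI)"
        by (intro span_sum span_scale span_base) auto
      finally show "f \<in> span (delta ` WI)" .
    qed
  qed
qed

lemma card_delta: "card (delta ` WI :: ('a \<Rightarrow> complex) set) = card WI"
  by (intro card_image inj_onI) (auto simp: delta_def fun_eq_iff split: if_splits)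

text \<open>The whole eigenspace is used instead of the line through \<open>f\<close>: since the
  full twist commutes with every \<open>lmul\<close>, the eigenspace is stable under all of
  them.\<close>

lemma eigenvalue_power:
  fixes c c' l :: complex
  assumes "c * c' = 1" "supp f" "f \<noteq> 0" "full_twist (c - c') f = fscale l f"
  shows "\<exists>d a b. 0 < d \<and> d \<le> card WI \<and> a + b = d * len w0 \<and> l ^ d = (c ^ a * c' ^ b)\<^sup>2"
proof -
  interpret vector_space "fscale :: _ \<Rightarrow> ('a \<Rightarrow> complex) \<Rightarrow> _" by (rule vector_space_fscale)
  interpret vector_space_pair "fscale :: _ \<Rightarrow> ('a \<Rightarrow> complex) \<Rightarrow> _" "fscale :: _ \<Rightarrow> ('a \<Rightarrow> complex) \<Rightarrow> _" ..
  define q where "q = c - c'"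
  define U where "U = {f. supp f \<and> full_twist q f = fscale l f}"
  note lin = linear_full_twist[of q]
  have sub: "subspace U"
    unfolding subspace_def U_def
    by (auto simp: linear_0[OF lin] linear_add[OF lin] linear_scale[OF lin] scale_right_distrib)
      (auto simp: supp_def fscale_def algebra_simps)
  have map: "foldr (\<lambda>f. f) (map (lmul q) us) = foldr (lmul q) us" for us
    by (induction us) auto
  have "\<exists>d a b. 0 < d \<and> d \<le> card (delta ` WI :: ('a \<Rightarrow> complex) set) \<and>
      a + b = d * length (map (lmul q) w0_word) \<and> l ^ d = (c ^ a * c' ^ b)\<^sup>2"
  proof (rule scalar_power_of_invariant_subspace[OF vector_space_fscale sub])
    show "U \<subseteq> span (delta ` WI)" by (auto simp: span_delta U_def)
    show "finite (delta ` WI)" using finite_WI by simp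
    show "f \<in> U" using assms by (simp add: U_def q_def)
    show "f \<noteq> 0" "c * c' = 1" by fact+
    fix g assume "g \<in> set (map (lmul q) w0_word)"
    then obtain s where s: "s \<in> I" "g = lmul q s" using w0_word(3) by auto
    show "Vector_Spaces.linear fscale fscale g" using linear_lmul s by simp
    show "g x \<in> U" if "x \<in> U" for x
      using that full_twist_commute[OF s(1), of q x] linear_scale[OF linear_lmul] s(2)
      by (auto simp: U_def)
    show "g (g x) = x + fscale (c - c') (g x)" if "x \<in> U" for x
      unfolding s(2) using that lmul_square[OF s(1), of x q]
      by (simp add: U_def fscale_def q_def fun_eq_iff)
  next
    fix x assume "x \<in> U"
    then show "foldr (\<lambda>f. f) (map (lmul q) w0_word @ map (lmul q) w0_word) x = fscale l x"
      unfolding map_append[symmetric] map by (simp add: U_def full_twist_def)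
  qed
  then show ?thesis by (simp add: card_delta w0_word(4))
qed

lemma laurent_fun_full_twist: "laurent_fun (\<lambda>u. full_twist (u - inverse u) (delta y) x)"
proof -
  have "laurent_fun (\<lambda>u. foldr (lmul (u - inverse u)) us (delta y) x)" for us
  proof (induction us arbitrary: x)
    case Nil
    show ?case by (simp add: delta_def)
  next
    case (Cons s us)
    then show ?case
      by (cases "x \<in> WI"; cases "descent x s")
        (simp_all add: lmul_apply laurent_fun_add laurent_fun_mult laurent_fun_diff)
  qed
  then show ?thesis unfolding full_twist_def .
qed

text \<open>The characteristic polynomial of the full twist, evaluated at \<open>l\<close>. With
  \<open>l\<close> and \<open>q\<close> as plain arguments, both can vary with u.\<close>

definition char_det :: "complex \<Rightarrow> complex \<Rightarrow> complex" where
  "char_det l q = (let e = (SOME e. bij_betw e {0..<card WI} WI) in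
     det (mat (card WI) (card WI)
       (\<lambda>(i, j). (if i = j then l else 0) - full_twist q (delta (e j)) (e i))))"

text \<open>One enumeration of W_I serves all three facts. The first holds because the full twist is
  the identity at q = 0, the last because the matrix entries are Laurent polynomials.\<close>

lemma char_det:
  shows char_det_zero: "char_det l 0 = (l - 1) ^ card WI"
    and char_det_eigenvalue: "supp f \<Longrightarrow> f \<noteq> 0 \<Longrightarrow> full_twist q f = fscale l f \<Longrightarrow> char_det l q = 0"
    and laurent_fun_char_det: "laurent_fun g \<Longrightarrow> D > 0 \<Longrightarrow>
      laurent_fun (\<lambda>u. char_det (g u) (u ^ D - inverse (u ^ D)))"
proof -
  define n where "n = card WI"
  define e where "e = (SOME e. bij_betw e {0..<n} WI)"
  have e: "bij_betw e {0..<n} WI"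
    using someI_ex[OF ex_bij_betw_nat_finite[OF finite_WI]] by (simp add: e_def n_def)
  have eW: "e i \<in> WI" if "i < n" for i using e that by (auto simp: bij_betw_def)
  have eq: "e i = e j \<longleftrightarrow> i = j" if "i < n" "j < n" for i j
    using e that by (auto simp: bij_betw_def inj_on_def)
  define A where "A l q = mat n n (\<lambda>(i, j). (if i = j then l else 0) - full_twist q (delta (e j)) (e i))"
    for l q :: complex
  have A: "A l q \<in> carrier_mat n n" for l q by (simp add: A_def)
  have det: "char_det l q = det (A l q)" for l q
    by (simp add: char_det_def A_def e_def n_def Let_def)
  have "A l 0 = (l - 1) \<cdot>\<^sub>m 1\<^sub>m n"
    by (intro eq_matI) (simp_all add: A_def full_twist_zero eW, simp add: delta_def eq)
  then show "char_det l 0 = (l - 1) ^ card WI" by (simp add: det n_def)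
  show "laurent_fun (\<lambda>u. char_det (g u) (u ^ D - inverse (u ^ D)))" if "laurent_fun g" "D > 0"
  proof -
    have "laurent_fun (\<lambda>u. (if i = j then g u else 0) -
        full_twist (u ^ D - inverse (u ^ D)) (delta (e j)) (e i))" for i j
    proof -
      have "laurent_fun (\<lambda>u. if i = j then g u else 0)" using that by (cases "i = j") simp_all
      then show ?thesis
        using laurent_fun_comp_power[OF laurent_fun_full_twist[of "e j" "e i"], of D]
        by (rule laurent_fun_diff)
    qed
    then show ?thesis unfolding det A_def by (rule laurent_fun_det)
  qed
  show "char_det l q = 0" if f: "supp f" "f \<noteq> 0" "full_twist q f = fscale l f"
  proof -
    let ?x = "vec n (\<lambda>j. f (e j))"
    have "?x \<noteq> 0\<^sub>v n"
    proof
      assume "?x = 0\<^sub>v n"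
      then have "f (e j) = 0" if "j < n" for j using that by (metis index_vec index_zero_vec(1))
      moreover have "\<exists>j<n. w = e j" if "w \<in> WI" for w using e that by (force simp: bij_betw_def)
      ultimately have "f w = 0" if "w \<in> WI" for w using that by metis
      then have "f = 0" using f(1) by (auto simp: supp_def fun_eq_iff)
      with f(2) show False by simp
    qed
    moreover have "A l q *\<^sub>v ?x = 0\<^sub>v n"
    proof (rule eq_vecI)
      fix i assume "i < dim_vec (0\<^sub>v n :: complex vec)"
      then have i: "i < n" by simp
      have "vec_index (A l q *\<^sub>v ?x) i =
          (\<Sum>j = 0..<n. ((if i = j then l else 0) - full_twist q (delta (e j)) (e i)) * f (e j))"
        using i by (simp add: A_def scalar_prod_def)
      also have "\<dots> = (\<Sum>j = 0..<n. (if i = j then l * f (e j) else 0)) -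
          (\<Sum>j = 0..<n. f (e j) * full_twist q (delta (e j)) (e i))"
        unfolding sum_subtractf[symmetric] by (intro sum.cong) (simp_all add: algebra_simps)
      also have "(\<Sum>j = 0..<n. (if i = j then l * f (e j) else 0)) = l * f (e i)"
        using i by simp
      also have "(\<Sum>j = 0..<n. f (e j) * full_twist q (delta (e j)) (e i)) =
          (\<Sum>w\<in>WI. f w * full_twist q (delta w) (e i))"
        by (rule sum.reindex_bij_betw[OF e])
      also have "\<dots> = full_twist q f (e i)"
        using fun_cong[OF full_twist_sum[OF finite_WI, of q f delta]]
        unfolding delta_expansion[OF f(1), symmetric] by simp
      finally show "vec_index (A l q *\<^sub>v ?x) i = vec_index (0\<^sub>v n) i"
        using f(3) i by (simp add: fscale_def)
    qed (simp add: A_def)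
    ultimately show ?thesis
      unfolding det using det_0_iff_vec_prod_zero[OF A] by (metis vec_carrier)
  qed
qed

text \<open>For c = v and c' = v^-1 these are the powers v^k with k from - \<open>len w0\<close> to
  \<open>len w0\<close>, the candidates for square roots of eigenvalues. The range reflects a + b =
  D \<open>len w0\<close> for the monomial u^a u^-b with v = u^D.\<close>

definition twist_roots :: "'k::comm_ring_1 \<Rightarrow> 'k \<Rightarrow> 'k list" where
  "twist_roots c c' = map (\<lambda>j. c ^ j * c' ^ len w0) [0..<2 * len w0 + 1]"

text \<open>The product over all candidates is raised to the power \<open>card WI\<close>, the
  dimension, because knowing the eigenvalues does not exclude nilpotent parts.\<close>

definition twist_ann :: "'k::comm_ring_1 \<Rightarrow> 'k \<Rightarrow> ('a \<Rightarrow> 'k) \<Rightarrow> 'a \<Rightarrow> 'k" where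
  "twist_ann c c' =
     foldr (\<lambda>\<alpha> f x. full_twist (c - c') f x - \<alpha>\<^sup>2 * f x) (twist_roots c c') ^^ card WI"

text \<open>An eigenvalue of the full twist at \<open>v = u\<^sup>D\<close> is \<open>\<zeta> (u\<^sup>a u\<^sup>-\<^sup>b)\<^sup>2\<close> with \<open>\<zeta>\<^sup>D = 1\<close>. If this
  happens for infinitely many \<open>u\<close> then, the characteristic polynomial being a Laurent polynomial in
  \<open>u\<close>, it happens for \<open>u = 1\<close> and for \<open>u\<^sup>D = -1\<close>. There the full twist is the identity, whence
  \<open>\<zeta> = 1\<close> and \<open>D\<close> divides \<open>2 a\<close>.\<close>

lemma generic_eigenvalue:
  assumes D: "D > 0" and ab: "a + b = D * len w0"
    and inf: "infinite {u. u \<noteq> 0 \<and> char_det (z * (u ^ a * inverse u ^ b)\<^sup>2) (u ^ D - inverse (u ^ D)) = 0}"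
  shows "z = 1 \<and> D dvd 2 * a"
proof -
  define F where "F u = char_det (z * (u ^ a * inverse u ^ b)\<^sup>2) (u ^ D - inverse (u ^ D))" for u
  have "laurent_fun F"
    unfolding F_def using D
    by (intro laurent_fun_char_det laurent_fun_mult laurent_fun_power) simp_all
  then have F: "F u = 0" if "u \<noteq> 0" for u
    using laurent_fun_eq_0 inf that unfolding F_def[symmetric] by blast
  have z: "z = 1" using F[of 1] by (simp add: F_def char_det_zero)
  \<comment> \<open>A primitive 2D-th root of unity; its order turns u^(4a) = 1 into D | 2a.\<close>
  define u where "u = cis (pi / D)"
  have u: "u \<noteq> 0" "u ^ D = - 1" using D by (simp_all add: u_def Complex.DeMoivre)
  \<comment> \<open>The product x y is u^(a-b). Multiplying it by t = u^(a+b), a power of -1 and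
    hence of square 1, replaces a - b by 2a.\<close>
  define x y t where "x = u ^ a" and "y = inverse u ^ b" and "t = u ^ (a + b)"
  have xy: "(x * y)\<^sup>2 = 1"
    using F[OF u(1)] u z by (simp add: F_def char_det_zero x_def y_def)
  have tt: "t * t = 1"
    unfolding t_def ab power_mult u(2) by (simp flip: power_mult_distrib)
  have yt: "y * t = x"
    using u(1) by (simp add: power_add power_inverse field_simps x_def y_def t_def)
  have "(x * x) * (x * x) = (x * (y * t)) * (x * (y * t))" unfolding yt by (simp only: mult_ac)
  also have "\<dots> = (x * y)\<^sup>2 * (t * t)" by (simp only: power2_eq_square mult_ac)
  finally have "(x * x) * (x * x) = 1" using xy tt by simp
  moreover have "4 * a = (a + a) + (a + a)" by simp
  ultimately have "u ^ (4 * a) = 1" by (simp only: power_add x_def)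
  then have "cis (4 * a * pi / D) = 1" by (simp add: u_def Complex.DeMoivre algebra_simps)
  then have "cos (4 * a * pi / D) = 1" by (metis cis.sel(1) one_complex.sel(1))
  then obtain k :: int where "4 * a * pi / D = of_int k * 2 * pi"
    by (auto simp: cos_one_2pi_int)
  then have "real (2 * a) = real D * of_int k" using D by (simp add: field_simps)
  then have "int (2 * a) = int D * k" by (metis of_int_eq_iff of_int_mult of_int_of_nat_eq)
  then show ?thesis using z by (metis dvd_triv_left int_dvd_int_iff)
qed

text \<open>An exceptional u is a zero of one of the Laurent functions treated in
  \<open>generic_eigenvalue\<close>. Only finitely many triples (z, a, b) are possible, and each bad
  triple has finitely many zeros.\<close>

lemma eigenvalue_in_twist_roots:
  "\<exists>D>0. finite {u. u \<noteq> 0 \<and> (\<exists>l f. supp f \<and> f \<noteq> 0 \<and>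
    full_twist (u ^ D - inverse (u ^ D)) f = fscale l f \<and>
    l \<notin> (\<lambda>\<alpha>. \<alpha>\<^sup>2) ` set (twist_roots (u ^ D) (inverse (u ^ D))))}" (is "\<exists>D>0. finite (?E D)")
proof -
  \<comment> \<open>The dimensions d in \<open>eigenvalue_power\<close> are at most
    \<open>card WI\<close>, so the factorial is a common multiple of all of them.\<close>
  define D :: nat where "D = fact (card WI)"
  have D: "D > 0" by (simp add: D_def)
  define Z where "Z z a b = {u. u \<noteq> 0 \<and>
    char_det (z * (u ^ a * inverse u ^ b)\<^sup>2) (u ^ D - inverse (u ^ D)) = 0}" for z a b
  define P where "P = {(z :: complex, a, b). z ^ D = 1 \<and> a \<le> D * len w0 \<and> b \<le> D * len w0 \<and>
    a + b = D * len w0 \<and> \<not> (z = 1 \<and> D dvd 2 * a)}"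
  have "?E D \<subseteq> (\<Union>(z, a, b)\<in>P. Z z a b)"
  proof
    fix u assume "u \<in> ?E D"
    then obtain l f where u: "u \<noteq> 0" and f: "supp f" "f \<noteq> 0"
        "full_twist (u ^ D - inverse (u ^ D)) f = fscale l f"
      and l: "l \<notin> (\<lambda>\<alpha>. \<alpha>\<^sup>2) ` set (twist_roots (u ^ D) (inverse (u ^ D)))" by blast
    obtain d a0 b0 where d: "0 < d" "d \<le> card WI" "a0 + b0 = d * len w0"
        "l ^ d = ((u ^ D) ^ a0 * inverse (u ^ D) ^ b0)\<^sup>2"
      using eigenvalue_power[of "u ^ D" "inverse (u ^ D)" f l] u f by auto
    obtain r where r: "D = d * r" using d(1,2) dvd_fact[of d "card WI"] by (auto simp: D_def)
    define a b where "a = a0 * r" and "b = b0 * r"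
    have ab: "a + b = D * len w0" using d(3) r by (simp add: a_def b_def flip: distrib_right)
    define t where "t = (u ^ a * inverse u ^ b)\<^sup>2"
    have t0: "t \<noteq> 0" using u by (simp add: t_def)
    have "l ^ D = (((u ^ D) ^ a0 * inverse (u ^ D) ^ b0)\<^sup>2) ^ r"
      unfolding r power_mult[of l] d(4) ..
    also have "\<dots> = t ^ D"
      unfolding t_def a_def b_def
      by (simp add: power_mult_distrib power_inverse flip: power_mult) (simp add: mult_ac)
    finally have lD: "l ^ D = t ^ D" .
    \<comment> \<open>Dividing by the expected monomial leaves a D-th root of unity.\<close>
    define z where "z = l / t"
    have z: "l = z * t" "z ^ D = 1" using t0 lD by (simp_all add: z_def power_divide)
    have "\<not> (z = 1 \<and> D dvd 2 * a)"
    proof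
      assume "z = 1 \<and> D dvd 2 * a"
      then obtain j where j: "2 * a = D * j" and "l = t" using z by auto
      have "2 * a \<le> 2 * (D * len w0)" using ab by linarith
      then have "D * j \<le> D * (2 * len w0)" unfolding j by (simp only: mult.left_commute)
      then have "j \<le> 2 * len w0" using D by simp
      \<comment> \<open>Here u^(a-b) = u^(2a) u^-(a+b), which is v^j v^(- len w0) with j = 2a / D:
        this is the form of the entries of \<open>twist_roots\<close>.\<close>
      have "u ^ a * inverse u ^ b = u ^ (2 * a) * inverse u ^ (a + b)"
        unfolding mult_2 power_add using u by (simp add: power_inverse field_simps)
      also have "\<dots> = (u ^ D) ^ j * inverse (u ^ D) ^ len w0"
        unfolding j ab by (simp add: power_mult power_inverse)
      finally have "l = ((u ^ D) ^ j * inverse (u ^ D) ^ len w0)\<^sup>2"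
        using \<open>l = t\<close> by (simp add: t_def)
      moreover have "(u ^ D) ^ j * inverse (u ^ D) ^ len w0 \<in> set (twist_roots (u ^ D) (inverse (u ^ D)))"
        unfolding twist_roots_def set_map set_upt using \<open>j \<le> 2 * len w0\<close> by (intro imageI) simp
      ultimately have "l \<in> (\<lambda>\<alpha>. \<alpha>\<^sup>2) ` set (twist_roots (u ^ D) (inverse (u ^ D)))"
        by (rule image_eqI)
      with l show False by simp
    qed
    then have "(z, a, b) \<in> P" using z(2) ab unfolding P_def by auto
    moreover have "u \<in> Z z a b"
      using u z(1) char_det_eigenvalue[OF f] by (simp add: Z_def t_def)
    ultimately show "u \<in> (\<Union>(z, a, b)\<in>P. Z z a b)" by blast
  qed
  moreover have "finite (\<Union>(z, a, b)\<in>P. Z z a b)"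
  proof (rule finite_UN_I)
    have "P \<subseteq> {z. z ^ D = 1} \<times> {..D * len w0} \<times> {..D * len w0}" by (auto simp: P_def)
    then show "finite P" using finite_subset D finite_nth_roots[of D 1] by blast
  next
    fix x assume "x \<in> P"
    then show "finite (case x of (z, a, b) \<Rightarrow> Z z a b)"
      using generic_eigenvalue[OF D] unfolding P_def Z_def by (auto split: prod.splits)
  qed
  ultimately have "finite (?E D)" by (rule finite_subset)
  with D show ?thesis by blast
qed

lemma twist_ann_complex:
  assumes "c * c' = 1" and "\<And>l f. supp f \<Longrightarrow> f \<noteq> 0 \<Longrightarrow> full_twist (c - c') f = fscale l f \<Longrightarrow>
      l \<in> (\<lambda>\<alpha>. \<alpha>\<^sup>2) ` set (twist_roots c c')"
  shows "twist_ann c c' (delta \<one>) = (0 :: 'a \<Rightarrow> complex)"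
proof -
  let ?T = "delta ` WI :: ('a \<Rightarrow> complex) set"
  have "(foldr (\<lambda>l y. full_twist (c - c') y - fscale l y) (map (\<lambda>\<alpha>. \<alpha>\<^sup>2) (twist_roots c c')) ^^ card ?T)
      (delta \<one>) = 0"
    using assms finite_WI
    by (intro annihilator[OF vector_space_fscale]) (auto simp: span_delta linear_full_twist)
  moreover have "foldr (\<lambda>l y. full_twist (c - c') y - fscale l y) (map (\<lambda>\<alpha>. \<alpha>\<^sup>2) rs) =
      foldr (\<lambda>\<alpha> f x. full_twist (c - c') f x - \<alpha>\<^sup>2 * f x) rs" for rs
    by (induction rs) (simp_all add: fscale_def fun_diff_def)
  ultimately show ?thesis by (simp add: twist_ann_def card_delta)
qed

lemma laurent_rel_full_twist:
  assumes q: "laurent_rel q q'" and f: "\<And>x. laurent_rel (f x) (\<lambda>u. g u x)"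
  shows "laurent_rel (full_twist q f x) (\<lambda>u. full_twist (q' u) (g u) x)"
proof -
  have "laurent_rel (foldr (lmul q) us f x) (\<lambda>u. foldr (lmul (q' u)) us (g u) x)" for us
    by (induction us arbitrary: x)
      (simp_all add: f lmul_apply laurent_rel_0 laurent_rel_add laurent_rel_mult q)
  then show ?thesis unfolding full_twist_def .
qed

lemma laurent_rel_twist_ann:
  assumes c: "laurent_rel c k" "laurent_rel c' k'"
  shows "laurent_rel (twist_ann c c' (delta \<one>) x) (\<lambda>u. twist_ann (k u) (k' u) (delta \<one>) x)"
proof -
  let ?G = "\<lambda>c c' \<alpha> f x. full_twist (c - c') f x - \<alpha>\<^sup>2 * f x"
  have step: "laurent_rel (foldr (?G c c') (map (\<lambda>j. c ^ j * c' ^ len w0) js) f x)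
      (\<lambda>u. foldr (?G (k u) (k' u)) (map (\<lambda>j. k u ^ j * k' u ^ len w0) js) (g u) x)"
    if "\<And>x. laurent_rel (f x) (\<lambda>u. g u x)" for js f g x
    using that
  proof (induction js arbitrary: x)
    case (Cons j js)
    have "laurent_rel (c - c') (\<lambda>u. k u - k' u)" by (intro laurent_rel_diff c)
    with Cons show ?case
      by (simp only: list.map foldr.simps comp_apply)
        (intro laurent_rel_diff laurent_rel_mult laurent_rel_power laurent_rel_full_twist c, simp_all)
  qed simp
  have "laurent_rel ((foldr (?G c c') (twist_roots c c') ^^ n) (delta \<one>) x)
      (\<lambda>u. (foldr (?G (k u) (k' u)) (twist_roots (k u) (k' u)) ^^ n) (delta \<one>) x)" for n
  proof (induction n arbitrary: x)
    case 0
    show ?case by (simp add: delta_def laurent_rel_0 laurent_rel_1)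
  next
    case (Suc n)
    show ?case unfolding twist_roots_def funpow.simps comp_apply
      by (rule step) (rule Suc[unfolded twist_roots_def])
  qed
  then show ?thesis unfolding twist_ann_def .
qed

text \<open>The left side is a Laurent polynomial in v that vanishes at v = u^D for all but finitely
  many u. The power map has finite fibres, so infinitely many values of v arise. The function
  \<open>delta \<one>\<close> is chosen because it corresponds to the unit of the algebra.\<close>

theorem twist_ann_eq_0: "twist_ann (1 + fps_X :: rat fps) (inverse (1 + fps_X)) (delta \<one>) x = 0"
proof -
  obtain D where D: "D > 0" and fin: "finite {u. u \<noteq> 0 \<and> (\<exists>l f. supp f \<and> f \<noteq> 0 \<and>
      full_twist (u ^ D - inverse (u ^ D)) f = fscale l f \<and>
      l \<notin> (\<lambda>\<alpha>. \<alpha>\<^sup>2) ` set (twist_roots (u ^ D) (inverse (u ^ D))))}" (is "finite ?E")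
    using eigenvalue_in_twist_roots by blast
  let ?G = "- insert 0 ?E"
  have G: "twist_ann (u ^ D) (inverse (u ^ D)) (delta \<one>) x = 0" if "u \<in> ?G" for u
  proof -
    have "twist_ann (u ^ D) (inverse (u ^ D)) (delta \<one>) = 0"
      by (rule twist_ann_complex) (use that in auto)
    then show ?thesis by simp
  qed
  have "infinite ?G" using fin by (simp add: infinite_UNIV_char_0 Compl_eq_Diff_UNIV Diff_infinite_finite)
  have "infinite ((\<lambda>u. u ^ D) ` ?G)"
  proof
    assume "finite ((\<lambda>u. u ^ D) ` ?G)"
    then obtain w where "infinite ((\<lambda>u. u ^ D) -` {w} \<inter> ?G)"
      using inf_img_fin_domE' \<open>infinite ?G\<close> by blast
    moreover have "(\<lambda>u. u ^ D) -` {w} \<inter> ?G \<subseteq> {u. u ^ D = w}" by auto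
    ultimately show False using finite_nth_roots[OF D, of w] finite_subset by blast
  qed
  moreover have "(\<lambda>u. u ^ D) ` ?G \<subseteq> {u. u \<noteq> 0 \<and> twist_ann u (inverse u) (delta \<one>) x = 0}"
  proof (rule image_subsetI)
    fix u assume "u \<in> ?G"
    with G[OF this] show "u ^ D \<in> {u. u \<noteq> 0 \<and> twist_ann u (inverse u) (delta \<one>) x = 0}" by simp
  qed
  ultimately have inf: "infinite {u :: complex. u \<noteq> 0 \<and> twist_ann u (inverse u) (delta \<one>) x = 0}"
    using finite_subset by blast
  show ?thesis
    using laurent_rel_eq_0[OF laurent_rel_twist_ann[OF laurent_rel_ident laurent_rel_inverse] inf] .
qed

end

section \<open>Square roots over the localization\<close>

text \<open>A Laurent polynomial is prime to v - 1 exactly when its image in R has nonzero constant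
  term; in this form it is clear that denominators may be multiplied.\<close>

lemma localizationD:
  assumes "f \<in> localization_in_R"
  obtains p q where "laurent_to_R q $ 0 \<noteq> 0" "f * laurent_to_R q = laurent_to_R p"
  using assms completion_dvd_iff[of 1] fps_X_power_dvd_iff_nth[of 1] unfolding localization_in_R_def by auto

lemma localizationI:
  "laurent_to_R q $ 0 \<noteq> 0 \<Longrightarrow> f * laurent_to_R q = laurent_to_R p \<Longrightarrow> f \<in> localization_in_R"
  using completion_dvd_iff[of 1] fps_X_power_dvd_iff_nth[of 1] unfolding localization_in_R_def by fastforce

lemma laurent_to_R_minus: "laurent_to_R (- p) = - laurent_to_R p"
proof -
  have "laurent_to_R 0 = 0" by (simp add: laurent_to_R_def)
  then show ?thesis using completion_hom_add[of p "- p"] by (simp add: minus_unique)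
qed

lemma localization_laurent: "laurent_to_R p \<in> localization_in_R"
  by (rule localizationI[of 1 _ p]) (simp_all add: completion_hom_one)

lemma localization_add: "f \<in> localization_in_R \<Longrightarrow> g \<in> localization_in_R \<Longrightarrow> f + g \<in> localization_in_R"
proof -
  assume "f \<in> localization_in_R" "g \<in> localization_in_R"
  then obtain p q p' q' where *: "laurent_to_R q $ 0 \<noteq> 0" "f * laurent_to_R q = laurent_to_R p"
    "laurent_to_R q' $ 0 \<noteq> 0" "g * laurent_to_R q' = laurent_to_R p'" by (metis localizationD)
  have "(f + g) * laurent_to_R (q * q') =
      (f * laurent_to_R q) * laurent_to_R q' + (g * laurent_to_R q') * laurent_to_R q"
    by (simp add: completion_hom_mult algebra_simps)
  also have "\<dots> = laurent_to_R (p * q' + p' * q)"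
    unfolding * by (simp add: completion_hom_mult completion_hom_add)
  finally show ?thesis using * by (intro localizationI[of "q * q'"]) (simp_all add: completion_hom_mult)
qed

lemma localization_mult: "f \<in> localization_in_R \<Longrightarrow> g \<in> localization_in_R \<Longrightarrow> f * g \<in> localization_in_R"
proof -
  assume "f \<in> localization_in_R" "g \<in> localization_in_R"
  then obtain p q p' q' where *: "laurent_to_R q $ 0 \<noteq> 0" "f * laurent_to_R q = laurent_to_R p"
    "laurent_to_R q' $ 0 \<noteq> 0" "g * laurent_to_R q' = laurent_to_R p'" by (metis localizationD)
  have "(f * g) * laurent_to_R (q * q') = (f * laurent_to_R q) * (g * laurent_to_R q')"
    by (simp add: completion_hom_mult algebra_simps)
  also have "\<dots> = laurent_to_R (p * p')"
    unfolding * by (simp add: completion_hom_mult)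
  finally show ?thesis
    using * by (intro localizationI[of "q * q'" _ "p * p'"]) (simp_all add: completion_hom_mult)
qed

lemma localization_uminus: "f \<in> localization_in_R \<Longrightarrow> - f \<in> localization_in_R"
  by (metis laurent_to_R_minus localizationD localizationI mult_minus_left)

lemma localization_0: "0 \<in> localization_in_R" and localization_1: "1 \<in> localization_in_R"
  using localization_laurent[of 0] localization_laurent[of 1]
  by (simp_all add: completion_hom_one laurent_to_R_def)

lemma localization_diff: "f \<in> localization_in_R \<Longrightarrow> g \<in> localization_in_R \<Longrightarrow> f - g \<in> localization_in_R"
  using localization_add[of f "- g"] localization_uminus[of g] by simp

lemma localization_inverse:
  fixes f :: "rat fps"
  assumes "f \<in> localization_in_R" "f $ 0 \<noteq> 0"
  shows "inverse f \<in> localization_in_R"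
proof -
  obtain p q where *: "laurent_to_R q $ 0 \<noteq> 0" "f * laurent_to_R q = laurent_to_R p"
    using assms localizationD by metis
  have "laurent_to_R p $ 0 = f $ 0 * laurent_to_R q $ 0" unfolding *(2)[symmetric] by simp
  moreover have "inverse f * laurent_to_R p = (inverse f * f) * laurent_to_R q"
    unfolding *(2)[symmetric] by (simp add: mult.assoc)
  ultimately show ?thesis
    using assms * inverse_mult_eq_1[OF assms(2)] by (intro localizationI[of p _ q]) simp_all
qed

lemmas localization_closed =
  localization_0 localization_1 localization_add localization_mult localization_uminus
  localization_diff localization_inverse

section \<open>Polynomials over the localization and a square root of t modulo a product\<close>

definition loc_poly :: "rat fps poly \<Rightarrow> bool" where
  "loc_poly g \<longleftrightarrow> (\<forall>i. poly.coeff g i \<in> localization_in_R)"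

lemma loc_poly_pCons [simp]: "loc_poly (pCons a g) \<longleftrightarrow> a \<in> localization_in_R \<and> loc_poly g"
  unfolding loc_poly_def by (metis coeff_pCons_0 coeff_pCons_Suc not0_implies_Suc)

lemma loc_poly_0 [simp]: "loc_poly 0"
  by (simp add: loc_poly_def localization_0)

lemma loc_poly_1 [simp]: "loc_poly 1"
  unfolding one_pCons by (simp add: localization_1)

lemma loc_poly_add: "loc_poly g \<Longrightarrow> loc_poly h \<Longrightarrow> loc_poly (g + h)"
  by (simp add: loc_poly_def localization_add)

lemma loc_poly_smult: "a \<in> localization_in_R \<Longrightarrow> loc_poly g \<Longrightarrow> loc_poly (smult a g)"
  by (simp add: loc_poly_def localization_mult)

lemma loc_poly_mult: "loc_poly g \<Longrightarrow> loc_poly h \<Longrightarrow> loc_poly (g * h)"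
  by (induction g) (auto simp: loc_poly_add loc_poly_smult localization_0)

lemma loc_poly_eval: "loc_poly g \<Longrightarrow> a \<in> localization_in_R \<Longrightarrow> poly g a \<in> localization_in_R"
  by (induction g) (auto simp: localization_closed)

lemma loc_poly_synthetic_div: "loc_poly g \<Longrightarrow> a \<in> localization_in_R \<Longrightarrow> loc_poly (synthetic_div g a)"
  by (induction g) (auto simp: loc_poly_eval)

lemma loc_poly_prod:
  "\<forall>\<alpha>\<in>set as. \<alpha> \<in> localization_in_R \<Longrightarrow> loc_poly (\<Prod>\<alpha>\<leftarrow>as. [:- (\<alpha> * \<alpha>), 1:])"
  by (induction as) (simp_all add: loc_poly_mult localization_closed del: mult_pCons_left)

text \<open>Taking constant terms is a ring homomorphism, so modulo X the value of \<open>g\<close>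
  depends only on its argument modulo X.\<close>

lemma fps_nth_0_poly: "poly g b $ 0 = poly (map_poly (\<lambda>f. f $ 0) g) (b $ 0)"
  for g :: "rat fps poly"
  by (induction g) (auto simp: map_poly_pCons)

text \<open>Newton's method, with one more root \<open>\<alpha>\<^sup>2\<close> at each step.\<close>

lemma sqrt_modulo_product:
  assumes "\<And>\<alpha>. \<alpha> \<in> set as \<Longrightarrow> \<alpha> \<in> localization_in_R \<and> \<alpha> $ 0 = 1"
  shows "\<exists>g h. loc_poly g \<and> loc_poly h \<and> poly g 1 $ 0 = 1 \<and>
    g * g = [:0, 1:] + (\<Prod>\<alpha>\<leftarrow>as. [:- (\<alpha> * \<alpha>), 1:]) * h"
  using assms
proof (induction as)
  case Nil
  have "loc_poly (1 - [:0, 1:])"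
    unfolding one_pCons diff_pCons by (simp add: localization_closed)
  then show ?case by (intro exI[of _ 1] exI[of _ "1 - [:0, 1:]"]) simp
next
  case (Cons \<alpha> as)
  define p where "p = (\<Prod>\<alpha>\<leftarrow>as. [:- (\<alpha> * \<alpha>), 1:])"
  obtain g h where g: "loc_poly g" "loc_poly h" "poly g 1 $ 0 = 1" "g * g = [:0, 1:] + p * h"
    using Cons unfolding p_def by auto
  have p: "loc_poly p"
    unfolding p_def using Cons.prems by (intro loc_poly_prod) auto
  have \<alpha>: "\<alpha> \<in> localization_in_R" "\<alpha> $ 0 = 1" using Cons.prems by auto
  define b where "b = \<alpha> * \<alpha>"
  have b: "b \<in> localization_in_R" "b $ 0 = 1" using \<alpha> by (auto simp: b_def localization_closed)
  have at_b: "poly f b $ 0 = poly f 1 $ 0" for f :: "rat fps poly"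
    by (simp add: fps_nth_0_poly b)
  \<comment> \<open>Both summands are 1 modulo X, so \<open>u\<close> is 2 modulo X and hence a unit
    of the localization.\<close>
  define u where "u = poly g b + \<alpha>"
  have u: "u $ 0 \<noteq> 0" "u \<in> localization_in_R"
    using g \<alpha> b by (simp_all add: u_def at_b localization_closed loc_poly_eval)
  \<comment> \<open>The corrected polynomial g + c p is to take the value \<alpha> at b. Dividing by
    \<open>u\<close> instead of p(b) keeps \<open>c\<close> defined for a repeated root, where p(b)
    = 0.\<close>
  define c where "c = - poly h b * inverse u"
  have c: "c \<in> localization_in_R" using g u b by (simp add: c_def localization_closed loc_poly_eval)
  have cu: "c * u = - poly h b" using inverse_mult_eq_1[OF u(1)] by (simp add: c_def mult.assoc)
  have gb: "(poly g b - \<alpha>) * u = poly p b * poly h b"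
    using arg_cong[OF g(4), of "\<lambda>f. poly f b"] by (simp add: u_def b_def algebra_simps)
  have "(poly p b * c + (poly g b - \<alpha>)) * u = 0"
  proof -
    have "(poly p b * c + (poly g b - \<alpha>)) * u = poly p b * (c * u) + (poly g b - \<alpha>) * u"
      by (simp add: algebra_simps)
    then show ?thesis unfolding gb cu by simp
  qed
  then have pc: "poly p b * c = \<alpha> - poly g b"
  proof -
    have "u \<noteq> 0" using u(1) by auto
    with \<open>(poly p b * c + (poly g b - \<alpha>)) * u = 0\<close> have "poly p b * c + (poly g b - \<alpha>) = 0" by simp
    then show ?thesis by (simp add: algebra_simps eq_diff_eq)
  qed
  \<comment> \<open>The cofactor of p in (g + c p)^2 - t. Its zero at \<open>b\<close> supplies the
    new factor t - b.\<close>
  define k where "k = h + smult c (g + g) + smult (c * c) p"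
  have "poly k b = poly h b + c * (2 * poly g b + poly p b * c)"
    by (simp add: k_def algebra_simps)
  also have "\<dots> = 0" unfolding pc using cu by (simp add: u_def algebra_simps)
  finally have kb: "poly k b = 0" .
  have k: "loc_poly k"
    unfolding k_def using g p c
    by (intro loc_poly_add loc_poly_smult localization_mult) auto
  have kd: "k = [:- b, 1:] * synthetic_div k b"
    using synthetic_div_correct'[of b k] kb by simp
  have "(g + smult c p) * (g + smult c p) = [:0, 1:] + p * k"
    unfolding k_def using g(4) by (simp add: algebra_simps smult_add_left)
  then have "(g + smult c p) * (g + smult c p) = [:0, 1:] + ([:- b, 1:] * p) * synthetic_div k b"
    by (subst (asm) kd) (simp only: mult_ac)
  \<comment> \<open>Modulo X, g(1)^2 = 1 forces p(1) h(1) = 0, and \<open>c\<close> is a multiple of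
    h(1) there; so the correction leaves the normalization at 1 intact.\<close>
  moreover have "poly (g + smult c p) 1 $ 0 = 1"
  proof -
    have "poly p 1 $ 0 * poly h 1 $ 0 = 0"
      using arg_cong[OF g(4), of "\<lambda>f. poly f 1 $ 0"] g(3) by simp
    then have "poly p 1 $ 0 * c $ 0 = 0" by (auto simp: c_def at_b)
    then show ?thesis using g(3) by (simp add: mult.commute)
  qed
  ultimately show ?case
    using g p c k b unfolding p_def b_def
    by (intro exI[of _ "g + smult c p"] exI[of _ "synthetic_div k b"])
      (simp add: p_def b_def loc_poly_add loc_poly_smult loc_poly_synthetic_div)
qed

section \<open>The element \<open>w\<^sub>I\<close> in a specialized algebra\<close>

lemma foldr_concat_replicate: "foldr f (concat (replicate n xs)) = foldr f xs ^^ n"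
  by (induction n) auto

lemma monoid_ring_simps [simp]:
  "carrier (monoid_ring G) = {f. Poly_Mapping.keys f \<subseteq> carrier G}"
  "f \<oplus>\<^bsub>monoid_ring G\<^esub> g = f + g"
  "\<zero>\<^bsub>monoid_ring G\<^esub> = 0"
  "\<one>\<^bsub>monoid_ring G\<^esub> = Poly_Mapping.single \<one>\<^bsub>G\<^esub> 1"
  by (simp_all add: monoid_ring_def)

lemma monoid_ring_mult_single:
  "Poly_Mapping.single x a \<otimes>\<^bsub>monoid_ring G\<^esub> Poly_Mapping.single y b =
    Poly_Mapping.single (x \<otimes>\<^bsub>G\<^esub> y) (a * b)"
  by (cases "a = 0"; cases "b = 0") (simp_all add: monoid_ring_def)

lemma (in ring) finsum_closed_set:
  assumes "finite A" "\<And>a. a \<in> A \<Longrightarrow> f a \<in> M" "M \<subseteq> carrier R" "\<zero> \<in> M"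
    and "\<And>x y. x \<in> M \<Longrightarrow> y \<in> M \<Longrightarrow> x \<oplus> y \<in> M"
  shows "finsum R f A \<in> M"
  using assms(1,2)
proof (induction A rule: finite_induct)
  case (insert a A)
  then have "finsum R f (insert a A) = f a \<oplus> finsum R f A"
    using assms(3) by (intro finsum_insert) auto
  with insert show ?case using assms(5) by auto
qed (use assms in simp)

text \<open>The interface to R H_W: a ring with a homomorphism from R to its centre, elements T_s
  with the quadratic and braid relations, and a homomorphism \<phi> to QW that plays the role of v =
  1. Here v is 1 + X.\<close>

locale hecke_specialization = finite_coxeter_parabolic W S I + B: ring B
  for W :: "('a, 'm) monoid_scheme" (structure) and S I and B :: "('b, 'n) ring_scheme" +
  fixes \<iota> :: "rat fps \<Rightarrow> 'b" and T :: "'a \<Rightarrow> 'b" and \<phi> :: "'b \<Rightarrow> ('a \<Rightarrow>\<^sub>0 rat)"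
  assumes \<iota>_closed [simp]: "\<iota> a \<in> carrier B"
    and \<iota>_add: "\<iota> (a + b) = \<iota> a \<oplus>\<^bsub>B\<^esub> \<iota> b"
    and \<iota>_mult: "\<iota> (a * b) = \<iota> a \<otimes>\<^bsub>B\<^esub> \<iota> b"
    and \<iota>_one [simp]: "\<iota> 1 = \<one>\<^bsub>B\<^esub>"
    and \<iota>_central: "x \<in> carrier B \<Longrightarrow> x \<otimes>\<^bsub>B\<^esub> \<iota> a = \<iota> a \<otimes>\<^bsub>B\<^esub> x"
    and T_closed [simp]: "s \<in> I \<Longrightarrow> T s \<in> carrier B"
    and T_square: "s \<in> I \<Longrightarrow> T s \<otimes>\<^bsub>B\<^esub> T s =
      \<one>\<^bsub>B\<^esub> \<oplus>\<^bsub>B\<^esub> \<iota> ((1 + fps_X) - inverse (1 + fps_X)) \<otimes>\<^bsub>B\<^esub> T s"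
    and braid: "s \<in> I \<Longrightarrow> t \<in> I \<Longrightarrow>
      mprod B (alternating (ord (s \<otimes> t)) (T s) (T t)) = mprod B (alternating (ord (s \<otimes> t)) (T t) (T s))"
    and \<phi>_hom: "\<phi> \<in> Ring.ring_hom B (monoid_ring W)"
    and \<phi>_\<iota>: "\<phi> (\<iota> a) = Poly_Mapping.single \<one> (a $ 0)"
    and \<phi>_T: "s \<in> I \<Longrightarrow> \<phi> (T s) = Poly_Mapping.single s 1"
begin

definition q :: "rat fps" where "q = (1 + fps_X) - inverse (1 + fps_X)"

lemma \<iota>_0 [simp]: "\<iota> 0 = \<zero>\<^bsub>B\<^esub>"
  using \<iota>_add[of 0 0] B.add.l_cancel_one'[of "\<iota> 0" "\<iota> 0"] by simp

lemma \<iota>_uminus: "\<iota> (- a) = \<ominus>\<^bsub>B\<^esub> \<iota> a"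
  using \<iota>_add[of "- a" a] B.minus_equality[of "\<iota> (- a)" "\<iota> a"] by simp

lemma \<phi>_mult: "x \<in> carrier B \<Longrightarrow> y \<in> carrier B \<Longrightarrow> \<phi> (x \<otimes>\<^bsub>B\<^esub> y) = \<phi> x \<otimes>\<^bsub>monoid_ring W\<^esub> \<phi> y"
  using \<phi>_hom by (simp add: Ring.ring_hom_mult)

lemma \<phi>_add: "x \<in> carrier B \<Longrightarrow> y \<in> carrier B \<Longrightarrow> \<phi> (x \<oplus>\<^bsub>B\<^esub> y) = \<phi> x + \<phi> y"
  using Ring.ring_hom_add[OF \<phi>_hom] by simp

lemma \<phi>_one: "\<phi> \<one>\<^bsub>B\<^esub> = Poly_Mapping.single \<one> 1"
  using Ring.ring_hom_one[OF \<phi>_hom] by simp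

lemma \<phi>_zero: "\<phi> \<zero>\<^bsub>B\<^esub> = 0"
  using \<phi>_add[of "\<zero>\<^bsub>B\<^esub>" "\<zero>\<^bsub>B\<^esub>"] by simp

lemma \<iota>_left_commute: "x \<in> carrier B \<Longrightarrow> y \<in> carrier B \<Longrightarrow>
    x \<otimes>\<^bsub>B\<^esub> (\<iota> a \<otimes>\<^bsub>B\<^esub> y) = \<iota> a \<otimes>\<^bsub>B\<^esub> (x \<otimes>\<^bsub>B\<^esub> y)"
  by (simp add: \<iota>_central flip: B.m_assoc)

text \<open>R-linear combinations of a family in \<open>B\<close>. The family is a parameter because
  \<open>nakayama\<close> is applied to the elements T_w e instead of the T_w.\<close>

definition lincomb :: "'c set \<Rightarrow> ('c \<Rightarrow> 'b) \<Rightarrow> ('c \<Rightarrow> rat fps) \<Rightarrow> 'b" where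
  "lincomb A e f = finsum B (\<lambda>a. \<iota> (f a) \<otimes>\<^bsub>B\<^esub> e a) A"

lemma lincomb_closed [simp]: "e \<in> A \<rightarrow> carrier B \<Longrightarrow> lincomb A e f \<in> carrier B"
  unfolding lincomb_def by (intro B.finsum_closed) auto

lemma lincomb_empty [simp]: "lincomb {} e f = \<zero>\<^bsub>B\<^esub>"
  by (simp add: lincomb_def)

lemma lincomb_insert: "finite A \<Longrightarrow> a \<notin> A \<Longrightarrow> e \<in> insert a A \<rightarrow> carrier B \<Longrightarrow>
    lincomb (insert a A) e f = \<iota> (f a) \<otimes>\<^bsub>B\<^esub> e a \<oplus>\<^bsub>B\<^esub> lincomb A e f"
  unfolding lincomb_def by (intro B.finsum_insert) auto

lemma lincomb_add: "e \<in> A \<rightarrow> carrier B \<Longrightarrow>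
    lincomb A e (\<lambda>a. f a + g a) = lincomb A e f \<oplus>\<^bsub>B\<^esub> lincomb A e g"
proof -
  assume e: "e \<in> A \<rightarrow> carrier B"
  have "lincomb A e (\<lambda>a. f a + g a) =
      finsum B (\<lambda>a. \<iota> (f a) \<otimes>\<^bsub>B\<^esub> e a \<oplus>\<^bsub>B\<^esub> \<iota> (g a) \<otimes>\<^bsub>B\<^esub> e a) A"
    unfolding lincomb_def using e by (intro B.finsum_cong') (auto simp: \<iota>_add B.l_distr Pi_def)
  also have "\<dots> = lincomb A e f \<oplus>\<^bsub>B\<^esub> lincomb A e g"
    unfolding lincomb_def using e by (intro B.finsum_addf) auto
  finally show ?thesis .
qed

lemma lincomb_scale: "finite A \<Longrightarrow> e \<in> A \<rightarrow> carrier B \<Longrightarrow>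
    lincomb A e (\<lambda>a. c * f a) = \<iota> c \<otimes>\<^bsub>B\<^esub> lincomb A e f"
  unfolding lincomb_def
  by (subst B.finsum_rdistr) (auto intro!: B.finsum_cong' simp: \<iota>_mult B.m_assoc Pi_def)

lemma lincomb_cong: "(\<And>a. a \<in> A \<Longrightarrow> f a = g a) \<Longrightarrow> (\<And>a. a \<in> A \<Longrightarrow> e a = e' a) \<Longrightarrow>
    e' \<in> A \<rightarrow> carrier B \<Longrightarrow> lincomb A e f = lincomb A e' g"
  unfolding lincomb_def by (auto intro!: B.finsum_cong')

lemma lincomb_mult_right: "finite A \<Longrightarrow> e \<in> A \<rightarrow> carrier B \<Longrightarrow> x \<in> carrier B \<Longrightarrow>
    lincomb A e f \<otimes>\<^bsub>B\<^esub> x = lincomb A (\<lambda>a. e a \<otimes>\<^bsub>B\<^esub> x) f"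
  unfolding lincomb_def
  by (subst B.finsum_ldistr) (auto intro!: B.finsum_cong' simp: B.m_assoc Pi_def)

lemma lincomb_mult_left: "finite A \<Longrightarrow> e \<in> A \<rightarrow> carrier B \<Longrightarrow> x \<in> carrier B \<Longrightarrow>
    x \<otimes>\<^bsub>B\<^esub> lincomb A e f = lincomb A (\<lambda>a. x \<otimes>\<^bsub>B\<^esub> e a) f"
  unfolding lincomb_def
  by (subst B.finsum_rdistr) (auto intro!: B.finsum_cong' simp: \<iota>_left_commute Pi_def)

lemma lincomb_zero: "finite A \<Longrightarrow> e \<in> A \<rightarrow> carrier B \<Longrightarrow> lincomb A e (\<lambda>a. 0) = \<zero>\<^bsub>B\<^esub>"
  using lincomb_scale[of A e 0 "\<lambda>a. 0"] by simp

text \<open>One element is eliminated at a time: the coefficient 1 - X c_aa is a unit of R, so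
  \<open>e a\<close> is a combination of the others with coefficients divisible by X, and
  substituting it leaves a system of the same form.\<close>

lemma nakayama:
  assumes "finite A" "e \<in> A \<rightarrow> carrier B"
    and "\<And>a. a \<in> A \<Longrightarrow> e a = lincomb A e (\<lambda>b. fps_X * c a b)"
  shows "\<forall>a\<in>A. e a = \<zero>\<^bsub>B\<^esub>"
  using assms
proof (induction A arbitrary: c rule: finite_induct)
  case (insert a A)
  have ea: "e a \<in> carrier B" and eA: "e \<in> A \<rightarrow> carrier B" using insert.prems(1) by auto
  note fin = insert.hyps(1)
  define r where "r = inverse (1 - fps_X * c a a)"
  have "(1 - fps_X * c a a) * r = 1"
    unfolding r_def by (subst mult.commute) (rule inverse_mult_eq_1, simp)
  then have r: "r * (1 - fps_X * c a a) = 1" by (simp add: mult.commute)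
  have expand: "e b = \<iota> (fps_X * c b a) \<otimes>\<^bsub>B\<^esub> e a \<oplus>\<^bsub>B\<^esub> lincomb A e (\<lambda>b'. fps_X * c b b')"
    if "b \<in> insert a A" for b
    using insert.prems(2)[OF that] unfolding lincomb_insert[OF insert.hyps insert.prems(1)] .
  define y where "y = lincomb A e (\<lambda>b. fps_X * c a b)"
  have y: "y \<in> carrier B" using eA by (simp add: y_def)
  have "\<iota> (1 - fps_X * c a a) \<otimes>\<^bsub>B\<^esub> e a = \<iota> (- (fps_X * c a a)) \<otimes>\<^bsub>B\<^esub> e a \<oplus>\<^bsub>B\<^esub> e a"
    using ea \<iota>_add[of "- (fps_X * c a a)" 1] by (simp add: B.l_distr)
  also have "\<dots> = \<iota> (- (fps_X * c a a)) \<otimes>\<^bsub>B\<^esub> e a \<oplus>\<^bsub>B\<^esub>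
      (\<iota> (fps_X * c a a) \<otimes>\<^bsub>B\<^esub> e a \<oplus>\<^bsub>B\<^esub> y)"
    by (rule arg_cong[OF expand[of a, folded y_def]]) simp
  also have "\<dots> = \<iota> (- (fps_X * c a a) + fps_X * c a a) \<otimes>\<^bsub>B\<^esub> e a \<oplus>\<^bsub>B\<^esub> y"
    using ea y by (simp only: \<iota>_add) (simp add: B.a_assoc B.l_distr)
  also have "\<dots> = y" using ea y by simp
  finally have "\<iota> r \<otimes>\<^bsub>B\<^esub> (\<iota> (1 - fps_X * c a a) \<otimes>\<^bsub>B\<^esub> e a) = \<iota> r \<otimes>\<^bsub>B\<^esub> y"
    by (rule arg_cong)
  moreover have "\<iota> r \<otimes>\<^bsub>B\<^esub> (\<iota> (1 - fps_X * c a a) \<otimes>\<^bsub>B\<^esub> e a) = e a"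
    using ea r by (simp flip: B.m_assoc \<iota>_mult)
  moreover have "\<iota> r \<otimes>\<^bsub>B\<^esub> y = lincomb A e (\<lambda>b. r * (fps_X * c a b))"
    unfolding y_def by (rule lincomb_scale[OF fin eA, symmetric])
  ultimately have e_a: "e a = lincomb A e (\<lambda>b. r * (fps_X * c a b))" by (simp only:)
  have "e b = lincomb A e (\<lambda>b'. fps_X * (c b a * r * (fps_X * c a b') + c b b'))" if "b \<in> A" for b
  proof -
    have "e b = \<iota> (fps_X * c b a) \<otimes>\<^bsub>B\<^esub> e a \<oplus>\<^bsub>B\<^esub> lincomb A e (\<lambda>b'. fps_X * c b b')"
      using that by (intro expand) simp
    also have "\<iota> (fps_X * c b a) \<otimes>\<^bsub>B\<^esub> e a = lincomb A e (\<lambda>b'. fps_X * c b a * (r * (fps_X * c a b')))"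
      unfolding lincomb_scale[OF fin eA, of "fps_X * c b a"] by (rule arg_cong[OF e_a])
    also have "\<dots> \<oplus>\<^bsub>B\<^esub> lincomb A e (\<lambda>b'. fps_X * c b b') =
        lincomb A e (\<lambda>b'. fps_X * (c b a * r * (fps_X * c a b') + c b b'))"
      unfolding lincomb_add[OF eA, symmetric] by (simp only: distrib_left mult.assoc)
    finally show ?thesis .
  qed
  then have zero: "\<forall>b\<in>A. e b = \<zero>\<^bsub>B\<^esub>" by (rule insert.IH[OF eA])
  have "lincomb A e (\<lambda>b. r * (fps_X * c a b)) = lincomb A (\<lambda>b. \<zero>\<^bsub>B\<^esub>) (\<lambda>b. r * (fps_X * c a b))"
    by (rule lincomb_cong) (use zero in auto)
  also have "\<dots> = \<zero>\<^bsub>B\<^esub>" by (simp add: lincomb_def)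
  finally have "e a = \<zero>\<^bsub>B\<^esub>" unfolding e_a[symmetric] .
  then show ?case using zero by simp
qed simp

section \<open>The elements T_w and their linear combinations\<close>

definition Tw :: "'a \<Rightarrow> 'b" where
  "Tw w = mprod B (map T (SOME us. reduced us \<and> mprod W us = w))"

lemma T_lists [simp]: "us \<in> lists I \<Longrightarrow> map T us \<in> lists (carrier B)"
  by (induction us) auto

lemma mprod_T_unique:
  "reduced us \<Longrightarrow> reduced ws \<Longrightarrow> mprod W us = mprod W ws \<Longrightarrow> mprod B (map T us) = mprod B (map T ws)"
  by (rule matsumoto[OF B.monoid_axioms]) (auto intro: braid)

lemma Tw_reduced: "reduced us \<Longrightarrow> mprod W us = w \<Longrightarrow> Tw w = mprod B (map T us)"
  unfolding Tw_def by (rule mprod_T_unique) (auto intro: someI2[of _ us])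

lemma Tw_closed [simp]: "w \<in> WI \<Longrightarrow> Tw w \<in> carrier B"
  using ex_reduced[of w] by (auto simp: Tw_reduced reduced_lists intro!: B.mprod_closed)

lemma Tw_Pi [simp]: "Tw \<in> WI \<rightarrow> carrier B"
  by simp

lemma Tw_one [simp]: "Tw \<one> = \<one>\<^bsub>B\<^esub>"
  using Tw_reduced[of "[]" \<one>] by (simp add: reduced_def)

lemma Tw_gen_mult:
  assumes "s \<in> I" "w \<in> WI" "\<not> descent w s"
  shows "Tw (s \<otimes> w) = T s \<otimes>\<^bsub>B\<^esub> Tw w"
proof -
  obtain us where us: "reduced us" "mprod W us = w" using ex_reduced assms(2) by blast
  have "reduced (s # us)" using assms us by (intro Cons_reduced) auto
  then have "Tw (s \<otimes> w) = mprod B (map T (s # us))" using us by (intro Tw_reduced) auto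
  then show ?thesis using Tw_reduced[OF us] by simp
qed

text \<open>At a descent, w = s y with y shorter, and the quadratic relation in T_s T_s T_y produces
  the extra term.\<close>

lemma T_Tw:
  assumes "s \<in> I" "w \<in> WI"
  shows "T s \<otimes>\<^bsub>B\<^esub> Tw w = Tw (s \<otimes> w) \<oplus>\<^bsub>B\<^esub> \<iota> (if descent w s then q else 0) \<otimes>\<^bsub>B\<^esub> Tw w"
proof (cases "descent w s")
  case True
  define y where "y = s \<otimes> w"
  have y: "y \<in> WI" "\<not> descent y s" "w = s \<otimes> y"
    using assms True by (auto simp: y_def descent_gen_mult)
  have w: "Tw w = T s \<otimes>\<^bsub>B\<^esub> Tw y" using Tw_gen_mult[OF assms(1) y(1,2)] y(3) by simp
  have "T s \<otimes>\<^bsub>B\<^esub> Tw w = (T s \<otimes>\<^bsub>B\<^esub> T s) \<otimes>\<^bsub>B\<^esub> Tw y"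
    unfolding w using assms y by (simp add: B.m_assoc)
  also have "\<dots> = Tw y \<oplus>\<^bsub>B\<^esub> \<iota> q \<otimes>\<^bsub>B\<^esub> Tw w"
    unfolding T_square[OF assms(1)] q_def[symmetric] w using assms y
    by (simp add: B.l_distr B.m_assoc)
  finally show ?thesis using True by (simp add: y_def)
qed (use assms in \<open>simp add: Tw_gen_mult\<close>)

abbreviation Theta :: "('a \<Rightarrow> rat fps) \<Rightarrow> 'b" where "Theta \<equiv> lincomb WI Tw"

lemma Theta_delta: "w \<in> WI \<Longrightarrow> Theta (delta w) = Tw w"
proof -
  assume w: "w \<in> WI"
  have "Theta (delta w) = lincomb (insert w (WI - {w})) Tw (delta w)" using w by (simp add: insert_absorb)
  also have "\<dots> = Tw w \<oplus>\<^bsub>B\<^esub> lincomb (WI - {w}) Tw (delta w)"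
    using finite_WI w by (subst lincomb_insert) (auto simp: delta_def)
  also have "lincomb (WI - {w}) Tw (delta w) = lincomb (WI - {w}) Tw (\<lambda>x. 0)"
    by (intro lincomb_cong) (auto simp: delta_def)
  finally show ?thesis using w finite_WI by (simp add: lincomb_zero Pi_def)
qed

text \<open>This carries identities between operators on functions into \<open>B\<close>. The
  shifted term is obtained by reindexing the sum along w -> s w.\<close>

lemma T_Theta:
  assumes "s \<in> I"
  shows "T s \<otimes>\<^bsub>B\<^esub> Theta f = Theta (lmul q s f)"
proof -
  have "T s \<otimes>\<^bsub>B\<^esub> Theta f = finsum B (\<lambda>w. \<iota> (f w) \<otimes>\<^bsub>B\<^esub> (T s \<otimes>\<^bsub>B\<^esub> Tw w)) WI"
    using assms finite_WI by (simp add: lincomb_mult_left) (simp add: lincomb_def)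
  also have "\<dots> = finsum B (\<lambda>w. \<iota> (f w) \<otimes>\<^bsub>B\<^esub> Tw (s \<otimes> w) \<oplus>\<^bsub>B\<^esub>
      \<iota> (if descent w s then q * f w else 0) \<otimes>\<^bsub>B\<^esub> Tw w) WI"
  proof (intro B.finsum_cong')
    fix w assume w: "w \<in> WI"
    have "\<iota> (f w) \<otimes>\<^bsub>B\<^esub> (T s \<otimes>\<^bsub>B\<^esub> Tw w) = \<iota> (f w) \<otimes>\<^bsub>B\<^esub> Tw (s \<otimes> w) \<oplus>\<^bsub>B\<^esub>
        \<iota> (f w * (if descent w s then q else 0)) \<otimes>\<^bsub>B\<^esub> Tw w"
      unfolding T_Tw[OF assms w] \<iota>_mult using assms w by (simp add: B.r_distr B.m_assoc)
    also have "f w * (if descent w s then q else 0) = (if descent w s then q * f w else 0)"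
      by simp
    finally show "\<iota> (f w) \<otimes>\<^bsub>B\<^esub> (T s \<otimes>\<^bsub>B\<^esub> Tw w) = \<iota> (f w) \<otimes>\<^bsub>B\<^esub> Tw (s \<otimes> w) \<oplus>\<^bsub>B\<^esub>
        \<iota> (if descent w s then q * f w else 0) \<otimes>\<^bsub>B\<^esub> Tw w" .
  qed (use assms in auto)
  also have "\<dots> = finsum B (\<lambda>w. \<iota> (f w) \<otimes>\<^bsub>B\<^esub> Tw (s \<otimes> w)) WI \<oplus>\<^bsub>B\<^esub>
      Theta (\<lambda>w. if descent w s then q * f w else 0)"
    unfolding lincomb_def using assms by (intro B.finsum_addf) auto
  also have "finsum B (\<lambda>w. \<iota> (f w) \<otimes>\<^bsub>B\<^esub> Tw (s \<otimes> w)) WI = Theta (\<lambda>x. f (s \<otimes> x))"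
  proof -
    have inj: "inj_on ((\<otimes>) s) WI" using assms by (intro inj_onI) (metis I_closed WI_closed l_cancel)
    have im: "(\<otimes>) s ` WI = WI"
    proof
      show "WI \<subseteq> (\<otimes>) s ` WI"
      proof
        fix w assume "w \<in> WI"
        then show "w \<in> (\<otimes>) s ` WI" using assms by (intro image_eqI[of _ _ "s \<otimes> w"]) auto
      qed
    qed (use assms in auto)
    have "Theta (\<lambda>x. f (s \<otimes> x)) = finsum B (\<lambda>x. \<iota> (f (s \<otimes> x)) \<otimes>\<^bsub>B\<^esub> Tw x) ((\<otimes>) s ` WI)"
      by (simp add: lincomb_def im)
    also have "\<dots> = finsum B (\<lambda>w. \<iota> (f (s \<otimes> (s \<otimes> w))) \<otimes>\<^bsub>B\<^esub> Tw (s \<otimes> w)) WI"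
      using inj assms by (intro B.finsum_reindex) auto
    also have "\<dots> = finsum B (\<lambda>w. \<iota> (f w) \<otimes>\<^bsub>B\<^esub> Tw (s \<otimes> w)) WI"
      using assms by (intro B.finsum_cong') auto
    finally show ?thesis by simp
  qed
  also have "Theta (\<lambda>x. f (s \<otimes> x)) \<oplus>\<^bsub>B\<^esub> Theta (\<lambda>w. if descent w s then q * f w else 0) =
      Theta (\<lambda>x. f (s \<otimes> x) + (if descent x s then q * f x else 0))"
    by (rule lincomb_add[symmetric]) simp
  also have "\<dots> = Theta (lmul q s f)"
    by (rule lincomb_cong) (auto simp: lmul_def)
  finally show ?thesis .
qed

lemma q_nth_0: "q $ 0 = 0"
  by (simp add: q_def)

lemma one_plus_X_localization: "1 + fps_X \<in> localization_in_R" "inverse (1 + fps_X) \<in> localization_in_R"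
proof -
  have "laurent_to_R v = 1 + fps_X" by (simp add: vpow_def completion_single)
  then show *: "1 + fps_X \<in> localization_in_R" using localization_laurent[of v] by simp
  show "inverse (1 + fps_X) \<in> localization_in_R"
    by (rule localization_inverse[OF *]) simp
qed

lemma q_localization: "q \<in> localization_in_R"
  unfolding q_def by (intro localization_closed one_plus_X_localization)

text \<open>The inverse of T_s: the quadratic relation says T_s (T_s - q) = 1.\<close>

definition Tinv :: "'a \<Rightarrow> 'b" where
  "Tinv s = T s \<oplus>\<^bsub>B\<^esub> \<iota> (- q)"

lemma Tinv_closed [simp]: "s \<in> I \<Longrightarrow> Tinv s \<in> carrier B"
  by (simp add: Tinv_def)

lemma T_Tinv: "s \<in> I \<Longrightarrow> T s \<otimes>\<^bsub>B\<^esub> Tinv s = \<one>\<^bsub>B\<^esub>" "s \<in> I \<Longrightarrow> Tinv s \<otimes>\<^bsub>B\<^esub> T s = \<one>\<^bsub>B\<^esub>"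
proof -
  assume s: "s \<in> I"
  have "T s \<otimes>\<^bsub>B\<^esub> T s \<oplus>\<^bsub>B\<^esub> \<iota> (- q) \<otimes>\<^bsub>B\<^esub> T s = \<one>\<^bsub>B\<^esub> \<oplus>\<^bsub>B\<^esub> \<iota> (q + - q) \<otimes>\<^bsub>B\<^esub> T s"
    unfolding T_square[OF s] \<iota>_add q_def[symmetric] using s by (simp add: B.a_assoc B.l_distr)
  then have *: "T s \<otimes>\<^bsub>B\<^esub> T s \<oplus>\<^bsub>B\<^esub> \<iota> (- q) \<otimes>\<^bsub>B\<^esub> T s = \<one>\<^bsub>B\<^esub>" using s by simp
  then show "Tinv s \<otimes>\<^bsub>B\<^esub> T s = \<one>\<^bsub>B\<^esub>" using s by (simp add: Tinv_def B.l_distr)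
  show "T s \<otimes>\<^bsub>B\<^esub> Tinv s = \<one>\<^bsub>B\<^esub>" using * s \<iota>_central[of "T s" "- q"] by (simp add: Tinv_def B.r_distr)
qed

lemma Tinv_lists [simp]: "us \<in> lists I \<Longrightarrow> map Tinv us \<in> lists (carrier B)"
  by (induction us) auto

lemma mprod_T_closed: "us \<in> lists I \<Longrightarrow> mprod B (map T us) \<in> carrier B"
  by (rule B.mprod_closed[OF T_lists])

lemma mprod_Tinv_closed: "us \<in> lists I \<Longrightarrow> mprod B (map Tinv us) \<in> carrier B"
  by (rule B.mprod_closed[OF Tinv_lists])

lemma mprod_Tinv:
  assumes "us \<in> lists I"
  shows "mprod B (map T us) \<otimes>\<^bsub>B\<^esub> mprod B (map Tinv (rev us)) = \<one>\<^bsub>B\<^esub>"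
    and "mprod B (map Tinv (rev us)) \<otimes>\<^bsub>B\<^esub> mprod B (map T us) = \<one>\<^bsub>B\<^esub>"
  using assms
proof (induction us)
  case (Cons s us)
  define x y where "x = mprod B (map T us)" and "y = mprod B (map Tinv (rev us))"
  have us: "us \<in> lists I" "rev us \<in> lists I" "s \<in> I" using Cons by auto
  have xy: "x \<in> carrier B" "y \<in> carrier B"
    unfolding x_def y_def by (rule mprod_T_closed[OF us(1)], rule mprod_Tinv_closed[OF us(2)])
  have e: "mprod B (map T (s # us)) = T s \<otimes>\<^bsub>B\<^esub> x" "mprod B (map Tinv (rev (s # us))) = y \<otimes>\<^bsub>B\<^esub> Tinv s"
    using us Tinv_lists[OF us(2)] unfolding x_def y_def by (simp_all add: B.mprod_append)
  note IH = Cons.IH[folded x_def y_def]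
  {
    case 1
    have "(T s \<otimes>\<^bsub>B\<^esub> x) \<otimes>\<^bsub>B\<^esub> (y \<otimes>\<^bsub>B\<^esub> Tinv s) = T s \<otimes>\<^bsub>B\<^esub> (x \<otimes>\<^bsub>B\<^esub> y) \<otimes>\<^bsub>B\<^esub> Tinv s"
      using xy us by (simp add: B.m_assoc)
    then show ?case unfolding e using IH us by (simp add: T_Tinv)
  next
    case 2
    have "(y \<otimes>\<^bsub>B\<^esub> Tinv s) \<otimes>\<^bsub>B\<^esub> (T s \<otimes>\<^bsub>B\<^esub> x) = y \<otimes>\<^bsub>B\<^esub> (Tinv s \<otimes>\<^bsub>B\<^esub> T s) \<otimes>\<^bsub>B\<^esub> x"
      using xy us by (simp add: B.m_assoc)
    then show ?case unfolding e using IH us xy by (simp add: T_Tinv)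
  }
qed simp_all

section \<open>The full twist in the algebra and polynomials in it\<close>

definition Tw0 :: 'b where "Tw0 = mprod B (map T w0_word)"
definition Tw0_inv :: 'b where "Tw0_inv = mprod B (map Tinv (rev w0_word))"
definition z :: 'b where "z = Tw0 \<otimes>\<^bsub>B\<^esub> Tw0"

lemma Tw0_closed [simp]: "Tw0 \<in> carrier B" "Tw0_inv \<in> carrier B" "z \<in> carrier B"
proof -
  have r: "rev w0_word \<in> lists I" using w0_word(3) by auto
  show Tw0: "Tw0 \<in> carrier B" "Tw0_inv \<in> carrier B" unfolding Tw0_def Tw0_inv_def
    by (rule mprod_T_closed[OF w0_word(3)], rule mprod_Tinv_closed[OF r])
  show "z \<in> carrier B" using Tw0 by (simp add: z_def)
qed

lemma Tw0_inverse: "Tw0 \<otimes>\<^bsub>B\<^esub> Tw0_inv = \<one>\<^bsub>B\<^esub>" "Tw0_inv \<otimes>\<^bsub>B\<^esub> Tw0 = \<one>\<^bsub>B\<^esub>"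
  unfolding Tw0_def Tw0_inv_def by (rule mprod_Tinv[OF w0_word(3)])+

lemma Tw0_intertwines: "s \<in> I \<Longrightarrow> T s \<otimes>\<^bsub>B\<^esub> Tw0 = Tw0 \<otimes>\<^bsub>B\<^esub> T (w0 \<otimes> s \<otimes> w0)"
  unfolding Tw0_def
  by (rule longest_intertwines[OF B.monoid_axioms]) (auto intro: mprod_T_unique w0_word)

lemma Tw0_inv_intertwines:
  assumes "s \<in> I"
  shows "Tw0_inv \<otimes>\<^bsub>B\<^esub> T s = T (w0 \<otimes> s \<otimes> w0) \<otimes>\<^bsub>B\<^esub> Tw0_inv"
proof -
  let ?t = "T (w0 \<otimes> s \<otimes> w0)"
  have t: "?t \<in> carrier B" using w0_conj(1)[OF assms] by simp
  have "Tw0_inv \<otimes>\<^bsub>B\<^esub> T s = Tw0_inv \<otimes>\<^bsub>B\<^esub> (T s \<otimes>\<^bsub>B\<^esub> Tw0) \<otimes>\<^bsub>B\<^esub> Tw0_inv"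
    using assms by (simp add: B.m_assoc Tw0_inverse)
  also have "\<dots> = (Tw0_inv \<otimes>\<^bsub>B\<^esub> Tw0) \<otimes>\<^bsub>B\<^esub> ?t \<otimes>\<^bsub>B\<^esub> Tw0_inv"
    unfolding Tw0_intertwines[OF assms] using t by (simp add: B.m_assoc)
  finally show ?thesis using t by (simp add: Tw0_inverse)
qed

text \<open>Moving T_s past T_w0 replaces \<open>s\<close> by w0 s w0; doing so twice restores
  \<open>s\<close>.\<close>

lemma z_commute:
  assumes "s \<in> I"
  shows "z \<otimes>\<^bsub>B\<^esub> T s = T s \<otimes>\<^bsub>B\<^esub> z"
proof -
  let ?t = "w0 \<otimes> s \<otimes> w0"
  have t: "?t \<in> I" "w0 \<otimes> ?t \<otimes> w0 = s" using w0_conj(1)[OF assms] assms by (simp_all add: m_assoc)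
  have "T s \<otimes>\<^bsub>B\<^esub> z = Tw0 \<otimes>\<^bsub>B\<^esub> (T ?t \<otimes>\<^bsub>B\<^esub> Tw0)"
    unfolding z_def using assms t by (simp add: Tw0_intertwines B.m_assoc flip: B.m_assoc[of "T s"])
  also have "\<dots> = z \<otimes>\<^bsub>B\<^esub> T s"
    unfolding Tw0_intertwines[OF t(1)] t(2) z_def using assms by (simp add: B.m_assoc)
  finally show ?thesis by simp
qed

lemma mprod_Theta: "us \<in> lists I \<Longrightarrow> mprod B (map T us) \<otimes>\<^bsub>B\<^esub> Theta f = Theta (foldr (lmul q) us f)"
proof (induction us)
  case (Cons s us)
  have "mprod B (map T us) \<in> carrier B" using Cons.prems by (intro mprod_T_closed) simp
  with Cons show ?case by (simp add: B.m_assoc T_Theta)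
qed simp

lemma z_Theta: "z \<otimes>\<^bsub>B\<^esub> Theta f = Theta (full_twist q f)"
proof -
  have "z \<otimes>\<^bsub>B\<^esub> Theta f = Tw0 \<otimes>\<^bsub>B\<^esub> (Tw0 \<otimes>\<^bsub>B\<^esub> Theta f)" by (simp add: z_def B.m_assoc)
  then show ?thesis using w0_word(3) by (simp add: Tw0_def mprod_Theta full_twist_def)
qed

text \<open>Horner evaluation at \<open>z\<close>. It is multiplicative even though \<open>B\<close>
  need not be commutative, because the coefficients are central.\<close>

definition pev :: "rat fps poly \<Rightarrow> 'b" where
  "pev g = fold_coeffs (\<lambda>a x. \<iota> a \<oplus>\<^bsub>B\<^esub> z \<otimes>\<^bsub>B\<^esub> x) g \<zero>\<^bsub>B\<^esub>"

lemma pev_0 [simp]: "pev 0 = \<zero>\<^bsub>B\<^esub>"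
  by (simp add: pev_def)

lemma pev_pCons [simp]: "pev (pCons a g) = \<iota> a \<oplus>\<^bsub>B\<^esub> z \<otimes>\<^bsub>B\<^esub> pev g"
  by (cases "a = 0 \<and> g = 0") (auto simp: pev_def)

lemma pev_closed [simp]: "pev g \<in> carrier B"
  by (induction g) auto

lemma pev_1 [simp]: "pev 1 = \<one>\<^bsub>B\<^esub>"
  unfolding one_pCons by simp

lemma pev_add: "pev (g + h) = pev g \<oplus>\<^bsub>B\<^esub> pev h"
  by (induction g h rule: poly_induct2) (simp_all add: \<iota>_add B.r_distr B.a_ac)

lemma pev_smult: "pev (smult a g) = \<iota> a \<otimes>\<^bsub>B\<^esub> pev g"
  by (induction g) (simp_all add: \<iota>_mult B.r_distr \<iota>_left_commute)

lemma pev_mult: "pev (g * h) = pev g \<otimes>\<^bsub>B\<^esub> pev h"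
  by (induction g) (simp_all add: pev_add pev_smult B.l_distr B.m_assoc)

lemma pev_commute:
  assumes "x \<in> carrier B" "x \<otimes>\<^bsub>B\<^esub> z = z \<otimes>\<^bsub>B\<^esub> x"
  shows "x \<otimes>\<^bsub>B\<^esub> pev g = pev g \<otimes>\<^bsub>B\<^esub> x"
proof (induction g)
  case (pCons a g)
  have "x \<otimes>\<^bsub>B\<^esub> (z \<otimes>\<^bsub>B\<^esub> pev g) = z \<otimes>\<^bsub>B\<^esub> (x \<otimes>\<^bsub>B\<^esub> pev g)"
    using assms by (simp flip: B.m_assoc)
  with pCons assms show ?case by (simp add: B.r_distr B.l_distr \<iota>_central B.m_assoc)
qed (use assms in simp)

lemma pev_prod_Theta:
  "pev (\<Prod>\<alpha>\<leftarrow>as. [:- (\<alpha> * \<alpha>), 1:]) \<otimes>\<^bsub>B\<^esub> Theta f =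
    Theta (foldr (\<lambda>\<alpha> f x. full_twist q f x - \<alpha>\<^sup>2 * f x) as f)"
proof (induction as)
  case (Cons \<alpha> as)
  define h where "h = foldr (\<lambda>\<alpha> f x. full_twist q f x - \<alpha>\<^sup>2 * f x) as f"
  define g where "g = (\<Prod>\<alpha>\<leftarrow>as. [:- (\<alpha> * \<alpha>), 1:])"
  have "pev (\<Prod>\<alpha>\<leftarrow>\<alpha> # as. [:- (\<alpha> * \<alpha>), 1:]) \<otimes>\<^bsub>B\<^esub> Theta f =
      pev [:- (\<alpha> * \<alpha>), 1:] \<otimes>\<^bsub>B\<^esub> (pev g \<otimes>\<^bsub>B\<^esub> Theta f)"
    by (simp only: list.map prod_list.Cons pev_mult g_def[symmetric])
      (rule B.m_assoc; simp del: pev_pCons)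
  also have "pev g \<otimes>\<^bsub>B\<^esub> Theta f = Theta h" using Cons by (simp only: g_def h_def)
  also have "pev [:- (\<alpha> * \<alpha>), 1:] \<otimes>\<^bsub>B\<^esub> Theta h =
      \<iota> (- (\<alpha> * \<alpha>)) \<otimes>\<^bsub>B\<^esub> Theta h \<oplus>\<^bsub>B\<^esub> z \<otimes>\<^bsub>B\<^esub> Theta h"
    by (simp add: B.l_distr)
  also have "\<dots> = Theta (\<lambda>x. - (\<alpha> * \<alpha>) * h x + full_twist q h x)"
    unfolding z_Theta lincomb_scale[OF finite_WI Tw_Pi, symmetric] lincomb_add[OF Tw_Pi] ..
  also have "(\<lambda>x. - (\<alpha> * \<alpha>) * h x + full_twist q h x) =
      foldr (\<lambda>\<alpha> f x. full_twist q f x - \<alpha>\<^sup>2 * f x) (\<alpha> # as) f"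
    by (simp add: h_def power2_eq_square fun_eq_iff)
  finally show ?case .
qed simp

text \<open>On \<open>Theta (delta \<one>)\<close>, which is the unit of \<open>B\<close>, the
  product acts as \<open>twist_ann\<close> does on \<open>delta \<one>\<close>; so the vanishing of
  one function annihilates the element itself.\<close>

lemma pev_annihilator:
  "pev (\<Prod>\<alpha>\<leftarrow>concat (replicate (card WI) (twist_roots (1 + fps_X) (inverse (1 + fps_X)))).
    [:- (\<alpha> * \<alpha>), 1:]) = \<zero>\<^bsub>B\<^esub>" (is "pev ?p = _")
proof -
  have "pev ?p \<otimes>\<^bsub>B\<^esub> Theta (delta \<one>) =
      Theta (twist_ann (1 + fps_X) (inverse (1 + fps_X)) (delta \<one>))"
    unfolding pev_prod_Theta by (simp only: twist_ann_def q_def foldr_concat_replicate)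
  also have "twist_ann (1 + fps_X) (inverse (1 + fps_X)) (delta \<one>) = (\<lambda>x. 0 :: rat fps)"
    by (rule ext) (rule twist_ann_eq_0)
  also have "Theta (\<lambda>x. 0) = \<zero>\<^bsub>B\<^esub>" using finite_WI by (intro lincomb_zero) auto
  finally show ?thesis by (simp add: Theta_delta)
qed

lemma \<phi>_mprod: "us \<in> lists I \<Longrightarrow> \<phi> (mprod B (map T us)) = Poly_Mapping.single (mprod W us) 1"
proof (induction us)
  case (Cons s us)
  have "mprod B (map T us) \<in> carrier B" using Cons.prems by (intro mprod_T_closed) simp
  with Cons show ?case by (simp add: \<phi>_mult \<phi>_T monoid_ring_mult_single)
qed (simp add: \<phi>_one)

lemma \<phi>_mprod_Tinv: "us \<in> lists I \<Longrightarrow> \<phi> (mprod B (map Tinv us)) = Poly_Mapping.single (mprod W us) 1"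
proof (induction us)
  case (Cons s us)
  have "mprod B (map Tinv us) \<in> carrier B" using Cons.prems by (intro mprod_Tinv_closed) simp
  moreover have "\<phi> (Tinv s) = Poly_Mapping.single s 1"
    using Cons.prems by (simp add: Tinv_def \<phi>_add \<phi>_T \<phi>_\<iota> q_nth_0)
  ultimately show ?case using Cons by (simp add: \<phi>_mult monoid_ring_mult_single)
qed (simp add: \<phi>_one)

lemma \<phi>_Tw0: "\<phi> Tw0 = Poly_Mapping.single w0 1" "\<phi> Tw0_inv = Poly_Mapping.single w0 1"
proof -
  have "rev w0_word \<in> lists I" using w0_word(3) by auto
  then show "\<phi> Tw0 = Poly_Mapping.single w0 1" "\<phi> Tw0_inv = Poly_Mapping.single w0 1"
    unfolding Tw0_def Tw0_inv_def using w0_word mprod_rev[OF lists_I_gen[OF w0_word(3)]]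
    by (simp_all add: \<phi>_mprod \<phi>_mprod_Tinv)
qed

text \<open>As \<open>z\<close> specializes to w0^2 = 1, g(z) specializes to g(1) at v = 1. This is
  the origin of the normalization in \<open>sqrt_modulo_product\<close>.\<close>

lemma \<phi>_pev: "\<phi> (pev g) = Poly_Mapping.single \<one> (poly g 1 $ 0)"
proof (induction g)
  case (pCons a g)
  have "\<phi> z = Poly_Mapping.single \<one> 1" by (simp add: z_def \<phi>_mult \<phi>_Tw0 monoid_ring_mult_single)
  with pCons show ?case
    by (simp add: \<phi>_add \<phi>_mult \<phi>_\<iota> monoid_ring_mult_single single_add)
qed (simp add: \<phi>_zero)

text \<open>The counterpart of \<open>is_tilde_w\<close> in \<open>B\<close>:
  \<open>range Theta\<close> stands for R H_I, and the conjugation is multiplied out, which x^2 = 1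
  makes equivalent.\<close>

definition is_tilde :: "'b \<Rightarrow> bool" where
  "is_tilde x \<longleftrightarrow> x \<in> range Theta \<and> x \<otimes>\<^bsub>B\<^esub> x = \<one>\<^bsub>B\<^esub> \<and> \<phi> x = Poly_Mapping.single w0 1 \<and>
     (\<forall>s\<in>I. x \<otimes>\<^bsub>B\<^esub> T s = T (w0 \<otimes> s \<otimes> w0) \<otimes>\<^bsub>B\<^esub> x)"

lemma Theta_closed: "x \<in> range Theta \<Longrightarrow> x \<in> carrier B"
  by (auto intro: lincomb_closed)

lemma Theta_add_closed: "x \<in> range Theta \<Longrightarrow> y \<in> range Theta \<Longrightarrow> x \<oplus>\<^bsub>B\<^esub> y \<in> range Theta"
  by (auto simp: lincomb_add[symmetric])

lemma Theta_scale_closed: "x \<in> range Theta \<Longrightarrow> \<iota> a \<otimes>\<^bsub>B\<^esub> x \<in> range Theta"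
  using finite_WI by (auto simp: lincomb_scale[symmetric])

lemma Theta_zero: "\<zero>\<^bsub>B\<^esub> \<in> range Theta"
  using lincomb_zero[OF finite_WI Tw_Pi] by (metis rangeI)

lemma Theta_one: "\<one>\<^bsub>B\<^esub> \<in> range Theta"
  using Theta_delta[of \<one>] by (metis Tw_one WI_one rangeI)

lemma Theta_\<iota>: "\<iota> a \<in> range Theta"
  using Theta_scale_closed[OF Theta_one, of a] by simp

lemma T_Theta_closed: "s \<in> I \<Longrightarrow> x \<in> range Theta \<Longrightarrow> T s \<otimes>\<^bsub>B\<^esub> x \<in> range Theta"
  by (auto simp: T_Theta)

lemma Theta_T: "s \<in> I \<Longrightarrow> T s \<in> range Theta"
  using T_Theta_closed[OF _ Theta_one] by simp

text \<open>Stability under left multiplication by each T_s passes to each T_w and then to their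
  combinations.\<close>

lemma Theta_mult_closed:
  assumes "x \<in> range Theta" "y \<in> range Theta"
  shows "x \<otimes>\<^bsub>B\<^esub> y \<in> range Theta"
proof -
  obtain f where f: "x = Theta f" using assms(1) by blast
  have y: "y \<in> carrier B" using Theta_closed assms(2) by blast
  have Tw: "Tw w \<otimes>\<^bsub>B\<^esub> y \<in> range Theta" if w: "w \<in> WI" for w
  proof -
    obtain us where "reduced us" "mprod W us = w" using ex_reduced[OF w] by blast
    then show ?thesis using assms(2) mprod_Theta[of us] by (auto simp: Tw_reduced reduced_lists)
  qed
  have "x \<otimes>\<^bsub>B\<^esub> y = lincomb WI (\<lambda>w. Tw w \<otimes>\<^bsub>B\<^esub> y) f"
    unfolding f by (rule lincomb_mult_right[OF finite_WI Tw_Pi y])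
  also have "\<dots> \<in> range Theta"
    unfolding lincomb_def[of WI "\<lambda>w. Tw w \<otimes>\<^bsub>B\<^esub> y" f]
  proof (rule B.finsum_closed_set[OF finite_WI])
    show "range Theta \<subseteq> carrier B" using Theta_closed by blast
  qed (rule Theta_scale_closed[OF Tw] Theta_zero Theta_add_closed; assumption)+
  finally show ?thesis .
qed

text \<open>The clause about \<open>Y\<close> expresses that \<open>x\<close> is built from the T_s
  and scalars of the localization by sums and products. Stated for every closed \<open>Y\<close>, it
  can be used twice: with \<open>range Theta\<close> inside this proof, and later with the localized
  span of H_I.\<close>

lemma tilde_exists:
  "\<exists>x. is_tilde x \<and> (\<forall>Y. Y \<subseteq> carrier B \<longrightarrow> (\<forall>a\<in>localization_in_R. \<iota> a \<in> Y) \<longrightarrow> (\<forall>s\<in>I. T s \<in> Y) \<longrightarrow>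
    (\<forall>x\<in>Y. \<forall>y\<in>Y. x \<oplus>\<^bsub>B\<^esub> y \<in> Y \<and> x \<otimes>\<^bsub>B\<^esub> y \<in> Y) \<longrightarrow> x \<in> Y)"
proof -
  define as where "as = concat (replicate (card WI) (twist_roots (1 + fps_X) (inverse (1 + fps_X :: rat fps))))"
  have "\<alpha> \<in> localization_in_R \<and> \<alpha> $ 0 = 1" if "\<alpha> \<in> set as" for \<alpha>
  proof -
    have pow: "a ^ n \<in> localization_in_R" if "a \<in> localization_in_R" for a n
      using that by (induction n) (auto intro: localization_closed)
    have "\<alpha> \<in> set (twist_roots (1 + fps_X) (inverse (1 + fps_X)))" using that by (auto simp: as_def)
    then obtain j where "\<alpha> = (1 + fps_X) ^ j * inverse (1 + fps_X) ^ len w0"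
      unfolding twist_roots_def set_map by blast
    then show ?thesis by (simp add: localization_mult pow one_plus_X_localization fps_nth_power_0)
  qed
  then obtain g h where g: "loc_poly g" "poly g 1 $ 0 = 1"
      "g * g = [:0, 1:] + (\<Prod>\<alpha>\<leftarrow>as. [:- (\<alpha> * \<alpha>), 1:]) * h"
    using sqrt_modulo_product[of as] by blast
  define y where "y = pev g"
  \<comment> \<open>The same element as T_w0 y^-1, since y^2 is the square of T_w0 and y commutes
    with T_w0; in this form \<open>y\<close> is not inverted.\<close>
  define x where "x = Tw0_inv \<otimes>\<^bsub>B\<^esub> y"
  have y: "y \<in> carrier B" by (simp add: y_def)
  have x: "x \<in> carrier B" by (simp add: x_def y)
  have "y \<otimes>\<^bsub>B\<^esub> y = pev [:0, 1:] \<oplus>\<^bsub>B\<^esub> pev (\<Prod>\<alpha>\<leftarrow>as. [:- (\<alpha> * \<alpha>), 1:]) \<otimes>\<^bsub>B\<^esub> pev h"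
    unfolding y_def pev_mult[symmetric] g(3) by (simp only: pev_add pev_mult)
  then have yy: "y \<otimes>\<^bsub>B\<^esub> y = z"
    using pev_annihilator by (simp add: as_def)
  have zinv: "z \<otimes>\<^bsub>B\<^esub> Tw0_inv = Tw0" "Tw0_inv \<otimes>\<^bsub>B\<^esub> z = Tw0"
    by (simp_all add: z_def B.m_assoc Tw0_inverse, simp add: Tw0_inverse flip: B.m_assoc)
  have yP: "Tw0_inv \<otimes>\<^bsub>B\<^esub> y = y \<otimes>\<^bsub>B\<^esub> Tw0_inv"
    unfolding y_def by (rule pev_commute) (simp_all add: zinv)
  have yT: "T s \<otimes>\<^bsub>B\<^esub> y = y \<otimes>\<^bsub>B\<^esub> T s" if "s \<in> I" for s
    unfolding y_def using that by (intro pev_commute) (simp_all add: z_commute)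
  have "x \<otimes>\<^bsub>B\<^esub> x = x \<otimes>\<^bsub>B\<^esub> (y \<otimes>\<^bsub>B\<^esub> Tw0_inv)"
    by (subst (2) x_def) (simp only: yP)
  also have "\<dots> = Tw0_inv \<otimes>\<^bsub>B\<^esub> (y \<otimes>\<^bsub>B\<^esub> y) \<otimes>\<^bsub>B\<^esub> Tw0_inv"
    unfolding x_def using y by (simp add: B.m_assoc)
  finally have xx: "x \<otimes>\<^bsub>B\<^esub> x = \<one>\<^bsub>B\<^esub>" by (simp add: yy zinv Tw0_inverse)
  have \<phi>x: "\<phi> x = Poly_Mapping.single w0 1"
    using y g(2) by (simp add: x_def \<phi>_mult \<phi>_Tw0 y_def \<phi>_pev monoid_ring_mult_single)
  have conj: "x \<otimes>\<^bsub>B\<^esub> T s = T (w0 \<otimes> s \<otimes> w0) \<otimes>\<^bsub>B\<^esub> x" if "s \<in> I" for s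
  proof -
    have "x \<otimes>\<^bsub>B\<^esub> T s = Tw0_inv \<otimes>\<^bsub>B\<^esub> T s \<otimes>\<^bsub>B\<^esub> y"
      unfolding x_def using y that by (simp add: B.m_assoc yT)
    then show ?thesis
      unfolding x_def using y that w0_conj(1)[OF that] by (simp add: Tw0_inv_intertwines B.m_assoc)
  qed
  have closed: "x \<in> Y" if Y: "Y \<subseteq> carrier B" "\<forall>a\<in>localization_in_R. \<iota> a \<in> Y" "\<forall>s\<in>I. T s \<in> Y"
    "\<forall>x\<in>Y. \<forall>y\<in>Y. x \<oplus>\<^bsub>B\<^esub> y \<in> Y \<and> x \<otimes>\<^bsub>B\<^esub> y \<in> Y" for Y
  proof -
    have one: "\<one>\<^bsub>B\<^esub> \<in> Y" "\<zero>\<^bsub>B\<^esub> \<in> Y"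
      using Y(2) localization_0 localization_1 by (metis \<iota>_one, metis \<iota>_0)
    have T: "mprod B (map f us) \<in> Y" if "us \<in> lists I" "\<And>s. s \<in> I \<Longrightarrow> f s \<in> Y" for us f
      using that one Y(4) by (induction us) auto
    have Tinv: "Tinv s \<in> Y" if "s \<in> I" for s
      unfolding Tinv_def using that Y q_localization localization_uminus by blast
    have "rev w0_word \<in> lists I" using w0_word(3) by auto
    then have "Tw0_inv \<in> Y" "Tw0 \<in> Y" unfolding Tw0_inv_def Tw0_def
      using T w0_word(3) Tinv Y(3) by blast+
    then have "z \<in> Y" using Y(4) by (simp add: z_def)
    have "pev k \<in> Y" if "loc_poly k" for k
      using that by (induction k) (use one \<open>z \<in> Y\<close> Y in auto)
    then show ?thesis unfolding x_def y_def using Y(4) \<open>Tw0_inv \<in> Y\<close> g(1) by blast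
  qed
  have "x \<in> range Theta"
    using Theta_closed Theta_\<iota> Theta_T Theta_add_closed Theta_mult_closed by (intro closed) blast+
  then show ?thesis using xx \<phi>x conj closed unfolding is_tilde_def by blast
qed

section \<open>Uniqueness by reduction modulo X\<close>

lemma \<phi>_Theta: "\<phi> (Theta f) = (\<Sum>w\<in>WI. Poly_Mapping.single w (f w $ 0))"
proof -
  have "\<phi> (finsum B g A) = (\<Sum>a\<in>A. \<phi> (g a))" if "finite A" "g \<in> A \<rightarrow> carrier B" for g and A :: "'a set"
    using that by (induction A rule: finite_induct) (auto simp: \<phi>_zero \<phi>_add)
  then have "\<phi> (Theta f) = (\<Sum>w\<in>WI. \<phi> (\<iota> (f w) \<otimes>\<^bsub>B\<^esub> Tw w))"
    unfolding lincomb_def using finite_WI by auto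
  also have "\<dots> = (\<Sum>w\<in>WI. Poly_Mapping.single w (f w $ 0))"
  proof (intro sum.cong HOL.refl)
    fix w assume w: "w \<in> WI"
    obtain us where us: "reduced us" "mprod W us = w" using ex_reduced w by blast
    then have "\<phi> (Tw w) = Poly_Mapping.single w 1"
      using \<phi>_mprod[of us] by (simp add: Tw_reduced reduced_lists)
    then show "\<phi> (\<iota> (f w) \<otimes>\<^bsub>B\<^esub> Tw w) = Poly_Mapping.single w (f w $ 0)"
      using w by (simp add: \<phi>_mult \<phi>_\<iota> monoid_ring_mult_single)
  qed
  finally show ?thesis .
qed

text \<open>Group elements are linearly independent in QW, so \<open>\<phi> x = 0\<close> makes
  every coefficient of \<open>x\<close> divisible by X.\<close>

lemma kernel_\<phi>:
  assumes "x \<in> range Theta" "\<phi> x = 0"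
  shows "\<exists>k\<in>range Theta. x = \<iota> fps_X \<otimes>\<^bsub>B\<^esub> k"
proof -
  obtain f where f: "x = Theta f" using assms(1) by blast
  have "f w $ 0 = 0" if "w \<in> WI" for w
  proof -
    have "Poly_Mapping.lookup (\<phi> x) w = (\<Sum>y\<in>WI. if y = w then f y $ 0 else 0)"
      unfolding f \<phi>_Theta by (auto simp: lookup_sum lookup_single when_def intro!: sum.cong)
    then show ?thesis using that finite_WI assms(2) by simp
  qed
  then have "f w = fps_X * fps_shift 1 (f w)" if "w \<in> WI" for w
    using that by (auto simp: fps_eq_iff)
  then have "x = Theta (\<lambda>w. fps_X * fps_shift 1 (f w))"
    unfolding f by (intro lincomb_cong) auto
  then show ?thesis using lincomb_scale[OF finite_WI Tw_Pi] by auto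
qed

lemma commute_Theta:
  assumes u: "u \<in> carrier B" "\<And>s. s \<in> I \<Longrightarrow> u \<otimes>\<^bsub>B\<^esub> T s = T s \<otimes>\<^bsub>B\<^esub> u" and x: "x \<in> range Theta"
  shows "u \<otimes>\<^bsub>B\<^esub> x = x \<otimes>\<^bsub>B\<^esub> u"
proof -
  obtain f where f: "x = Theta f" using x by blast
  have m: "u \<otimes>\<^bsub>B\<^esub> mprod B (map T us) = mprod B (map T us) \<otimes>\<^bsub>B\<^esub> u" if "us \<in> lists I" for us
    using that
  proof (induction us)
    case (Cons s us)
    have c: "mprod B (map T us) \<in> carrier B" by (rule mprod_T_closed[OF Cons.hyps(2)])
    have "u \<otimes>\<^bsub>B\<^esub> (T s \<otimes>\<^bsub>B\<^esub> mprod B (map T us)) = T s \<otimes>\<^bsub>B\<^esub> (u \<otimes>\<^bsub>B\<^esub> mprod B (map T us))"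
      using u c Cons.hyps by (simp flip: B.m_assoc)
    with Cons u c show ?case by (simp add: B.m_assoc)
  qed (use u in simp)
  have Tw: "u \<otimes>\<^bsub>B\<^esub> Tw w = Tw w \<otimes>\<^bsub>B\<^esub> u" if "w \<in> WI" for w
    using ex_reduced[OF that] m by (auto simp: Tw_reduced reduced_lists)
  show ?thesis
    unfolding f lincomb_mult_right[OF finite_WI Tw_Pi u(1)] lincomb_mult_left[OF finite_WI Tw_Pi u(1)]
    using Tw u by (intro lincomb_cong) auto
qed

text \<open>An element \<open>\<epsilon>\<close> of the kernel with \<open>(1 + \<epsilon>)\<^sup>2 = 1\<close> satisfies \<open>\<epsilon> = - \<epsilon>\<^sup>2 / 2\<close>, so the
  left ideal it generates in the span of the \<open>T w\<close> equals \<open>X\<close> times itself.\<close>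

lemma involution_trivial:
  assumes e: "e \<in> range Theta" "\<phi> e = 0" and sq: "e \<otimes>\<^bsub>B\<^esub> e = \<iota> (- 2) \<otimes>\<^bsub>B\<^esub> e"
  shows "e = \<zero>\<^bsub>B\<^esub>"
proof -
  obtain k where k: "k \<in> range Theta" "e = \<iota> fps_X \<otimes>\<^bsub>B\<^esub> k" using kernel_\<phi>[OF e] by blast
  have c: "e \<in> carrier B" "k \<in> carrier B" using e(1) k(1) Theta_closed by blast+
  define k' where "k' = \<iota> (fps_const (- 1 / 2)) \<otimes>\<^bsub>B\<^esub> k"
  have k': "k' \<in> range Theta" "k' \<in> carrier B" unfolding k'_def using k(1) c Theta_scale_closed by auto
  have two: "fps_const (- 1 / 2) * (- 2) = (1 :: rat fps)"
    by (rule fps_ext) (simp add: fps_numeral_nth)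
  have "\<iota> (fps_const (- 1 / 2)) \<otimes>\<^bsub>B\<^esub> (e \<otimes>\<^bsub>B\<^esub> e) = (\<iota> (fps_const (- 1 / 2)) \<otimes>\<^bsub>B\<^esub> \<iota> (- 2)) \<otimes>\<^bsub>B\<^esub> e"
    unfolding sq using c by (simp add: B.m_assoc)
  then have "e = \<iota> (fps_const (- 1 / 2)) \<otimes>\<^bsub>B\<^esub> (e \<otimes>\<^bsub>B\<^esub> e)"
    unfolding \<iota>_mult[symmetric] two using c by simp
  also have "e \<otimes>\<^bsub>B\<^esub> e = \<iota> fps_X \<otimes>\<^bsub>B\<^esub> (k \<otimes>\<^bsub>B\<^esub> e)"
    using k(2) c by (metis B.m_assoc \<iota>_closed)
  also have "\<iota> (fps_const (- 1 / 2)) \<otimes>\<^bsub>B\<^esub> (\<iota> fps_X \<otimes>\<^bsub>B\<^esub> (k \<otimes>\<^bsub>B\<^esub> e)) =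
      \<iota> fps_X \<otimes>\<^bsub>B\<^esub> (\<iota> (fps_const (- 1 / 2)) \<otimes>\<^bsub>B\<^esub> (k \<otimes>\<^bsub>B\<^esub> e))"
    using c by (intro \<iota>_left_commute) auto
  also have "\<iota> (fps_const (- 1 / 2)) \<otimes>\<^bsub>B\<^esub> (k \<otimes>\<^bsub>B\<^esub> e) = k' \<otimes>\<^bsub>B\<^esub> e"
    unfolding k'_def using c by (simp add: B.m_assoc)
  finally have e': "e = \<iota> fps_X \<otimes>\<^bsub>B\<^esub> (k' \<otimes>\<^bsub>B\<^esub> e)" .
  \<comment> \<open>Coefficients of T_w k' on the elements T_a. As e = X k' e, they write T_w e as a
    combination of the T_a e with coefficients divisible by X, which is the system of
    \<open>nakayama\<close>.\<close>
  define c where "c w = (SOME f. Tw w \<otimes>\<^bsub>B\<^esub> k' = Theta f)" for w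
  have cw: "Tw w \<otimes>\<^bsub>B\<^esub> k' = Theta (c w)" if "w \<in> WI" for w
  proof -
    have "Tw w \<in> range Theta" using Theta_delta[OF that] by (metis rangeI)
    then have "\<exists>f. Tw w \<otimes>\<^bsub>B\<^esub> k' = Theta f" using Theta_mult_closed k'(1) by blast
    then show ?thesis unfolding c_def by (rule someI_ex)
  qed
  have ec: "e \<in> carrier B" by fact
  have "\<forall>w\<in>WI. Tw w \<otimes>\<^bsub>B\<^esub> e = \<zero>\<^bsub>B\<^esub>"
  proof (rule nakayama[OF finite_WI])
    fix w assume w: "w \<in> WI"
    have "Tw w \<otimes>\<^bsub>B\<^esub> e = Tw w \<otimes>\<^bsub>B\<^esub> (\<iota> fps_X \<otimes>\<^bsub>B\<^esub> (k' \<otimes>\<^bsub>B\<^esub> e))" by (rule arg_cong[OF e'])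
    also have "\<dots> = \<iota> fps_X \<otimes>\<^bsub>B\<^esub> (Theta (c w) \<otimes>\<^bsub>B\<^esub> e)"
      unfolding cw[OF w, symmetric] using w ec k' by (simp add: \<iota>_left_commute B.m_assoc)
    also have "\<dots> = lincomb WI (\<lambda>a. Tw a \<otimes>\<^bsub>B\<^esub> e) (\<lambda>a. fps_X * c w a)"
      unfolding lincomb_mult_right[OF finite_WI Tw_Pi ec]
      using ec finite_WI by (intro lincomb_scale[symmetric]) auto
    finally show "Tw w \<otimes>\<^bsub>B\<^esub> e = lincomb WI (\<lambda>a. Tw a \<otimes>\<^bsub>B\<^esub> e) (\<lambda>a. fps_X * c w a)" .
  qed (use ec in auto)
  then have "Tw \<one> \<otimes>\<^bsub>B\<^esub> e = \<zero>\<^bsub>B\<^esub>" by (rule bspec[OF _ WI_one])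
  then show ?thesis using ec by simp
qed

lemma tilde_unique:
  assumes x: "is_tilde x" and y: "is_tilde y"
  shows "x = y"
proof -
  have c: "x \<in> carrier B" "y \<in> carrier B" using x y Theta_closed unfolding is_tilde_def by blast+
  have xx: "x \<otimes>\<^bsub>B\<^esub> x = \<one>\<^bsub>B\<^esub>" and yy: "y \<otimes>\<^bsub>B\<^esub> y = \<one>\<^bsub>B\<^esub>"
    using x y unfolding is_tilde_def by blast+
  define u where "u = y \<otimes>\<^bsub>B\<^esub> x"
  have u: "u \<in> carrier B" using c by (simp add: u_def)
  have uR: "u \<in> range Theta" using x y Theta_mult_closed unfolding u_def is_tilde_def by blast
  have "u \<otimes>\<^bsub>B\<^esub> T s = T s \<otimes>\<^bsub>B\<^esub> u" if s: "s \<in> I" for s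
  proof -
    let ?t = "w0 \<otimes> s \<otimes> w0"
    have t: "?t \<in> I" "w0 \<otimes> ?t \<otimes> w0 = s" using w0_conj(1)[OF s] s by (simp_all add: m_assoc)
    have "u \<otimes>\<^bsub>B\<^esub> T s = y \<otimes>\<^bsub>B\<^esub> (x \<otimes>\<^bsub>B\<^esub> T s)" using c s by (simp add: u_def B.m_assoc)
    also have "x \<otimes>\<^bsub>B\<^esub> T s = T ?t \<otimes>\<^bsub>B\<^esub> x" using x s unfolding is_tilde_def by blast
    also have "y \<otimes>\<^bsub>B\<^esub> (T ?t \<otimes>\<^bsub>B\<^esub> x) = (y \<otimes>\<^bsub>B\<^esub> T ?t) \<otimes>\<^bsub>B\<^esub> x" using c t by (simp add: B.m_assoc)
    also have "y \<otimes>\<^bsub>B\<^esub> T ?t = T s \<otimes>\<^bsub>B\<^esub> y" using y t unfolding is_tilde_def by metis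
    finally show ?thesis using c s by (simp add: u_def B.m_assoc)
  qed
  \<comment> \<open>Both x and y conjugate by w0, an involution, so \<open>u\<close> commutes with
    every T_s and therefore with \<open>y\<close>. Then u^2 = u y x = y u x = x^2.\<close>
  then have uy: "u \<otimes>\<^bsub>B\<^esub> y = y \<otimes>\<^bsub>B\<^esub> u"
    using commute_Theta[OF u] y unfolding is_tilde_def by blast
  have yu: "y \<otimes>\<^bsub>B\<^esub> u = x" using c yy by (simp add: u_def flip: B.m_assoc)
  have "u \<otimes>\<^bsub>B\<^esub> u = (u \<otimes>\<^bsub>B\<^esub> y) \<otimes>\<^bsub>B\<^esub> x" using c u by (simp add: u_def B.m_assoc)
  then have uu: "u \<otimes>\<^bsub>B\<^esub> u = \<one>\<^bsub>B\<^esub>" unfolding uy yu using xx by simp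
  define e where "e = u \<oplus>\<^bsub>B\<^esub> \<iota> (- 1)"
  have "\<phi> u = Poly_Mapping.single \<one> 1"
    using x y c by (simp add: u_def \<phi>_mult is_tilde_def monoid_ring_mult_single)
  then have "\<phi> e = 0" using u by (simp add: e_def \<phi>_add \<phi>_\<iota> flip: single_add)
  moreover have "e \<in> range Theta" unfolding e_def by (rule Theta_add_closed[OF uR Theta_\<iota>])
  \<comment> \<open>With e = u - 1 and u^2 = 1, e^2 = 2 - 2u = -2e.\<close>
  moreover have "e \<otimes>\<^bsub>B\<^esub> e = \<iota> (- 2) \<otimes>\<^bsub>B\<^esub> e"
  proof -
    have "e \<otimes>\<^bsub>B\<^esub> e = \<iota> 1 \<oplus>\<^bsub>B\<^esub> \<iota> (- 1) \<otimes>\<^bsub>B\<^esub> u \<oplus>\<^bsub>B\<^esub> (\<iota> (- 1) \<otimes>\<^bsub>B\<^esub> u \<oplus>\<^bsub>B\<^esub> \<iota> ((- 1) * (- 1)))"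
      unfolding e_def \<iota>_mult using u uu
      by (simp add: B.l_distr B.r_distr B.a_ac \<iota>_central[OF u])
    also have "\<dots> = \<iota> (- 1) \<otimes>\<^bsub>B\<^esub> u \<oplus>\<^bsub>B\<^esub> \<iota> (- 1) \<otimes>\<^bsub>B\<^esub> u \<oplus>\<^bsub>B\<^esub> \<iota> (1 + 1)"
      unfolding \<iota>_add[of 1 1] using u by (simp add: B.a_ac)
    also have "\<dots> = \<iota> (- 1 + - 1) \<otimes>\<^bsub>B\<^esub> u \<oplus>\<^bsub>B\<^esub> \<iota> ((- 2) * (- 1))"
      unfolding \<iota>_add[of "- 1" "- 1"] using u by (simp add: B.l_distr)
    also have "\<dots> = \<iota> (- 2) \<otimes>\<^bsub>B\<^esub> e"
      unfolding e_def \<iota>_mult using u by (simp add: B.r_distr)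
    finally show ?thesis .
  qed
  ultimately have "e = \<zero>\<^bsub>B\<^esub>" by (intro involution_trivial)
  have "u = e \<oplus>\<^bsub>B\<^esub> \<iota> 1" using u \<iota>_add[of "- 1" 1] by (simp add: e_def B.a_assoc)
  then have "u = \<one>\<^bsub>B\<^esub>" using \<open>e = \<zero>\<^bsub>B\<^esub>\<close> by simp
  then show ?thesis using yu c by simp
qed

end

section \<open>Monoid rings, quotients and presentations\<close>

lemma poly_mapping_sum_singles:
  "f = (\<Sum>x\<in>Poly_Mapping.keys f. Poly_Mapping.single x (Poly_Mapping.lookup f x))"
  for f :: "'g \<Rightarrow>\<^sub>0 'k::comm_monoid_add"
  by (rule poly_mapping_eqI) (simp add: lookup_sum lookup_single when_def in_keys_iff)

text \<open>Induction that keeps supports inside \<open>C\<close>, so that statements on the carrier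
  of a monoid ring reduce to monomials.\<close>

lemma poly_mapping_keys_induct [consumes 1, case_names zero single add]:
  fixes f :: "'g \<Rightarrow>\<^sub>0 'k::comm_monoid_add"
  assumes "Poly_Mapping.keys f \<subseteq> C"
    and zero: "P 0" and single: "\<And>x a. x \<in> C \<Longrightarrow> P (Poly_Mapping.single x a)"
    and add: "\<And>f g. Poly_Mapping.keys f \<subseteq> C \<Longrightarrow> Poly_Mapping.keys g \<subseteq> C \<Longrightarrow> P f \<Longrightarrow> P g \<Longrightarrow> P (f + g)"
  shows "P f"
proof -
  define h where "h A = (\<Sum>x\<in>A. Poly_Mapping.single x (Poly_Mapping.lookup f x))" for A
  have "Poly_Mapping.keys (h A) \<subseteq> C \<and> P (h A)" if "finite A" "A \<subseteq> C" for A
    using that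
  proof (induction A rule: finite_induct)
    case (insert x A)
    have e: "h (insert x A) = Poly_Mapping.single x (Poly_Mapping.lookup f x) + h A"
      using insert by (simp add: h_def)
    have "Poly_Mapping.keys (Poly_Mapping.single x (Poly_Mapping.lookup f x)) \<subseteq> C"
      using insert.prems by auto
    with insert show ?case
      unfolding e using Poly_Mapping.keys_add[of "Poly_Mapping.single x (Poly_Mapping.lookup f x)" "h A"]
      by (intro conjI add single) auto
  qed (simp add: h_def zero)
  then have "P (h (Poly_Mapping.keys f))" using assms(1) by simp
  then show ?thesis unfolding h_def poly_mapping_sum_singles[symmetric] .
qed

text \<open>The product in \<open>monoid_ring\<close> sums over exact supports, which change under
  addition; over fixed larger index sets its bilinearity is visible.\<close>

lemma monoid_ring_mult_superset:
  assumes "finite A" "Poly_Mapping.keys f \<subseteq> A" "finite B" "Poly_Mapping.keys g \<subseteq> B"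
  shows "f \<otimes>\<^bsub>monoid_ring G\<^esub> g = (\<Sum>x\<in>A. \<Sum>y\<in>B.
    Poly_Mapping.single (x \<otimes>\<^bsub>G\<^esub> y) (Poly_Mapping.lookup f x * Poly_Mapping.lookup g y))"
proof -
  have "f \<otimes>\<^bsub>monoid_ring G\<^esub> g = (\<Sum>x\<in>Poly_Mapping.keys f. \<Sum>y\<in>B.
      Poly_Mapping.single (x \<otimes>\<^bsub>G\<^esub> y) (Poly_Mapping.lookup f x * Poly_Mapping.lookup g y))"
    unfolding monoid_ring_def monoid.simps using assms
    by (intro sum.cong HOL.refl sum.mono_neutral_left) (auto simp: in_keys_iff)
  also have "\<dots> = (\<Sum>x\<in>A. \<Sum>y\<in>B.
      Poly_Mapping.single (x \<otimes>\<^bsub>G\<^esub> y) (Poly_Mapping.lookup f x * Poly_Mapping.lookup g y))"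
    using assms by (intro sum.mono_neutral_left) (auto simp: in_keys_iff)
  finally show ?thesis .
qed

lemma monoid_ring_distrib_right:
  "(f + g) \<otimes>\<^bsub>monoid_ring G\<^esub> h = f \<otimes>\<^bsub>monoid_ring G\<^esub> h + g \<otimes>\<^bsub>monoid_ring G\<^esub> h"
proof -
  let ?A = "Poly_Mapping.keys f \<union> Poly_Mapping.keys g" and ?B = "Poly_Mapping.keys h"
  have "Poly_Mapping.keys (f + g) \<subseteq> ?A" by (rule Poly_Mapping.keys_add)
  then show ?thesis
    using monoid_ring_mult_superset[of ?A "f + g" ?B h G] monoid_ring_mult_superset[of ?A f ?B h G]
      monoid_ring_mult_superset[of ?A g ?B h G]
    by (simp add: lookup_add distrib_right single_add sum.distrib)
qed

lemma monoid_ring_distrib_left: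
  "h \<otimes>\<^bsub>monoid_ring G\<^esub> (f + g) = h \<otimes>\<^bsub>monoid_ring G\<^esub> f + h \<otimes>\<^bsub>monoid_ring G\<^esub> g"
proof -
  let ?A = "Poly_Mapping.keys f \<union> Poly_Mapping.keys g" and ?B = "Poly_Mapping.keys h"
  have "Poly_Mapping.keys (f + g) \<subseteq> ?A" by (rule Poly_Mapping.keys_add)
  then show ?thesis
    using monoid_ring_mult_superset[of ?B h ?A "f + g" G] monoid_ring_mult_superset[of ?B h ?A f G]
      monoid_ring_mult_superset[of ?B h ?A g G]
    by (simp add: lookup_add distrib_left single_add sum.distrib)
qed

lemma monoid_ring_zero [simp]:
  "0 \<otimes>\<^bsub>monoid_ring G\<^esub> f = 0" "f \<otimes>\<^bsub>monoid_ring G\<^esub> 0 = 0"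
  by (simp_all add: monoid_ring_def)

context monoid
begin

lemma monoid_ring_closed:
  assumes "Poly_Mapping.keys f \<subseteq> carrier G" "Poly_Mapping.keys g \<subseteq> carrier G"
  shows "Poly_Mapping.keys (f \<otimes>\<^bsub>monoid_ring G\<^esub> g) \<subseteq> carrier G"
  using assms(1)
proof (induction rule: poly_mapping_keys_induct)
  case (single x a)
  show ?case using assms(2)
  proof (induction rule: poly_mapping_keys_induct)
    case (single y b)
    then show ?case using \<open>x \<in> carrier G\<close> by (auto simp: monoid_ring_mult_single)
  next
    case (add f g)
    then show ?case unfolding monoid_ring_distrib_left
      by (intro order_trans[OF Poly_Mapping.keys_add] Un_least)
  qed simp
next
  case (add f g)
  then show ?case unfolding monoid_ring_distrib_right
    by (intro order_trans[OF Poly_Mapping.keys_add] Un_least)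
qed simp

lemma monoid_ring_assoc:
  assumes "Poly_Mapping.keys f \<subseteq> carrier G" "Poly_Mapping.keys g \<subseteq> carrier G" "Poly_Mapping.keys h \<subseteq> carrier G"
  shows "f \<otimes>\<^bsub>monoid_ring G\<^esub> g \<otimes>\<^bsub>monoid_ring G\<^esub> h = f \<otimes>\<^bsub>monoid_ring G\<^esub> (g \<otimes>\<^bsub>monoid_ring G\<^esub> h)"
  using assms(1)
proof (induction rule: poly_mapping_keys_induct)
  case (single x a)
  show ?case using assms(2)
  proof (induction rule: poly_mapping_keys_induct)
    case (single y b)
    show ?case using assms(3)
    proof (induction rule: poly_mapping_keys_induct)
      case (single z c)
      then show ?case using \<open>x \<in> carrier G\<close> \<open>y \<in> carrier G\<close>
        by (simp add: monoid_ring_mult_single m_assoc mult.assoc)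
    qed (simp_all add: monoid_ring_distrib_left)
  qed (simp_all add: monoid_ring_distrib_left monoid_ring_distrib_right)
qed (simp_all add: monoid_ring_distrib_right)

lemma monoid_ring_unit:
  assumes "Poly_Mapping.keys f \<subseteq> carrier G"
  shows "Poly_Mapping.single \<one> 1 \<otimes>\<^bsub>monoid_ring G\<^esub> f = f" "f \<otimes>\<^bsub>monoid_ring G\<^esub> Poly_Mapping.single \<one> 1 = f"
  using assms
  by (induction rule: poly_mapping_keys_induct)
    (simp_all add: monoid_ring_mult_single monoid_ring_distrib_left monoid_ring_distrib_right)

lemma ring_monoid_ring: "ring (monoid_ring G :: ('a \<Rightarrow>\<^sub>0 'k::comm_ring_1) ring)"
proof (rule ringI)
  show "abelian_group (monoid_ring G :: ('a \<Rightarrow>\<^sub>0 'k) ring)"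
  proof (rule abelian_groupI)
    fix f :: "'a \<Rightarrow>\<^sub>0 'k" assume "f \<in> carrier (monoid_ring G)"
    then show "\<exists>g\<in>carrier (monoid_ring G). g \<oplus>\<^bsub>monoid_ring G\<^esub> f = \<zero>\<^bsub>monoid_ring G\<^esub>"
      by (intro bexI[of _ "- f"]) auto
  next
    fix f g :: "'a \<Rightarrow>\<^sub>0 'k"
    assume "f \<in> carrier (monoid_ring G)" "g \<in> carrier (monoid_ring G)"
    then show "f \<oplus>\<^bsub>monoid_ring G\<^esub> g \<in> carrier (monoid_ring G)"
      using Poly_Mapping.keys_add[of f g] by auto
  qed (simp_all add: ac_simps)
  show "Group.monoid (monoid_ring G :: ('a \<Rightarrow>\<^sub>0 'k) ring)"
    by (rule monoidI) (simp_all add: monoid_ring_closed monoid_ring_assoc monoid_ring_unit)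
qed (simp_all add: monoid_ring_distrib_left monoid_ring_distrib_right)

lemma monoid_ring_scalar_central:
  assumes "Poly_Mapping.keys f \<subseteq> carrier G"
  shows "Poly_Mapping.single \<one> c \<otimes>\<^bsub>monoid_ring G\<^esub> f = f \<otimes>\<^bsub>monoid_ring G\<^esub> Poly_Mapping.single \<one> c"
  using assms
  by (induction rule: poly_mapping_keys_induct)
    (simp_all add: monoid_ring_mult_single monoid_ring_distrib_left monoid_ring_distrib_right mult.commute)

end

text \<open>Additive extension from monomials. The coefficient is passed to \<theta> as well, so
  that scalars can be specialized together with monoid elements.\<close>

definition monoid_ring_lift :: "('g \<Rightarrow> 'k::comm_ring_1 \<Rightarrow> 'c::comm_monoid_add) \<Rightarrow> ('g \<Rightarrow>\<^sub>0 'k) \<Rightarrow> 'c" where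
  "monoid_ring_lift \<theta> f = (\<Sum>x\<in>Poly_Mapping.keys f. \<theta> x (Poly_Mapping.lookup f x))"

lemma monoid_ring_lift_single:
  "\<theta> x 0 = 0 \<Longrightarrow> monoid_ring_lift \<theta> (Poly_Mapping.single x a) = \<theta> x a"
  by (simp add: monoid_ring_lift_def)

lemma monoid_ring_lift_add:
  assumes "\<And>x. \<theta> x 0 = 0" "\<And>x a b. \<theta> x (a + b) = \<theta> x a + \<theta> x b"
  shows "monoid_ring_lift \<theta> (f + g) = monoid_ring_lift \<theta> f + monoid_ring_lift \<theta> g"
proof -
  let ?A = "Poly_Mapping.keys f \<union> Poly_Mapping.keys g"
  have ext: "monoid_ring_lift \<theta> h = (\<Sum>x\<in>?A. \<theta> x (Poly_Mapping.lookup h x))" if "Poly_Mapping.keys h \<subseteq> ?A" for h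
    unfolding monoid_ring_lift_def using that assms(1)
    by (intro sum.mono_neutral_left) (auto simp: in_keys_iff)
  show ?thesis
    using ext[of f] ext[of g] ext[OF Poly_Mapping.keys_add] assms(2)
    by (simp add: lookup_add sum.distrib)
qed

lemma monoid_ring_lift_hom:
  fixes \<theta> :: "'g \<Rightarrow> 'k::comm_ring_1 \<Rightarrow> ('h \<Rightarrow>\<^sub>0 'l::comm_ring_1)"
  assumes "Group.monoid G" "Group.monoid H"
    and zero: "\<And>x. \<theta> x 0 = 0" and add: "\<And>x a b. \<theta> x (a + b) = \<theta> x a + \<theta> x b"
    and closed: "\<And>x a. x \<in> carrier G \<Longrightarrow> \<theta> x a \<in> carrier (monoid_ring H)"
    and mult: "\<And>x y a b. x \<in> carrier G \<Longrightarrow> y \<in> carrier G \<Longrightarrow>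
      \<theta> (x \<otimes>\<^bsub>G\<^esub> y) (a * b) = \<theta> x a \<otimes>\<^bsub>monoid_ring H\<^esub> \<theta> y b"
    and one: "\<theta> \<one>\<^bsub>G\<^esub> 1 = \<one>\<^bsub>monoid_ring H\<^esub>"
  shows "monoid_ring_lift \<theta> \<in> Ring.ring_hom (monoid_ring G) (monoid_ring H)"
proof (rule Ring.ring_hom_memI)
  note s = monoid_ring_lift_single[of \<theta>, OF zero] and a = monoid_ring_lift_add[of \<theta>, OF zero add]
  have z: "monoid_ring_lift \<theta> 0 = 0" by (simp add: monoid_ring_lift_def)
  fix f g :: "'g \<Rightarrow>\<^sub>0 'k"
  assume f: "f \<in> carrier (monoid_ring G)"
  then have f': "Poly_Mapping.keys f \<subseteq> carrier G" by simp
  then show "monoid_ring_lift \<theta> f \<in> carrier (monoid_ring H)"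
  proof (induction rule: poly_mapping_keys_induct)
    case (add f g)
    then show ?case
      using Poly_Mapping.keys_add[of "monoid_ring_lift \<theta> f" "monoid_ring_lift \<theta> g"] by (auto simp: a)
  qed (use closed in \<open>simp_all add: s z\<close>)
  assume "g \<in> carrier (monoid_ring G)"
  then have g: "Poly_Mapping.keys g \<subseteq> carrier G" by simp
  show "monoid_ring_lift \<theta> (f \<oplus>\<^bsub>monoid_ring G\<^esub> g) = monoid_ring_lift \<theta> f \<oplus>\<^bsub>monoid_ring H\<^esub> monoid_ring_lift \<theta> g"
    by (simp add: a)
  show "monoid_ring_lift \<theta> (f \<otimes>\<^bsub>monoid_ring G\<^esub> g) = monoid_ring_lift \<theta> f \<otimes>\<^bsub>monoid_ring H\<^esub> monoid_ring_lift \<theta> g"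
    using f'
  proof (induction rule: poly_mapping_keys_induct)
    case (single x c)
    show ?case using g
    proof (induction rule: poly_mapping_keys_induct)
      case (single y d)
      then show ?case using \<open>x \<in> carrier G\<close> by (simp add: s monoid_ring_mult_single mult)
    qed (simp_all add: z a monoid_ring_distrib_left)
  qed (simp_all add: z a monoid_ring_distrib_right)
qed (use one in \<open>simp add: monoid_ring_lift_single zero\<close>)

text \<open>The value on a coset is taken at a chosen representative; \<open>wd\<close> makes it
  independent of the choice.\<close>

lemma quotient_lift:
  assumes A: "ring A" and J: "ideal J A" and C: "ring C" and h: "h \<in> Ring.ring_hom A C"
    and zero: "\<And>x. x \<in> J \<Longrightarrow> h x = \<zero>\<^bsub>C\<^esub>"
  shows "\<exists>\<psi>\<in>Ring.ring_hom (A Quot J) C. \<forall>x\<in>carrier A. \<psi> (J +>\<^bsub>A\<^esub> x) = h x"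
proof -
  interpret A: ring A by fact
  interpret C: ring C by fact
  interpret J: ideal J A by fact
  interpret h: ring_hom_ring A C h by (rule ring_hom_ringI2[OF A C h])
  let ?\<pi> = "\<lambda>x. J +>\<^bsub>A\<^esub> x"
  have \<pi>: "?\<pi> \<in> Ring.ring_hom A (A Quot J)" by (rule J.rcos_ring_hom)
  have wd: "h x = h y" if "x \<in> carrier A" "y \<in> carrier A" "?\<pi> x = ?\<pi> y" for x y
  proof -
    have "h (x \<ominus>\<^bsub>A\<^esub> y) = \<zero>\<^bsub>C\<^esub>"
      using A.quotient_eq_iff_same_a_r_cos[OF J that(1,2)] that(3) zero by simp
    moreover have "h (x \<ominus>\<^bsub>A\<^esub> y) = h x \<ominus>\<^bsub>C\<^esub> h y"
      unfolding a_minus_def using that by simp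
    moreover have "h x \<in> carrier C" "h y \<in> carrier C" using that by simp_all
    ultimately show ?thesis using C.r_right_minus_eq[of "h x" "h y"] by simp
  qed
  define \<psi> where "\<psi> D = h (SOME x. x \<in> carrier A \<and> ?\<pi> x = D)" for D
  have \<psi>: "\<psi> (?\<pi> x) = h x" if "x \<in> carrier A" for x
  proof -
    have "(SOME y. y \<in> carrier A \<and> ?\<pi> y = ?\<pi> x) \<in> carrier A \<and> ?\<pi> (SOME y. y \<in> carrier A \<and> ?\<pi> y = ?\<pi> x) = ?\<pi> x"
      by (rule someI[of _ x]) (use that in simp)
    then show ?thesis unfolding \<psi>_def using that by (intro wd) auto
  qed
  have sur: "\<exists>x\<in>carrier A. D = ?\<pi> x" if "D \<in> carrier (A Quot J)" for D
    using that by (auto simp: FactRing_def A_RCOSETS_def')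
  have "\<psi> \<in> Ring.ring_hom (A Quot J) C"
  proof (rule Ring.ring_hom_memI)
    fix D E assume D: "D \<in> carrier (A Quot J)"
    obtain x where x: "x \<in> carrier A" "D = ?\<pi> x" using sur[OF D] by blast
    show "\<psi> D \<in> carrier C" using x \<psi> by simp
    assume E: "E \<in> carrier (A Quot J)"
    obtain y where y: "y \<in> carrier A" "E = ?\<pi> y" using sur[OF E] by blast
    show "\<psi> (D \<otimes>\<^bsub>A Quot J\<^esub> E) = \<psi> D \<otimes>\<^bsub>C\<^esub> \<psi> E"
      using x y \<psi> Ring.ring_hom_mult[OF \<pi> x(1) y(1), symmetric] by simp
    show "\<psi> (D \<oplus>\<^bsub>A Quot J\<^esub> E) = \<psi> D \<oplus>\<^bsub>C\<^esub> \<psi> E"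
      using x y \<psi> Ring.ring_hom_add[OF \<pi> x(1) y(1), symmetric] by simp
  next
    show "\<psi> \<one>\<^bsub>A Quot J\<^esub> = \<one>\<^bsub>C\<^esub>"
      using \<psi>[OF A.one_closed] Ring.ring_hom_one[OF \<pi>] by simp
  qed
  then show ?thesis using \<psi> by blast
qed

lemma ring_hom_vanishes_on_genideal:
  assumes A: "ring A" and C: "ring C" and h: "h \<in> Ring.ring_hom A C" and Y: "Y \<subseteq> carrier A"
    and zero: "\<And>x. x \<in> Y \<Longrightarrow> h x = \<zero>\<^bsub>C\<^esub>" and x: "x \<in> Idl\<^bsub>A\<^esub> Y"
  shows "h x = \<zero>\<^bsub>C\<^esub>"
proof -
  interpret A: ring A by fact
  interpret h: ring_hom_ring A C h by (rule ring_hom_ringI2[OF A C h])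
  have "Y \<subseteq> a_kernel A C h" unfolding a_kernel_def' using Y zero by blast
  then have "Idl\<^bsub>A\<^esub> Y \<subseteq> a_kernel A C h" by (rule A.genideal_minimal[OF h.kernel_is_ideal])
  then show ?thesis using x unfolding a_kernel_def' by blast
qed

section \<open>Groups given by presentations\<close>

lemma pres_class_eq_iff:
  assumes "u \<in> words Y" "w \<in> words Y"
  shows "pres_class Y R u = pres_class Y R w \<longleftrightarrow> pres_eq Y R u w"
  using assms pres_eq.refl pres_eq.sym pres_eq.trans unfolding pres_class_def by blast

text \<open>By \<open>pres_eq.append\<close> the union that defines the product runs over copies of
  a single class.\<close>

lemma presented_group_mult:
  assumes "u \<in> words Y" "w \<in> words Y"
  shows "pres_class Y R u \<otimes>\<^bsub>presented_group Y R\<^esub> pres_class Y R w = pres_class Y R (u @ w)"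
proof -
  have "pres_class Y R (u' @ w') = pres_class Y R (u @ w)" if "pres_eq Y R u u'" "pres_eq Y R w w'" for u' w'
  proof -
    have e: "pres_eq Y R (u' @ w') (u @ w)" using that by (blast intro: pres_eq.append pres_eq.sym)
    show ?thesis using e pres_eq_words[OF e] pres_class_eq_iff[of "u' @ w'" Y "u @ w" R] by simp
  qed
  note * = this
  have mem: "u \<in> pres_class Y R u" "w \<in> pres_class Y R w"
    using assms by (auto simp: pres_class_def intro: pres_eq.refl)
  have "(\<Union>u'\<in>pres_class Y R u. \<Union>w'\<in>pres_class Y R w. pres_class Y R (u' @ w')) =
      (\<Union>u'\<in>pres_class Y R u. \<Union>w'\<in>pres_class Y R w. pres_class Y R (u @ w))"
    by (intro SUP_cong HOL.refl *) (simp_all only: pres_class_def mem_Collect_eq)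
  also have "\<dots> = pres_class Y R (u @ w)" using mem by auto
  finally show ?thesis by (simp add: presented_group_def)
qed

lemma presented_group_simps:
  "carrier (presented_group Y R) = pres_class Y R ` words Y"
  "\<one>\<^bsub>presented_group Y R\<^esub> = pres_class Y R []"
  by (simp_all add: presented_group_def)

lemma monoid_presented_group: "Group.monoid (presented_group Y R)"
proof (rule monoidI)
  fix C D E
  assume "C \<in> carrier (presented_group Y R)" "D \<in> carrier (presented_group Y R)"
  then obtain u w where u: "u \<in> words Y" "C = pres_class Y R u" "w \<in> words Y" "D = pres_class Y R w"
    by (auto simp: presented_group_simps)
  then show "C \<otimes>\<^bsub>presented_group Y R\<^esub> D \<in> carrier (presented_group Y R)"
    by (simp add: presented_group_mult presented_group_simps)
  assume "E \<in> carrier (presented_group Y R)"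
  then obtain t where "t \<in> words Y" "E = pres_class Y R t" by (auto simp: presented_group_simps)
  with u show "C \<otimes>\<^bsub>presented_group Y R\<^esub> D \<otimes>\<^bsub>presented_group Y R\<^esub> E =
      C \<otimes>\<^bsub>presented_group Y R\<^esub> (D \<otimes>\<^bsub>presented_group Y R\<^esub> E)"
    by (simp add: presented_group_mult)
next
  fix C assume "C \<in> carrier (presented_group Y R)"
  then obtain u where u: "u \<in> words Y" "C = pres_class Y R u" by (auto simp: presented_group_simps)
  then show "\<one>\<^bsub>presented_group Y R\<^esub> \<otimes>\<^bsub>presented_group Y R\<^esub> C = C"
    "C \<otimes>\<^bsub>presented_group Y R\<^esub> \<one>\<^bsub>presented_group Y R\<^esub> = C"
    using presented_group_mult[of "[]" Y u R] presented_group_mult[of u Y "[]" R]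
    by (simp_all add: presented_group_simps)
qed (simp add: presented_group_simps)

section \<open>The Hecke algebra and its scalar extension\<close>

text \<open>The constant term in X = v - 1 is the value at v = 1.\<close>

lemma laurent_to_R_nth_0: "laurent_to_R p $ 0 = (\<Sum>n\<in>Poly_Mapping.keys p. Poly_Mapping.lookup p n)"
proof -
  have "((1 + fps_X :: rat fps) powi n) $ 0 = 1" for n
    by (cases "n \<ge> 0") (simp_all add: power_int_def fps_nth_power_0)
  then show ?thesis unfolding laurent_to_R_def by (simp add: fps_sum_nth)
qed

lemma lookup_map_of_int:
  "Poly_Mapping.lookup (Poly_Mapping.map of_int p) n = (of_int (Poly_Mapping.lookup p n) :: 'k::ring_1)"
  by (simp add: Poly_Mapping.map.rep_eq when_def)

lemma int_laurent_to_R_nth_0: "int_laurent_to_R p $ 0 = monoid_ring_lift (\<lambda>n. of_int) p"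
proof -
  have "Poly_Mapping.keys (Poly_Mapping.map of_int p :: rat laurent) = Poly_Mapping.keys p"
    by (auto simp: in_keys_iff lookup_map_of_int)
  then show ?thesis
    by (simp add: int_laurent_to_R_def laurent_to_R_nth_0 monoid_ring_lift_def lookup_map_of_int)
qed

lemma int_laurent_to_R_nth_0_add:
  "int_laurent_to_R (p + q) $ 0 = int_laurent_to_R p $ 0 + int_laurent_to_R q $ 0"
  unfolding int_laurent_to_R_nth_0 by (rule monoid_ring_lift_add) simp_all

lemma int_laurent_to_R_nth_0_single: "int_laurent_to_R (Poly_Mapping.single n c) $ 0 = of_int c"
  unfolding int_laurent_to_R_nth_0 by (simp add: monoid_ring_lift_single)

lemma int_laurent_to_R_nth_0_mult:
  "int_laurent_to_R (p * q) $ 0 = int_laurent_to_R p $ 0 * int_laurent_to_R q $ 0"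
proof -
  have z: "int_laurent_to_R 0 $ 0 = 0" using int_laurent_to_R_nth_0_single[of 0 0] by simp
  show ?thesis
    using subset_UNIV[of "Poly_Mapping.keys p"]
  proof (induction rule: poly_mapping_keys_induct)
    case (single m c)
    show ?case using subset_UNIV[of "Poly_Mapping.keys q"]
    proof (induction rule: poly_mapping_keys_induct)
      case (single n d)
      show ?case by (simp add: mult_single int_laurent_to_R_nth_0_single)
    qed (simp_all add: z distrib_left int_laurent_to_R_nth_0_add)
  qed (simp_all add: z distrib_right int_laurent_to_R_nth_0_add)
qed

lemma int_laurent_to_R_q: "int_laurent_to_R (v - vpow (- 1)) = (1 + fps_X) - inverse (1 + fps_X)"
proof -
  have m: "Poly_Mapping.map of_int (v - vpow (- 1)) = (v - vpow (- 1) :: rat laurent)"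
    by (rule poly_mapping_eqI) (simp add: lookup_map_of_int lookup_minus vpow_def lookup_single when_def)
  have h: "laurent_to_R (vpow 1 - vpow (- 1)) + laurent_to_R (vpow (- 1)) = laurent_to_R v"
    by (simp flip: completion_hom_add)
  have "laurent_to_R v = 1 + fps_X" "laurent_to_R (vpow (- 1)) = inverse (1 + fps_X)"
    by (simp_all add: vpow_def completion_single)
  with h show ?thesis unfolding int_laurent_to_R_def m by (simp only: eq_diff_eq)
qed

lemma monoid_ring_a_minus:
  fixes f g :: "'g \<Rightarrow>\<^sub>0 'k::comm_ring_1"
  assumes "Group.monoid G" "Poly_Mapping.keys f \<subseteq> carrier G" "Poly_Mapping.keys g \<subseteq> carrier G"
  shows "f \<ominus>\<^bsub>monoid_ring G\<^esub> g = f - g"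
proof -
  interpret ring "monoid_ring G :: ('g \<Rightarrow>\<^sub>0 'k) ring" by (rule monoid.ring_monoid_ring[OF assms(1)])
  have "\<ominus>\<^bsub>monoid_ring G\<^esub> g = - g"
    using assms by (intro minus_equality) auto
  then show ?thesis by (simp add: a_minus_def)
qed

lemma monoid_ring_quotient_eqI:
  fixes f g :: "'g \<Rightarrow>\<^sub>0 'k::comm_ring_1"
  assumes G: "Group.monoid G" and J: "ideal J (monoid_ring G)"
    and f: "Poly_Mapping.keys f \<subseteq> carrier G" "Poly_Mapping.keys g \<subseteq> carrier G" and "f - g \<in> J"
  shows "J +>\<^bsub>monoid_ring G\<^esub> f = J +>\<^bsub>monoid_ring G\<^esub> g"
proof -
  interpret ring "monoid_ring G :: ('g \<Rightarrow>\<^sub>0 'k) ring" by (rule monoid.ring_monoid_ring[OF G])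
  show ?thesis
    using quotient_eq_iff_same_a_r_cos[OF J, of f g] monoid_ring_a_minus[OF G f] assms by simp
qed

context coxeter_system
begin

abbreviation "BG \<equiv> braid_group W S"
abbreviation "BR \<equiv> braid_group_ring W S"
abbreviation "cls \<equiv> pres_class S (braid_relations W S)"
abbreviation "HI \<equiv> hecke_ideal W S"
abbreviation "HW \<equiv> hecke W S"
abbreviation "hs \<equiv> hecke_scalar W S"
abbreviation "hT \<equiv> hecke_T W S"
abbreviation "QW \<equiv> monoid_ring W :: ('a \<Rightarrow>\<^sub>0 rat) ring"

lemma monoid_BG: "Group.monoid BG"
  unfolding braid_group_def by (rule monoid_presented_group)

lemma ring_BR: "ring BR"
  unfolding braid_group_ring_def by (rule monoid.ring_monoid_ring[OF monoid_BG])

lemma ring_QW: "ring QW"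
  by (rule ring_monoid_ring)

lemma BG_one: "\<one>\<^bsub>BG\<^esub> = cls []" and cls_carrier: "u \<in> words S \<Longrightarrow> cls u \<in> carrier BG"
  and cls_mult: "u \<in> words S \<Longrightarrow> w \<in> words S \<Longrightarrow> cls u \<otimes>\<^bsub>BG\<^esub> cls w = cls (u @ w)"
  by (simp_all add: braid_group_def presented_group_simps presented_group_mult)

lemma BG_cases: "D \<in> carrier BG \<Longrightarrow> \<exists>u\<in>words S. D = cls u"
  by (auto simp: braid_group_def presented_group_simps)

lemma gen_word [simp]: "s \<in> S \<Longrightarrow> [(s, b)] \<in> words S"
  by simp

text \<open>The generators of \<open>hecke_ideal\<close> with differences written as sums, so that
  \<open>hpi_add\<close> applies directly.\<close>

definition quad_gens :: "('a word set \<Rightarrow>\<^sub>0 int laurent) set" where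
  "quad_gens = {(Poly_Mapping.single (cls [(s, True)]) 1 + Poly_Mapping.single (cls []) (- v)) \<otimes>\<^bsub>BR\<^esub>
     (Poly_Mapping.single (cls [(s, True)]) 1 + Poly_Mapping.single (cls []) (vpow (- 1))) | s. s \<in> S}"

lemma hecke_ideal_eq: "HI = Idl\<^bsub>BR\<^esub> quad_gens"
  by (simp add: hecke_ideal_def Let_def quad_gens_def braid_gen_def BG_one single_uminus)

lemma keys_single_cls: "u \<in> words S \<Longrightarrow> Poly_Mapping.keys (Poly_Mapping.single (cls u) c) \<subseteq> carrier BG"
  using cls_carrier by auto

lemma quad_gens_carrier: "quad_gens \<subseteq> carrier BR"
proof -
  interpret BR: ring BR by (rule ring_BR)
  have c: "Poly_Mapping.single (cls u) c \<in> carrier BR" if "u \<in> words S" for u c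
    using cls_carrier[OF that] by (simp add: braid_group_ring_def)
  have "x + y \<in> carrier BR" if "x \<in> carrier BR" "y \<in> carrier BR" for x y
    using BR.a_closed[OF that] by (simp add: braid_group_ring_def)
  then show ?thesis unfolding quad_gens_def using c by (auto intro!: BR.m_closed)
qed

lemma ideal_HI: "ideal HI BR"
  unfolding hecke_ideal_eq by (rule ring.genideal_ideal[OF ring_BR quad_gens_carrier])

lemma ring_HW: "ring HW"
  unfolding hecke_def by (rule ideal.quotient_is_ring[OF ideal_HI])

definition hpi :: "('a word set \<Rightarrow>\<^sub>0 int laurent) \<Rightarrow> ('a word set \<Rightarrow>\<^sub>0 int laurent) set" where
  "hpi f = HI +>\<^bsub>BR\<^esub> f"

lemma hpi_hom: "hpi \<in> Ring.ring_hom BR HW"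
  unfolding hecke_def hpi_def[abs_def] by (rule ideal.rcos_ring_hom[OF ideal_HI])

lemma hpi_closed: "Poly_Mapping.keys f \<subseteq> carrier BG \<Longrightarrow> hpi f \<in> carrier HW"
  using Ring.ring_hom_closed[OF hpi_hom] by (simp add: braid_group_ring_def)

lemma hpi_mult: "Poly_Mapping.keys f \<subseteq> carrier BG \<Longrightarrow> Poly_Mapping.keys g \<subseteq> carrier BG \<Longrightarrow>
    hpi (f \<otimes>\<^bsub>monoid_ring BG\<^esub> g) = hpi f \<otimes>\<^bsub>HW\<^esub> hpi g"
  using Ring.ring_hom_mult[OF hpi_hom] by (simp add: braid_group_ring_def)

lemma hpi_add: "Poly_Mapping.keys f \<subseteq> carrier BG \<Longrightarrow> Poly_Mapping.keys g \<subseteq> carrier BG \<Longrightarrow>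
    hpi (f + g) = hpi f \<oplus>\<^bsub>HW\<^esub> hpi g"
  using Ring.ring_hom_add[OF hpi_hom] by (simp add: braid_group_ring_def)

lemma hpi_one: "hpi (Poly_Mapping.single (cls []) 1) = \<one>\<^bsub>HW\<^esub>"
  using Ring.ring_hom_one[OF hpi_hom] by (simp add: braid_group_ring_def BG_one)

lemma HW_cases: "x \<in> carrier HW \<Longrightarrow> \<exists>f. Poly_Mapping.keys f \<subseteq> carrier BG \<and> x = hpi f"
  by (auto simp: hecke_def FactRing_def A_RCOSETS_def' hpi_def braid_group_ring_def)

lemma hs_eq: "hs c = hpi (Poly_Mapping.single (cls []) c)"
  by (simp add: hecke_scalar_def hpi_def BG_one)

lemma hT_eq: "hT s = hpi (Poly_Mapping.single (cls [(s, True)]) 1)"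
  by (simp add: hecke_T_def hpi_def braid_gen_def)

lemma hs_closed [simp]: "hs c \<in> carrier HW"
  unfolding hs_eq by (rule hpi_closed[OF keys_single_cls]) simp

lemma hT_closed [simp]: "s \<in> S \<Longrightarrow> hT s \<in> carrier HW"
  unfolding hT_eq by (rule hpi_closed[OF keys_single_cls]) simp

lemma hs_add: "hs (c + d) = hs c \<oplus>\<^bsub>HW\<^esub> hs d"
  unfolding hs_eq single_add by (rule hpi_add[OF keys_single_cls keys_single_cls]) simp_all

lemma hs_mult: "hs (c * d) = hs c \<otimes>\<^bsub>HW\<^esub> hs d"
  unfolding hs_eq hpi_mult[OF keys_single_cls keys_single_cls, symmetric, OF lists.Nil lists.Nil]
  by (simp add: monoid_ring_mult_single cls_mult)

lemma hs_one: "hs 1 = \<one>\<^bsub>HW\<^esub>"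
  by (simp add: hs_eq hpi_one)

lemma hs_central: "x \<in> carrier HW \<Longrightarrow> x \<otimes>\<^bsub>HW\<^esub> hs c = hs c \<otimes>\<^bsub>HW\<^esub> x"
proof -
  assume "x \<in> carrier HW"
  then obtain f where f: "Poly_Mapping.keys f \<subseteq> carrier BG" "x = hpi f" using HW_cases by blast
  note k = keys_single_cls[OF lists.Nil, of c]
  show ?thesis
    unfolding f(2) hs_eq hpi_mult[OF f(1) k, symmetric] hpi_mult[OF k f(1), symmetric]
    using monoid.monoid_ring_scalar_central[OF monoid_BG f(1), of c] by (simp add: BG_one)
qed

text \<open>Expanding (T_s - v)(T_s + v^-1) = 0 gives the form of the quadratic relation on which
  \<open>lmul\<close> is modelled.\<close>

lemma hT_square:
  assumes "s \<in> S"
  shows "hT s \<otimes>\<^bsub>HW\<^esub> hT s = \<one>\<^bsub>HW\<^esub> \<oplus>\<^bsub>HW\<^esub> hs (v - vpow (- 1)) \<otimes>\<^bsub>HW\<^esub> hT s"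
proof -
  interpret BR: ring BR by (rule ring_BR)
  interpret HW: ring HW by (rule ring_HW)
  define b where "b = Poly_Mapping.single (cls [(s, True)]) (1 :: int laurent)"
  define c :: "int laurent \<Rightarrow> _" where "c = Poly_Mapping.single (cls [])"
  have b: "Poly_Mapping.keys b \<subseteq> carrier BG" unfolding b_def using assms by (intro keys_single_cls) simp
  have c: "Poly_Mapping.keys (c x) \<subseteq> carrier BG" for x unfolding c_def by (intro keys_single_cls) simp
  have bc: "Poly_Mapping.keys (b + c x) \<subseteq> carrier BG" for x
    using Poly_Mapping.keys_add[of b "c x"] b c[of x] by blast
  let ?E = "(b + c (- v)) \<otimes>\<^bsub>BR\<^esub> (b + c (vpow (- 1)))"
  have "?E \<in> HI"
    unfolding hecke_ideal_eq using BR.genideal_self[OF quad_gens_carrier] assms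
    by (auto simp: quad_gens_def b_def c_def)
  then have "hpi ?E = hpi \<zero>\<^bsub>BR\<^esub>"
    unfolding hpi_def using BR.quotient_eq_iff_same_a_r_cos[OF ideal_HI, of ?E "\<zero>\<^bsub>BR\<^esub>"]
      ideal.Icarr[OF ideal_HI, of ?E] by (simp add: a_minus_def)
  then have "hpi ?E = \<zero>\<^bsub>HW\<^esub>" using Ring.ring_hom_zero[OF hpi_hom ring_BR ring_HW] by simp
  moreover have "hpi ?E = (hT s \<oplus>\<^bsub>HW\<^esub> hs (- v)) \<otimes>\<^bsub>HW\<^esub> (hT s \<oplus>\<^bsub>HW\<^esub> hs (vpow (- 1)))"
    unfolding braid_group_ring_def hpi_mult[OF bc bc] hpi_add[OF b c]
    by (simp add: hT_eq hs_eq b_def c_def)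
  ultimately have e: "(hT s \<oplus>\<^bsub>HW\<^esub> hs (- v)) \<otimes>\<^bsub>HW\<^esub> (hT s \<oplus>\<^bsub>HW\<^esub> hs (vpow (- 1))) = \<zero>\<^bsub>HW\<^esub>" by simp
  let ?T = "hT s"
  have T: "?T \<in> carrier HW" using assms by simp
  have vv: "- v * vpow (- 1) = (- 1 :: int laurent)" by (simp add: vpow_def mult_single single_one)
  have "(?T \<oplus>\<^bsub>HW\<^esub> hs (- v)) \<otimes>\<^bsub>HW\<^esub> (?T \<oplus>\<^bsub>HW\<^esub> hs (vpow (- 1))) =
      ?T \<otimes>\<^bsub>HW\<^esub> ?T \<oplus>\<^bsub>HW\<^esub> (hs (- v) \<otimes>\<^bsub>HW\<^esub> ?T \<oplus>\<^bsub>HW\<^esub> hs (vpow (- 1)) \<otimes>\<^bsub>HW\<^esub> ?T) \<oplus>\<^bsub>HW\<^esub> hs (- v * vpow (- 1))"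
    unfolding hs_mult using T by (simp add: HW.l_distr HW.r_distr HW.a_ac hs_central[OF T])
  also have "hs (- v) \<otimes>\<^bsub>HW\<^esub> ?T \<oplus>\<^bsub>HW\<^esub> hs (vpow (- 1)) \<otimes>\<^bsub>HW\<^esub> ?T = hs (- v + vpow (- 1)) \<otimes>\<^bsub>HW\<^esub> ?T"
    unfolding hs_add using T by (simp add: HW.l_distr)
  finally have z: "?T \<otimes>\<^bsub>HW\<^esub> ?T \<oplus>\<^bsub>HW\<^esub> hs (- v + vpow (- 1)) \<otimes>\<^bsub>HW\<^esub> ?T \<oplus>\<^bsub>HW\<^esub> hs (- 1) = \<zero>\<^bsub>HW\<^esub>"
    unfolding e vv by simp
  have hs0: "hs 0 = \<zero>\<^bsub>HW\<^esub>" using hs_add[of 0 0] HW.add.l_cancel_one'[of "hs 0" "hs 0"] by simp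
  have "?T \<otimes>\<^bsub>HW\<^esub> ?T = ?T \<otimes>\<^bsub>HW\<^esub> ?T \<oplus>\<^bsub>HW\<^esub> (hs ((- v + vpow (- 1)) + (v - vpow (- 1))) \<otimes>\<^bsub>HW\<^esub> ?T) \<oplus>\<^bsub>HW\<^esub> hs (- 1 + 1)"
    using T by (simp add: hs0)
  also have "\<dots> = (?T \<otimes>\<^bsub>HW\<^esub> ?T \<oplus>\<^bsub>HW\<^esub> hs (- v + vpow (- 1)) \<otimes>\<^bsub>HW\<^esub> ?T \<oplus>\<^bsub>HW\<^esub> hs (- 1)) \<oplus>\<^bsub>HW\<^esub>
      (\<one>\<^bsub>HW\<^esub> \<oplus>\<^bsub>HW\<^esub> hs (v - vpow (- 1)) \<otimes>\<^bsub>HW\<^esub> ?T)"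
    unfolding hs_add[of "- v + vpow (- 1)" "v - vpow (- 1)"] hs_add[of "- 1" 1] hs_one
    using T by (simp add: HW.l_distr HW.a_ac)
  also have "\<dots> = \<one>\<^bsub>HW\<^esub> \<oplus>\<^bsub>HW\<^esub> hs (v - vpow (- 1)) \<otimes>\<^bsub>HW\<^esub> ?T"
    unfolding z using T by simp
  finally show ?thesis .
qed

lemma mprod_hT:
  "us \<in> lists S \<Longrightarrow> mprod HW (map hT us) = hpi (Poly_Mapping.single (cls (map (\<lambda>s. (s, True)) us)) 1)"
proof (induction us)
  case (Cons s us)
  let ?u = "map (\<lambda>s. (s, True)) us"
  have u: "[(s, True)] \<in> words S" "?u \<in> words S" "us \<in> lists S" using Cons.prems by auto
  show ?case
    using Cons.IH[OF u(3)] hpi_mult[OF keys_single_cls[OF u(1), of 1] keys_single_cls[OF u(2), of 1]]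
      cls_mult[OF u(1,2)]
    by (simp add: hT_eq[of s] monoid_ring_mult_single)
qed (simp add: hpi_one)

lemma hT_braid:
  assumes "s \<in> S" "t \<in> S"
  shows "mprod HW (alternating (ord (s \<otimes> t)) (hT s) (hT t)) = mprod HW (alternating (ord (s \<otimes> t)) (hT t) (hT s))"
proof -
  have w: "alternating_word n s t \<in> words S" if "s \<in> S" "t \<in> S" for n s t
    using that by (induction n arbitrary: s t) auto
  have "pres_eq S (braid_relations W S) (alternating_word (ord (s \<otimes> t)) s t) (alternating_word (ord (s \<otimes> t)) t s)"
    using assms by (intro pres_eq.relation w) (auto simp: braid_relations_def coxeter_mat_def)
  then have "cls (alternating_word (ord (s \<otimes> t)) s t) = cls (alternating_word (ord (s \<otimes> t)) t s)"
    using assms w by (simp add: pres_class_eq_iff)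
  then show ?thesis
    using assms by (simp add: mprod_hT alternating_word_eq flip: map_alternating[of hT])
qed

section \<open>Projection of the braid group to W and specialization of H_W at v = 1\<close>

definition bw :: "'a word set \<Rightarrow> 'a" where
  "bw D = mprod W (map fst (SOME u. u \<in> words S \<and> cls u = D))"

text \<open>Makes \<open>bw\<close>, the projection from the braid group to W, independent of the
  representative.\<close>

lemma braid_eq_mprod:
  "pres_eq S (braid_relations W S) u w \<Longrightarrow> mprod W (map fst u) = mprod W (map fst w)"
proof (induction rule: pres_eq.induct)
  case (append u w u' w')
  have "map fst u \<in> lists S" "map fst w \<in> lists S" "map fst u' \<in> lists S" "map fst w' \<in> lists S"
    using pres_eq_words[OF append(1)] pres_eq_words[OF append(2)] by (auto simp: in_lists_conv_set)
  then show ?case using append.IH by (simp add: mprod_append lists_gen_closed)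
next
  case (relation u w)
  then obtain s t where st: "s \<in> S" "t \<in> S" "u = alternating_word (ord (s \<otimes> t)) s t"
      "w = alternating_word (ord (s \<otimes> t)) t s"
    by (auto simp: braid_relations_def coxeter_mat_def)
  have "map fst (alternating_word n s t) = alternating n s t" for n and s t :: 'a
    by (simp add: alternating_word_eq comp_def)
  then show ?case unfolding st(3,4) using mprod_alternating_swap[OF st(1,2)] by simp
qed (simp_all add: gen_square gen_square_mult)

lemma bw_cls:
  assumes "u \<in> words S"
  shows "bw (cls u) = mprod W (map fst u)"
proof -
  define w where "w = (SOME w. w \<in> words S \<and> cls w = cls u)"
  have w: "w \<in> words S \<and> cls w = cls u" unfolding w_def by (rule someI[of _ u]) (use assms in simp)
  then have "pres_eq S (braid_relations W S) w u"
    using assms pres_class_eq_iff[of w S u "braid_relations W S"] by blast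
  then show ?thesis using braid_eq_mprod by (simp add: bw_def flip: w_def)
qed

lemma word_mprod_closed: "u \<in> words S \<Longrightarrow> mprod W (map fst u) \<in> carrier W"
  by (rule mprod_gen_closed) (auto simp: in_lists_conv_set)

lemma bw_mult:
  assumes "C \<in> carrier BG" "D \<in> carrier BG"
  shows "bw (C \<otimes>\<^bsub>BG\<^esub> D) = bw C \<otimes> bw D"
proof -
  obtain u w where u: "u \<in> words S" "C = cls u" and w: "w \<in> words S" "D = cls w"
    using BG_cases assms by blast
  have "map fst u \<in> lists S" "map fst w \<in> lists S" using u w by (auto simp: in_lists_conv_set)
  then show ?thesis using u w by (simp add: cls_mult bw_cls mprod_append lists_gen_closed)
qed

lemma bw_closed: "D \<in> carrier BG \<Longrightarrow> bw D \<in> carrier W"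
proof -
  assume "D \<in> carrier BG"
  then obtain u where "u \<in> words S" "D = cls u" using BG_cases by blast
  then show "bw D \<in> carrier W" using word_mprod_closed[of u] bw_cls[of u] by simp
qed

text \<open>The projection to W together with v -> 1 extends to the braid group ring. It kills the
  ideal, since at v = 1 a quadratic generator becomes (s - 1)(s + 1) = s^2 - 1 = 0.\<close>

lemma hecke_specialization_exists:
  "\<exists>\<psi>\<in>Ring.ring_hom HW QW. (\<forall>c. \<psi> (hs c) = Poly_Mapping.single \<one> (int_laurent_to_R c $ 0)) \<and>
     (\<forall>s\<in>S. \<psi> (hT s) = Poly_Mapping.single s 1)"
proof -
  interpret QW: ring QW by (rule ring_QW)
  define \<theta> where "\<theta> D c = Poly_Mapping.single (bw D) (int_laurent_to_R c $ 0)" for D c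
  define \<Phi> where "\<Phi> = monoid_ring_lift \<theta>"
  have z: "int_laurent_to_R 0 $ 0 = 0" using int_laurent_to_R_nth_0_single[of 0 0] by simp
  have o: "int_laurent_to_R 1 $ 0 = 1" using int_laurent_to_R_nth_0_single[of 0 1] by (simp add: single_one)
  have \<theta>0: "\<theta> D 0 = 0" for D by (simp add: \<theta>_def z)
  have "\<Phi> \<in> Ring.ring_hom (monoid_ring BG) QW"
    unfolding \<Phi>_def
  proof (rule monoid_ring_lift_hom[OF monoid_BG monoid_axioms])
    show "\<theta> D c \<in> carrier QW" if "D \<in> carrier BG" for D c
      using bw_closed[OF that] by (simp add: \<theta>_def)
  qed (simp_all add: \<theta>_def z o int_laurent_to_R_nth_0_add int_laurent_to_R_nth_0_mult single_add
      bw_mult monoid_ring_mult_single BG_one bw_cls)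
  then have \<Phi>: "\<Phi> \<in> Ring.ring_hom BR QW" by (simp add: braid_group_ring_def)
  have \<Phi>_single: "\<Phi> (Poly_Mapping.single D c) = \<theta> D c" for D c
    unfolding \<Phi>_def by (rule monoid_ring_lift_single) (rule \<theta>0)
  have \<Phi>_add: "\<Phi> (f + g) = \<Phi> f + \<Phi> g" for f g
    unfolding \<Phi>_def by (rule monoid_ring_lift_add)
      (simp_all add: \<theta>_def z int_laurent_to_R_nth_0_add single_add)
  have kill: "\<Phi> x = \<zero>\<^bsub>QW\<^esub>" if "x \<in> quad_gens" for x
  proof -
    obtain s where s: "s \<in> S" and x: "x = (Poly_Mapping.single (cls [(s, True)]) 1 + Poly_Mapping.single (cls []) (- v))
        \<otimes>\<^bsub>BR\<^esub> (Poly_Mapping.single (cls [(s, True)]) 1 + Poly_Mapping.single (cls []) (vpow (- 1)))"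
      using \<open>x \<in> quad_gens\<close> unfolding quad_gens_def by blast
    have c: "Poly_Mapping.single (cls [(s, True)]) 1 + Poly_Mapping.single (cls []) y \<in> carrier BR" for y
      using cls_carrier[OF gen_word[OF s, of True]] cls_carrier[OF lists.Nil]
      by (auto simp: braid_group_ring_def intro!: order_trans[OF Poly_Mapping.keys_add] split: if_splits)
    have b: "bw (cls [(s, True)]) = s" "bw (cls []) = \<one>" using s by (simp_all add: bw_cls)
    have "int_laurent_to_R (- v) $ 0 = - 1" "int_laurent_to_R (vpow (- 1)) $ 0 = 1"
      using int_laurent_to_R_nth_0_single[of 1 "- 1"] int_laurent_to_R_nth_0_single[of "- 1" 1]
      by (simp_all add: vpow_def single_uminus)
    then show ?thesis
      unfolding x Ring.ring_hom_mult[OF \<Phi> c c] \<Phi>_add \<Phi>_single \<theta>_def b o using s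
      by (simp add: monoid_ring_distrib_left monoid_ring_distrib_right monoid_ring_mult_single gen_square)
        (simp add: single_uminus)
  qed
  have "\<Phi> x = \<zero>\<^bsub>QW\<^esub>" if "x \<in> HI" for x
    using ring_hom_vanishes_on_genideal[OF ring_BR ring_QW \<Phi> quad_gens_carrier kill] that
    unfolding hecke_ideal_eq by blast
  from quotient_lift[OF ring_BR ideal_HI ring_QW \<Phi> this] obtain \<psi>
    where \<psi>: "\<psi> \<in> Ring.ring_hom HW QW" "\<And>x. x \<in> carrier BR \<Longrightarrow> \<psi> (hpi x) = \<Phi> x"
    unfolding hecke_def[symmetric] hpi_def[symmetric] by blast
  have "\<psi> (hs c) = Poly_Mapping.single \<one> (int_laurent_to_R c $ 0)" for c
    unfolding hs_eq using cls_carrier[OF lists.Nil]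
    by (subst \<psi>(2)) (auto simp: braid_group_ring_def \<Phi>_single \<theta>_def bw_cls split: if_splits)
  moreover have "\<psi> (hT s) = Poly_Mapping.single s 1" if "s \<in> S" for s
    unfolding hT_eq using cls_carrier[OF gen_word[OF that, of True]] that
    by (subst \<psi>(2)) (auto simp: braid_group_ring_def \<Phi>_single \<theta>_def bw_cls o)
  ultimately show ?thesis using \<psi>(1) by blast
qed

section \<open>The scalar extension R H_W as a tensor product\<close>

abbreviation "TM \<equiv> (ring_of_type_algebra :: rat fps ring) \<times>\<times> HW"
abbreviation "TI \<equiv> tensor_ideal ring_of_type_algebra int_laurent_to_R ring_of_type_algebra hs HW"
abbreviation "TR \<equiv> tensor_relators ring_of_type_algebra int_laurent_to_R ring_of_type_algebra hs HW"
abbreviation "RH \<equiv> R_hecke W S"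
abbreviation "rt \<equiv> R_tensor W S"

lemma type_algebra_simps [simp]:
  "carrier (ring_of_type_algebra :: 'k::comm_ring_1 ring) = UNIV"
  "x \<otimes>\<^bsub>ring_of_type_algebra\<^esub> y = x * y" "x \<oplus>\<^bsub>ring_of_type_algebra\<^esub> y = x + y"
  "\<one>\<^bsub>ring_of_type_algebra\<^esub> = 1" for x y :: "'k::comm_ring_1"
  by (simp_all add: ring_of_type_algebra_def)

lemma monoid_TM: "Group.monoid TM"
  by (rule DirProd_monoid) (auto intro: ring.is_monoid ring_from_type_algebra ring_HW)

lemma TM_simps [simp]: "(a, h) \<in> carrier TM \<longleftrightarrow> h \<in> carrier HW"
  "(a, h) \<otimes>\<^bsub>TM\<^esub> (b, k) = (a * b, h \<otimes>\<^bsub>HW\<^esub> k)" "\<one>\<^bsub>TM\<^esub> = (1, \<one>\<^bsub>HW\<^esub>)"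
  by (auto simp: DirProd_def)

lemma ring_TMR: "ring (monoid_ring TM :: (rat fps \<times> _ \<Rightarrow>\<^sub>0 int) ring)"
  by (rule monoid.ring_monoid_ring[OF monoid_TM])

lemma keys_single_TM: "h \<in> carrier HW \<Longrightarrow> Poly_Mapping.keys (Poly_Mapping.single (a, h) (n :: int)) \<subseteq> carrier TM"
  by simp

lemma tensor_relators_carrier: "TR \<subseteq> carrier (monoid_ring TM)"
proof -
  interpret HW: ring HW by (rule ring_HW)
  show ?thesis
    unfolding tensor_relators_def Let_def
    by (auto dest!: subsetD[OF keys_diff])
qed

lemma ideal_TI: "ideal TI (monoid_ring TM)"
  unfolding tensor_ideal_def by (rule ring.genideal_ideal[OF ring_TMR tensor_relators_carrier])

lemma RH_eq: "RH = monoid_ring TM Quot TI"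
  by (simp add: R_hecke_def tensor_algebra_def)

lemma ring_RH: "ring RH"
  unfolding RH_eq by (rule ideal.quotient_is_ring[OF ideal_TI])

definition tpi :: "(rat fps \<times> _ \<Rightarrow>\<^sub>0 int) \<Rightarrow> 'a R_hecke_elem" where
  "tpi f = TI +>\<^bsub>monoid_ring TM\<^esub> f"

lemma tpi_hom: "tpi \<in> Ring.ring_hom (monoid_ring TM) RH"
  unfolding RH_eq tpi_def[abs_def] by (rule ideal.rcos_ring_hom[OF ideal_TI])

lemma tpi_closed: "Poly_Mapping.keys f \<subseteq> carrier TM \<Longrightarrow> tpi f \<in> carrier RH"
  using Ring.ring_hom_closed[OF tpi_hom] by simp

lemma tpi_mult: "Poly_Mapping.keys f \<subseteq> carrier TM \<Longrightarrow> Poly_Mapping.keys g \<subseteq> carrier TM \<Longrightarrow>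
    tpi (f \<otimes>\<^bsub>monoid_ring TM\<^esub> g) = tpi f \<otimes>\<^bsub>RH\<^esub> tpi g"
  using Ring.ring_hom_mult[OF tpi_hom] by simp

lemma tpi_add: "Poly_Mapping.keys f \<subseteq> carrier TM \<Longrightarrow> Poly_Mapping.keys g \<subseteq> carrier TM \<Longrightarrow>
    tpi (f + g) = tpi f \<oplus>\<^bsub>RH\<^esub> tpi g"
  using Ring.ring_hom_add[OF tpi_hom] by simp

lemma RH_cases: "x \<in> carrier RH \<Longrightarrow> \<exists>f. Poly_Mapping.keys f \<subseteq> carrier TM \<and> x = tpi f"
  by (auto simp: RH_eq FactRing_def A_RCOSETS_def' tpi_def)

lemma rt_eq: "rt a h = tpi (Poly_Mapping.single (a, h) 1)"
  by (simp add: R_tensor_def pure_tensor_def tpi_def)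

lemma rt_closed: "h \<in> carrier HW \<Longrightarrow> rt a h \<in> carrier RH"
  unfolding rt_eq by (rule tpi_closed[OF keys_single_TM])

lemma tpi_eqI: "Poly_Mapping.keys f \<subseteq> carrier TM \<Longrightarrow> Poly_Mapping.keys g \<subseteq> carrier TM \<Longrightarrow> f - g \<in> TR \<Longrightarrow>
    tpi f = tpi g"
  unfolding tpi_def using ring.genideal_self[OF ring_TMR tensor_relators_carrier]
  by (intro monoid_ring_quotient_eqI[OF monoid_TM ideal_TI]) (auto simp: tensor_ideal_def)

lemma keys_add_TM: "Poly_Mapping.keys f \<subseteq> carrier TM \<Longrightarrow> Poly_Mapping.keys g \<subseteq> carrier TM \<Longrightarrow>
    Poly_Mapping.keys (f + g :: _ \<Rightarrow>\<^sub>0 int) \<subseteq> carrier TM"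
  by (rule order_trans[OF Poly_Mapping.keys_add]) simp

lemma rt_add_left:
  assumes "h \<in> carrier HW"
  shows "rt (a + b) h = rt a h \<oplus>\<^bsub>RH\<^esub> rt b h"
  unfolding rt_eq tpi_add[OF keys_single_TM[OF assms] keys_single_TM[OF assms], symmetric]
proof (rule tpi_eqI[OF keys_single_TM[OF assms] keys_add_TM[OF keys_single_TM[OF assms] keys_single_TM[OF assms]]])
  have "Poly_Mapping.single (a + b, h) 1 - (Poly_Mapping.single (a, h) 1 + Poly_Mapping.single (b, h) 1) =
      Poly_Mapping.single (a + b, h) (1 :: int) - Poly_Mapping.single (a, h) 1 - Poly_Mapping.single (b, h) 1"
    by simp
  also have "\<dots> \<in> TR" using assms unfolding tensor_relators_def Let_def type_algebra_simps by blast
  finally show "Poly_Mapping.single (a + b, h) 1 - (Poly_Mapping.single (a, h) 1 + Poly_Mapping.single (b, h) 1) \<in> TR" .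
qed

lemma rt_add_right:
  assumes h: "h \<in> carrier HW" and k: "k \<in> carrier HW"
  shows "rt a (h \<oplus>\<^bsub>HW\<^esub> k) = rt a h \<oplus>\<^bsub>RH\<^esub> rt a k"
  unfolding rt_eq tpi_add[OF keys_single_TM[OF h] keys_single_TM[OF k], symmetric]
proof (rule tpi_eqI[OF keys_single_TM keys_add_TM[OF keys_single_TM[OF h] keys_single_TM[OF k]]])
  have "Poly_Mapping.single (a, h \<oplus>\<^bsub>HW\<^esub> k) 1 - (Poly_Mapping.single (a, h) 1 + Poly_Mapping.single (a, k) 1) =
      Poly_Mapping.single (a, h \<oplus>\<^bsub>HW\<^esub> k) (1 :: int) - Poly_Mapping.single (a, h) 1 - Poly_Mapping.single (a, k) 1"
    by simp
  also have "\<dots> \<in> TR" using assms unfolding tensor_relators_def Let_def type_algebra_simps by blast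
  finally show "Poly_Mapping.single (a, h \<oplus>\<^bsub>HW\<^esub> k) 1 -
      (Poly_Mapping.single (a, h) 1 + Poly_Mapping.single (a, k) 1) \<in> TR" .
  show "h \<oplus>\<^bsub>HW\<^esub> k \<in> carrier HW" using ring.ring_simprules(1)[OF ring_HW h k] .
qed

lemma rt_balanced:
  assumes h: "h \<in> carrier HW"
  shows "rt (int_laurent_to_R c * a) h = rt a (hs c \<otimes>\<^bsub>HW\<^esub> h)"
  unfolding rt_eq
proof (rule tpi_eqI[OF keys_single_TM[OF h] keys_single_TM])
  show "hs c \<otimes>\<^bsub>HW\<^esub> h \<in> carrier HW" using ring.ring_simprules(5)[OF ring_HW hs_closed h] .
  show "Poly_Mapping.single (int_laurent_to_R c * a, h) 1 - Poly_Mapping.single (a, hs c \<otimes>\<^bsub>HW\<^esub> h) 1 \<in> TR"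
    using assms unfolding tensor_relators_def Let_def type_algebra_simps by blast
qed

lemma rt_mult:
  assumes h: "h \<in> carrier HW" and k: "k \<in> carrier HW"
  shows "rt a h \<otimes>\<^bsub>RH\<^esub> rt b k = rt (a * b) (h \<otimes>\<^bsub>HW\<^esub> k)"
  unfolding rt_eq tpi_mult[OF keys_single_TM[OF h] keys_single_TM[OF k], symmetric]
  by (simp add: monoid_ring_mult_single)

lemma rt_one: "rt 1 \<one>\<^bsub>HW\<^esub> = \<one>\<^bsub>RH\<^esub>"
  using Ring.ring_hom_one[OF tpi_hom] by (simp add: rt_eq)

text \<open>Every element is a combination of braid words, and an inverse letter becomes T_s^-1 =
  T_s - (v - v^-1). Negatives arise as products with scalars, so closure under sums and products
  suffices.\<close>

lemma HW_generated:
  assumes "F \<subseteq> carrier HW" "\<And>c. hs c \<in> F" "\<And>s. s \<in> S \<Longrightarrow> hT s \<in> F"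
    and add: "\<And>x y. x \<in> F \<Longrightarrow> y \<in> F \<Longrightarrow> x \<oplus>\<^bsub>HW\<^esub> y \<in> F"
    and mult: "\<And>x y. x \<in> F \<Longrightarrow> y \<in> F \<Longrightarrow> x \<otimes>\<^bsub>HW\<^esub> y \<in> F"
  shows "carrier HW \<subseteq> F"
proof
  interpret HW: ring HW by (rule ring_HW)
  let ?m = "\<lambda>u. hpi (Poly_Mapping.single (cls u) 1)"
  have m_closed: "?m u \<in> carrier HW" if "u \<in> words S" for u by (rule hpi_closed[OF keys_single_cls[OF that]])
  have m_mult: "?m u \<otimes>\<^bsub>HW\<^esub> ?m w = ?m (u @ w)" if "u \<in> words S" "w \<in> words S" for u w
    unfolding hpi_mult[OF keys_single_cls[OF that(1)] keys_single_cls[OF that(2)], symmetric]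
    by (simp add: monoid_ring_mult_single cls_mult[OF that])
  have letter: "?m [(s, b)] \<in> F" if s: "s \<in> S" for s b
  proof (cases b)
    case True
    then show ?thesis using assms(3)[OF s] by (simp add: hT_eq)
  next
    case False
    define t d where "t = ?m [(s, False)]" and "d = (v - vpow (- 1) :: int laurent)"
    have t: "t \<in> carrier HW" unfolding t_def using s by (intro m_closed) simp
    have T: "hT s \<in> carrier HW" using s by simp
    have "cls [(s, False), (s, True)] = cls []"
      using pres_eq.cancel[of s S "braid_relations W S" False] s by (simp add: pres_class_eq_iff)
    then have tT: "t \<otimes>\<^bsub>HW\<^esub> hT s = \<one>\<^bsub>HW\<^esub>"
      using m_mult[of "[(s, False)]" "[(s, True)]"] s by (simp add: t_def hT_eq hpi_one)
    have "hs d \<oplus>\<^bsub>HW\<^esub> hs (- d) = \<zero>\<^bsub>HW\<^esub>"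
      using hs_add[of d "- d"] hs_add[of 0 0] HW.add.l_cancel_one'[of "hs 0" "hs 0"] by simp
    then have dd: "hs d \<otimes>\<^bsub>HW\<^esub> hT s \<oplus>\<^bsub>HW\<^esub> hs (- d) \<otimes>\<^bsub>HW\<^esub> hT s = \<zero>\<^bsub>HW\<^esub>"
      using HW.l_distr[of "hs d" "hs (- d)" "hT s"] T by simp
    have "hT s \<otimes>\<^bsub>HW\<^esub> (hT s \<oplus>\<^bsub>HW\<^esub> hs (- d)) =
        \<one>\<^bsub>HW\<^esub> \<oplus>\<^bsub>HW\<^esub> (hs d \<otimes>\<^bsub>HW\<^esub> hT s \<oplus>\<^bsub>HW\<^esub> hs (- d) \<otimes>\<^bsub>HW\<^esub> hT s)"
      using T hT_square[OF s] hs_central[OF T, of "- d"] by (simp add: HW.r_distr HW.a_assoc d_def)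
    then have TT: "hT s \<otimes>\<^bsub>HW\<^esub> (hT s \<oplus>\<^bsub>HW\<^esub> hs (- d)) = \<one>\<^bsub>HW\<^esub>" unfolding dd by simp
    \<comment> \<open>The inverse letter is a left inverse of T_s and T_s - d a right inverse, so
      the two agree.\<close>
    have "t = t \<otimes>\<^bsub>HW\<^esub> (hT s \<otimes>\<^bsub>HW\<^esub> (hT s \<oplus>\<^bsub>HW\<^esub> hs (- d)))" unfolding TT using t by simp
    also have "\<dots> = hT s \<oplus>\<^bsub>HW\<^esub> hs (- d)" using t T tT by (simp flip: HW.m_assoc)
    finally show ?thesis using assms(2) assms(3)[OF s] add False by (simp add: t_def)
  qed
  have word: "?m u \<in> F" if "u \<in> words S" for u
    using that
  proof (induction u)
    case Nil
    show ?case using assms(2)[of 1] by (simp add: hs_eq)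
  next
    case (Cons x u)
    obtain s b where x: "x = (s, b)" by (cases x)
    have "?m (x # u) = ?m [(s, b)] \<otimes>\<^bsub>HW\<^esub> ?m u"
      using m_mult[of "[(s, b)]" u] Cons by (auto simp: x)
    then show ?case using letter[of s b] mult Cons x by auto
  qed
  fix x assume "x \<in> carrier HW"
  then obtain f where f: "Poly_Mapping.keys f \<subseteq> carrier BG" "x = hpi f" using HW_cases by blast
  have "hpi f \<in> F" using f(1)
  proof (induction rule: poly_mapping_keys_induct)
    case zero
    have "hpi 0 = \<zero>\<^bsub>HW\<^esub>" using hpi_add[of 0 0] hpi_closed[of 0] HW.add.l_cancel_one'[of "hpi 0" "hpi 0"] by simp
    moreover have "hs 0 = hpi 0" by (simp add: hs_eq)
    ultimately show ?case using assms(2)[of 0] by simp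
  next
    case (single D c)
    then obtain u where u: "u \<in> words S" "D = cls u" using BG_cases by blast
    have "hpi (Poly_Mapping.single D c) = hs c \<otimes>\<^bsub>HW\<^esub> ?m u"
      unfolding u hs_eq hpi_mult[OF keys_single_cls[OF lists.Nil] keys_single_cls[OF u(1)], symmetric]
      using cls_mult[OF lists.Nil u(1)] by (simp add: monoid_ring_mult_single)
    then show ?case using mult assms(2) word[OF u(1)] by simp
  next
    case (add f g)
    then show ?case using hpi_add[of f g] assms(4) by simp
  qed
  then show "x \<in> F" using f by simp
qed

text \<open>A pure tensor is the product of a scalar of R and the image of an element of H_W, and
  the latter is covered by \<open>HW_generated\<close>. The lemma yields the uniqueness of the
  specialization and the centrality of R.\<close>

lemma RH_generated:
  assumes E: "E \<subseteq> carrier RH" "\<And>r. rt r \<one>\<^bsub>HW\<^esub> \<in> E" "\<And>s. s \<in> S \<Longrightarrow> R_T W S s \<in> E"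
    and add: "\<And>x y. x \<in> E \<Longrightarrow> y \<in> E \<Longrightarrow> x \<oplus>\<^bsub>RH\<^esub> y \<in> E"
    and mult: "\<And>x y. x \<in> E \<Longrightarrow> y \<in> E \<Longrightarrow> x \<otimes>\<^bsub>RH\<^esub> y \<in> E"
  shows "carrier RH \<subseteq> E"
proof
  interpret HW: ring HW by (rule ring_HW)
  interpret RH: ring RH by (rule ring_RH)
  have "carrier HW \<subseteq> {h \<in> carrier HW. rt 1 h \<in> E}"
  proof (rule HW_generated)
    fix c
    have "rt 1 (hs c) = rt (int_laurent_to_R c) \<one>\<^bsub>HW\<^esub>" using rt_balanced[of "\<one>\<^bsub>HW\<^esub>" c 1] by simp
    then show "hs c \<in> {h \<in> carrier HW. rt 1 h \<in> E}" using E(2) by simp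
  next
    fix x y assume "x \<in> {h \<in> carrier HW. rt 1 h \<in> E}" "y \<in> {h \<in> carrier HW. rt 1 h \<in> E}"
    then show "x \<oplus>\<^bsub>HW\<^esub> y \<in> {h \<in> carrier HW. rt 1 h \<in> E}" "x \<otimes>\<^bsub>HW\<^esub> y \<in> {h \<in> carrier HW. rt 1 h \<in> E}"
      using add[of "rt 1 x" "rt 1 y"] mult[of "rt 1 x" "rt 1 y"] by (auto simp: rt_add_right rt_mult)
  qed (use E(3) in \<open>auto simp: R_T_def\<close>)
  then have rt: "rt a h \<in> E" if "h \<in> carrier HW" for a h
    using that mult[of "rt a \<one>\<^bsub>HW\<^esub>" "rt 1 h"] E(2) by (auto simp: rt_mult)
  have zero: "\<zero>\<^bsub>RH\<^esub> \<in> E"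
    using rt_add_left[of "\<one>\<^bsub>HW\<^esub>" 0 0] RH.add.l_cancel_one'[of "rt 0 \<one>\<^bsub>HW\<^esub>" "rt 0 \<one>\<^bsub>HW\<^esub>"] E(2)[of 0]
      rt_closed[of "\<one>\<^bsub>HW\<^esub>" 0] by simp
  have tpi0: "tpi 0 = \<zero>\<^bsub>RH\<^esub>"
    using tpi_add[of 0 0] tpi_closed[of 0] RH.add.l_cancel_one'[of "tpi 0" "tpi 0"] by simp
  have neg: "\<ominus>\<^bsub>RH\<^esub> y \<in> E" if "y \<in> E" for y
  proof -
    have y: "y \<in> carrier RH" using that E by blast
    have "rt (- 1) \<one>\<^bsub>HW\<^esub> \<oplus>\<^bsub>RH\<^esub> \<one>\<^bsub>RH\<^esub> = rt 0 \<one>\<^bsub>HW\<^esub>"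
      using rt_add_left[of "\<one>\<^bsub>HW\<^esub>" "- 1" 1] by (simp add: rt_one)
    also have "rt 0 \<one>\<^bsub>HW\<^esub> = \<zero>\<^bsub>RH\<^esub>"
      using rt_add_left[of "\<one>\<^bsub>HW\<^esub>" 0 0] RH.add.l_cancel_one'[of "rt 0 \<one>\<^bsub>HW\<^esub>" "rt 0 \<one>\<^bsub>HW\<^esub>"]
        rt_closed[of "\<one>\<^bsub>HW\<^esub>" 0] by simp
    finally have "rt (- 1) \<one>\<^bsub>HW\<^esub> \<otimes>\<^bsub>RH\<^esub> y \<oplus>\<^bsub>RH\<^esub> y = \<zero>\<^bsub>RH\<^esub>"
      using RH.l_distr[of "rt (- 1) \<one>\<^bsub>HW\<^esub>" "\<one>\<^bsub>RH\<^esub>" y] y rt_closed[of "\<one>\<^bsub>HW\<^esub>" "- 1"] by simp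
    then have "\<ominus>\<^bsub>RH\<^esub> y = rt (- 1) \<one>\<^bsub>HW\<^esub> \<otimes>\<^bsub>RH\<^esub> y"
      using y rt_closed[of "\<one>\<^bsub>HW\<^esub>" "- 1"] by (intro RH.minus_equality) auto
    then show ?thesis using mult[OF E(2) that] by simp
  qed
  fix x assume "x \<in> carrier RH"
  then obtain f where f: "Poly_Mapping.keys f \<subseteq> carrier TM" "x = tpi f" using RH_cases by blast
  have "tpi f \<in> E" using f(1)
  proof (induction rule: poly_mapping_keys_induct)
    case zero
    then show ?case using tpi0 \<open>\<zero>\<^bsub>RH\<^esub> \<in> E\<close> by simp
  next
    case (single p n)
    obtain a h where p: "p = (a, h)" by (cases p)
    have h: "h \<in> carrier HW" using single p by (simp add: DirProd_def)
    \<comment> \<open>Integer multiples of a pure tensor: natural ones by repeated addition,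
      negative ones below by the scalar -1 of R.\<close>
    have pos: "tpi (Poly_Mapping.single (a, h) (int k)) \<in> E" for k
    proof (induction k)
      case (Suc k)
      have "tpi (Poly_Mapping.single (a, h) (int (Suc k))) = rt a h \<oplus>\<^bsub>RH\<^esub> tpi (Poly_Mapping.single (a, h) (int k))"
        unfolding rt_eq tpi_add[OF keys_single_TM[OF h] keys_single_TM[OF h], symmetric]
        by (simp flip: single_add)
      then show ?case using add[OF rt[OF h] Suc] by simp
    qed (use tpi0 zero in simp)
    have "tpi (Poly_Mapping.single (a, h) (- int k)) \<in> E" for k
    proof -
      have "tpi (Poly_Mapping.single (a, h) (- int k)) \<oplus>\<^bsub>RH\<^esub> tpi (Poly_Mapping.single (a, h) (int k)) = \<zero>\<^bsub>RH\<^esub>"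
        unfolding tpi_add[OF keys_single_TM[OF h] keys_single_TM[OF h], symmetric]
        using tpi0 by (simp flip: single_add)
      then have "tpi (Poly_Mapping.single (a, h) (- int k)) = \<ominus>\<^bsub>RH\<^esub> tpi (Poly_Mapping.single (a, h) (int k))"
        using tpi_closed[OF keys_single_TM[OF h]] by (intro RH.minus_equality[symmetric]) auto
      then show ?thesis using neg[OF pos] by simp
    qed
    then show ?case using pos p by (cases n rule: int_cases2) auto
  next
    case (add f g)
    then show ?case using tpi_add[of f g] assms(4) by simp
  qed
  then show "x \<in> E" using f by simp
qed

text \<open>The property inside the \<open>THE\<close> of \<open>at_v_eq_1\<close>. Extensionality
  is what makes the function itself unique, beyond its restriction to the carrier.\<close>

definition specialization :: "('a R_hecke_elem \<Rightarrow> ('a \<Rightarrow>\<^sub>0 rat)) \<Rightarrow> bool" where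
  "specialization \<phi> \<longleftrightarrow> \<phi> \<in> Ring.ring_hom RH QW \<and> \<phi> \<in> extensional (carrier RH) \<and>
     (\<forall>r. \<phi> (rt r \<one>\<^bsub>HW\<^esub>) = Poly_Mapping.single \<one> (r $ 0)) \<and>
     (\<forall>s\<in>S. \<phi> (R_T W S s) = Poly_Mapping.single s 1)"

lemma specialization_unique:
  assumes p: "specialization \<phi>" and q: "specialization \<psi>"
  shows "\<phi> = \<psi>"
proof (rule extensionalityI[of _ "carrier RH"])
  have h: "\<phi> \<in> Ring.ring_hom RH QW" "\<psi> \<in> Ring.ring_hom RH QW"
    using p q by (auto simp: specialization_def)
  have "carrier RH \<subseteq> {x \<in> carrier RH. \<phi> x = \<psi> x}"
  proof (rule RH_generated)
    fix x y assume "x \<in> {x \<in> carrier RH. \<phi> x = \<psi> x}" "y \<in> {x \<in> carrier RH. \<phi> x = \<psi> x}"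
    then show "x \<oplus>\<^bsub>RH\<^esub> y \<in> {x \<in> carrier RH. \<phi> x = \<psi> x}" "x \<otimes>\<^bsub>RH\<^esub> y \<in> {x \<in> carrier RH. \<phi> x = \<psi> x}"
      using Ring.ring_hom_add[OF h(1)] Ring.ring_hom_add[OF h(2)] Ring.ring_hom_mult[OF h(1)]
        Ring.ring_hom_mult[OF h(2)] ring.ring_simprules(1,5)[OF ring_RH] by simp_all
  qed (use p q rt_closed ring.ring_simprules(6)[OF ring_HW] in \<open>auto simp: specialization_def R_T_def\<close>)
  then show "\<phi> x = \<psi> x" if "x \<in> carrier RH" for x using that by blast
qed (use p q in \<open>auto simp: specialization_def\<close>)

text \<open>On the free abelian group on pairs, (r, h) is sent to r(0) \<psi>(h). This descends to
  the tensor product because the three kinds of relators go to 0, and restriction to the carrier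
  makes it extensional.\<close>

lemma specialization_exists: "\<exists>\<phi>. specialization \<phi>"
proof -
  interpret QW: ring QW by (rule ring_QW)
  interpret HW: ring HW by (rule ring_HW)
  obtain \<psi> where \<psi>: "\<psi> \<in> Ring.ring_hom HW QW"
    "\<And>c. \<psi> (hs c) = Poly_Mapping.single \<one> (int_laurent_to_R c $ 0)"
    "\<And>s. s \<in> S \<Longrightarrow> \<psi> (hT s) = Poly_Mapping.single s 1"
    using hecke_specialization_exists by blast
  let ?c = "\<lambda>a. Poly_Mapping.single \<one> a :: 'a \<Rightarrow>\<^sub>0 rat"
  define \<theta> where "\<theta> p n = ?c (of_int n * (fst p $ 0)) \<otimes>\<^bsub>QW\<^esub> \<psi> (snd p)"
    for p :: "rat fps \<times> ('a word set \<Rightarrow>\<^sub>0 int laurent) set" and n :: int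
  define \<Phi> where "\<Phi> = monoid_ring_lift \<theta>"
  have c: "?c a \<in> carrier QW" for a by simp
  have cc: "?c a \<otimes>\<^bsub>QW\<^esub> ?c b = ?c (a * b)" for a b by (simp add: monoid_ring_mult_single)
  have \<psi>c: "\<psi> h \<in> carrier QW" if "h \<in> carrier HW" for h by (rule Ring.ring_hom_closed[OF \<psi>(1) that])
  have z: "\<theta> p 0 = 0" and a: "\<theta> p (m + n) = \<theta> p m + \<theta> p n" for p m n
    by (simp_all add: \<theta>_def distrib_right single_add monoid_ring_distrib_right)
  have mult: "\<theta> ((x, h) \<otimes>\<^bsub>TM\<^esub> (y, k)) (m * n) = \<theta> (x, h) m \<otimes>\<^bsub>QW\<^esub> \<theta> (y, k) n"
    if h: "h \<in> carrier HW" and k: "k \<in> carrier HW" for x y h k m n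
  proof -
    let ?a = "?c (of_int m * x $ 0)" and ?b = "?c (of_int n * y $ 0)"
    have "?a \<otimes>\<^bsub>QW\<^esub> \<psi> h \<otimes>\<^bsub>QW\<^esub> (?b \<otimes>\<^bsub>QW\<^esub> \<psi> k) = ?a \<otimes>\<^bsub>QW\<^esub> (\<psi> h \<otimes>\<^bsub>QW\<^esub> ?b) \<otimes>\<^bsub>QW\<^esub> \<psi> k"
      using c \<psi>c[OF h] \<psi>c[OF k] by (simp only: QW.m_assoc QW.m_closed)
    also have "\<psi> h \<otimes>\<^bsub>QW\<^esub> ?b = ?b \<otimes>\<^bsub>QW\<^esub> \<psi> h"
      using monoid_ring_scalar_central[of "\<psi> h"] \<psi>c[OF h] by simp
    also have "?a \<otimes>\<^bsub>QW\<^esub> (?b \<otimes>\<^bsub>QW\<^esub> \<psi> h) \<otimes>\<^bsub>QW\<^esub> \<psi> k = (?a \<otimes>\<^bsub>QW\<^esub> ?b) \<otimes>\<^bsub>QW\<^esub> (\<psi> h \<otimes>\<^bsub>QW\<^esub> \<psi> k)"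
      using c \<psi>c[OF h] \<psi>c[OF k] by (simp only: QW.m_assoc QW.m_closed)
    finally show ?thesis
      by (simp add: \<theta>_def cc Ring.ring_hom_mult[OF \<psi>(1) h k] mult.assoc mult.left_commute)
  qed
  have \<Phi>: "\<Phi> \<in> Ring.ring_hom (monoid_ring TM) QW"
    unfolding \<Phi>_def
  proof (rule monoid_ring_lift_hom[OF monoid_TM monoid_axioms z a])
    fix p n assume "p \<in> carrier TM"
    then have "\<psi> (snd p) \<in> carrier QW" by (intro \<psi>c) (auto simp: DirProd_def)
    then show "\<theta> p n \<in> carrier QW" unfolding \<theta>_def using c by (intro QW.m_closed)
  next
    fix p p' m n assume "p \<in> carrier TM" "p' \<in> carrier TM"
    then show "\<theta> (p \<otimes>\<^bsub>TM\<^esub> p') (m * n) = \<theta> p m \<otimes>\<^bsub>QW\<^esub> \<theta> p' n"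
      using mult[of "snd p" "snd p'" "fst p" "fst p'" m n] by (auto simp: DirProd_def)
  next
    show "\<theta> \<one>\<^bsub>TM\<^esub> 1 = \<one>\<^bsub>QW\<^esub>"
      using Ring.ring_hom_one[OF \<psi>(1)] by (simp add: \<theta>_def monoid_ring_mult_single)
  qed
  have \<Phi>s: "\<Phi> (Poly_Mapping.single p n) = \<theta> p n" for p n
    unfolding \<Phi>_def by (rule monoid_ring_lift_single) (rule z)
  have \<Phi>a: "\<Phi> (f + g) = \<Phi> f + \<Phi> g" for f g
    unfolding \<Phi>_def by (rule monoid_ring_lift_add[OF z a])
  have \<Phi>d: "\<Phi> (f - g) = \<Phi> f - \<Phi> g" for f g using \<Phi>a[of "f - g" g] by simp
  have kill: "\<Phi> x = \<zero>\<^bsub>QW\<^esub>" if "x \<in> TR" for x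
  proof -
    have 1: "\<theta> (r + r', h) 1 - \<theta> (r, h) 1 - \<theta> (r', h) 1 = 0" for r r' h
      by (simp add: \<theta>_def single_add monoid_ring_distrib_right)
    have 2: "\<theta> (r, h \<oplus>\<^bsub>HW\<^esub> k) 1 - \<theta> (r, h) 1 - \<theta> (r, k) 1 = 0" if "h \<in> carrier HW" "k \<in> carrier HW" for r h k
      using Ring.ring_hom_add[OF \<psi>(1) that] by (simp add: \<theta>_def monoid_ring_distrib_left)
    have 3: "\<theta> (int_laurent_to_R b * r, h) 1 - \<theta> (r, hs b \<otimes>\<^bsub>HW\<^esub> h) 1 = 0" if h: "h \<in> carrier HW" for b r h
    proof -
      have "\<theta> (r, hs b \<otimes>\<^bsub>HW\<^esub> h) 1 = ?c (r $ 0) \<otimes>\<^bsub>QW\<^esub> (?c (int_laurent_to_R b $ 0) \<otimes>\<^bsub>QW\<^esub> \<psi> h)"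
        using Ring.ring_hom_mult[OF \<psi>(1) hs_closed h] \<psi>(2) by (simp add: \<theta>_def)
      also have "\<dots> = ?c (r $ 0 * int_laurent_to_R b $ 0) \<otimes>\<^bsub>QW\<^esub> \<psi> h"
        unfolding cc[symmetric] using c \<psi>c[OF h] by (simp only: QW.m_assoc)
      finally show ?thesis by (simp add: \<theta>_def mult.commute)
    qed
    show ?thesis
      using that unfolding tensor_relators_def Let_def type_algebra_simps
      by (elim UnE CollectE exE conjE) (simp_all only: \<Phi>d \<Phi>s 1 2 3 monoid_ring_simps)
  qed
  have "\<Phi> x = \<zero>\<^bsub>QW\<^esub>" if "x \<in> TI" for x
    using ring_hom_vanishes_on_genideal[OF ring_TMR ring_QW \<Phi> tensor_relators_carrier kill] that
    unfolding tensor_ideal_def by blast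
  from quotient_lift[OF ring_TMR ideal_TI ring_QW \<Phi> this] obtain \<phi>
    where \<phi>: "\<phi> \<in> Ring.ring_hom RH QW" "\<And>x. x \<in> carrier (monoid_ring TM) \<Longrightarrow> \<phi> (tpi x) = \<Phi> x"
    unfolding RH_eq[symmetric] tpi_def[symmetric] by blast
  have \<phi>rt: "\<phi> (rt r h) = ?c (r $ 0) \<otimes>\<^bsub>QW\<^esub> \<psi> h" if "h \<in> carrier HW" for r h
    unfolding rt_eq using \<phi>(2)[of "Poly_Mapping.single (r, h) 1"] that by (simp add: \<Phi>s \<theta>_def)
  have one: "\<psi> \<one>\<^bsub>HW\<^esub> = ?c 1" using Ring.ring_hom_one[OF \<psi>(1)] by simp
  have "restrict \<phi> (carrier RH) \<in> Ring.ring_hom RH QW"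
    using Ring.ring_hom_closed[OF \<phi>(1)] Ring.ring_hom_add[OF \<phi>(1)] Ring.ring_hom_mult[OF \<phi>(1)]
      Ring.ring_hom_one[OF \<phi>(1)] ring.ring_simprules(1,5,6)[OF ring_RH]
    by (intro Ring.ring_hom_memI) auto
  then have "specialization (restrict \<phi> (carrier RH))"
    unfolding specialization_def
    by (simp add: rt_closed R_T_def \<phi>rt one cc \<psi>(3) monoid_ring_mult_single)
  then show ?thesis by blast
qed

lemma specialization_at_v_eq_1: "specialization (at_v_eq_1 W S)"
proof -
  have "at_v_eq_1 W S = (THE \<phi>. specialization \<phi>)"
    by (simp add: at_v_eq_1_def specialization_def)
  then show ?thesis using specialization_exists specialization_unique theI'[of specialization] by auto
qed

section \<open>Localization\<close>

text \<open>Products of pure tensors over \<open>A\<close> and \<open>K\<close> are again such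
  tensors. Two inductions over additive generation, one for each factor, extend this to the
  span.\<close>

lemma sub_span_properties:
  assumes A: "\<And>a b. a \<in> A \<Longrightarrow> b \<in> A \<Longrightarrow> a * b \<in> A" "1 \<in> A" and K: "subring K HW"
  shows "sub_span W S A K \<subseteq> carrier RH"
    and "a \<in> A \<Longrightarrow> h \<in> K \<Longrightarrow> rt a h \<in> sub_span W S A K"
    and "x \<in> sub_span W S A K \<Longrightarrow> y \<in> sub_span W S A K \<Longrightarrow> x \<oplus>\<^bsub>RH\<^esub> y \<in> sub_span W S A K"
    and "x \<in> sub_span W S A K \<Longrightarrow> y \<in> sub_span W S A K \<Longrightarrow> x \<otimes>\<^bsub>RH\<^esub> y \<in> sub_span W S A K"
proof -
  interpret RH: ring RH by (rule ring_RH)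
  define M where "M = {rt a h | a h. a \<in> A \<and> h \<in> K}"
  have Kc: "K \<subseteq> carrier HW" by (rule subringE(1)[OF K])
  have M: "M \<subseteq> carrier RH" using Kc rt_closed by (auto simp: M_def)
  define Y where "Y = sub_span W S A K"
  have Y: "Y = generate (add_monoid RH) M" by (simp add: Y_def sub_span_def M_def)
  show c: "sub_span W S A K \<subseteq> carrier RH"
    using RH.add.generate_incl[OF M] unfolding Y_def[symmetric] Y by simp
  show "rt a h \<in> sub_span W S A K" if "a \<in> A" "h \<in> K"
    using generate.incl[of "rt a h" M "add_monoid RH"] that unfolding Y_def[symmetric] Y by (auto simp: M_def)
  have add: "x \<oplus>\<^bsub>RH\<^esub> y \<in> Y" if "x \<in> Y" "y \<in> Y" for x y
    using generate.eng[of x "add_monoid RH" M y] that unfolding Y by simp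
  then show "x \<in> sub_span W S A K \<Longrightarrow> y \<in> sub_span W S A K \<Longrightarrow> x \<oplus>\<^bsub>RH\<^esub> y \<in> sub_span W S A K"
    by (simp add: Y_def)
  have zero: "\<zero>\<^bsub>RH\<^esub> \<in> Y" using generate.one[of "add_monoid RH" M] unfolding Y by simp
  have neg: "\<ominus>\<^bsub>RH\<^esub> x \<in> Y" if "x \<in> Y" for x
    using RH.add.generate_m_inv_closed[OF M] that unfolding Y a_inv_def by simp
  have MM: "x \<otimes>\<^bsub>RH\<^esub> y \<in> Y" if xM: "x \<in> M" and yM: "y \<in> M" for x y
  proof -
    obtain a h b k where x: "x = rt a h" "a \<in> A" "h \<in> K" and y: "y = rt b k" "b \<in> A" "k \<in> K"
      using xM yM unfolding M_def by blast
    have "x \<otimes>\<^bsub>RH\<^esub> y = rt (a * b) (h \<otimes>\<^bsub>HW\<^esub> k)" unfolding x(1) y(1) using x(3) y(3) Kc by (intro rt_mult) auto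
    moreover have "rt (a * b) (h \<otimes>\<^bsub>HW\<^esub> k) \<in> M" using x y A(1) subringE(6)[OF K] unfolding M_def by blast
    ultimately show ?thesis unfolding Y by (simp add: generate.incl)
  qed
  have Yc: "Y \<subseteq> carrier RH" using c by (simp add: Y_def)
  have MY: "x \<otimes>\<^bsub>RH\<^esub> y \<in> Y" if x: "x \<in> M" and y: "y \<in> Y" for x y
    using y[unfolded Y]
  proof (induction rule: generate.induct)
    case one
    then show ?case using zero x M by auto
  next
    case (incl h)
    then show ?case using MM x by blast
  next
    case (inv h)
    then have h: "h \<in> carrier RH" "x \<in> carrier RH" using x M by blast+
    have "x \<otimes>\<^bsub>RH\<^esub> \<ominus>\<^bsub>RH\<^esub> h = \<ominus>\<^bsub>RH\<^esub> (x \<otimes>\<^bsub>RH\<^esub> h)" using h by (simp add: RH.r_minus)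
    then show ?case using neg[OF MM[OF x inv]] by (simp add: a_inv_def)
  next
    case (eng h1 h2)
    then have h: "h1 \<in> carrier RH" "h2 \<in> carrier RH" "x \<in> carrier RH" using x M Yc unfolding Y by blast+
    then show ?case using add[OF eng.IH] by (simp add: RH.r_distr)
  qed
  have "x \<otimes>\<^bsub>RH\<^esub> y \<in> Y" if x: "x \<in> Y" and y: "y \<in> Y" for x y
    using x[unfolded Y]
  proof (induction rule: generate.induct)
    case one
    then show ?case using zero y Yc by auto
  next
    case (incl h)
    then show ?case using MY y by blast
  next
    case (inv h)
    then have h: "h \<in> carrier RH" "y \<in> carrier RH" using y M Yc by blast+
    have "\<ominus>\<^bsub>RH\<^esub> h \<otimes>\<^bsub>RH\<^esub> y = \<ominus>\<^bsub>RH\<^esub> (h \<otimes>\<^bsub>RH\<^esub> y)" using h by (simp add: RH.l_minus)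
    then show ?case using neg[OF MY[OF inv y]] by (simp add: a_inv_def)
  next
    case (eng h1 h2)
    then have h: "h1 \<in> carrier RH" "h2 \<in> carrier RH" "y \<in> carrier RH" using y Yc unfolding Y by blast+
    then show ?case using add[OF eng.IH] by (simp add: RH.l_distr)
  qed
  then show "x \<in> sub_span W S A K \<Longrightarrow> y \<in> sub_span W S A K \<Longrightarrow> x \<otimes>\<^bsub>RH\<^esub> y \<in> sub_span W S A K"
    by (simp add: Y_def)
qed

lemma sub_span_mono:
  assumes "A \<subseteq> A'" "K \<subseteq> K'"
  shows "sub_span W S A K \<subseteq> sub_span W S A' K'"
  unfolding sub_span_def
  by (rule group.mono_generate[OF abelian_group.a_group[OF ring.is_abelian_group[OF ring_RH]]])
    (use assms in blast)

end

context finite_coxeter_parabolic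
begin

lemma hecke_specialization_R_hecke:
  "hecke_specialization W S I RH (\<lambda>r. rt r \<one>\<^bsub>HW\<^esub>) (R_T W S) (at_v_eq_1 W S)"
proof -
  interpret HW: ring HW by (rule ring_HW)
  interpret RH: ring RH by (rule ring_RH)
  have hT: "hT s \<in> carrier HW" if "s \<in> I" for s using that I_gen by simp
  have one: "\<one>\<^bsub>HW\<^esub> \<in> carrier HW" by simp
  have rt1: "rt 1 h \<otimes>\<^bsub>RH\<^esub> rt 1 k = rt 1 (h \<otimes>\<^bsub>HW\<^esub> k)" if "h \<in> carrier HW" "k \<in> carrier HW" for h k
    using rt_mult[OF that, of 1 1] by simp
  have mprod_rt: "mprod RH (map (rt 1) hs') = rt 1 (mprod HW hs')" if "hs' \<in> lists (carrier HW)" for hs'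
    using that
  proof (induction rule: lists.induct)
    case (Cons h hs')
    then show ?case using rt1[of h "mprod HW hs'"] HW.mprod_closed by simp
  qed (simp add: rt_one)
  have sp: "specialization (at_v_eq_1 W S)" by (rule specialization_at_v_eq_1)
  show ?thesis
  proof unfold_locales
    fix a b
    show "rt a \<one>\<^bsub>HW\<^esub> \<in> carrier RH" by (rule rt_closed[OF one])
    show "rt (a + b) \<one>\<^bsub>HW\<^esub> = rt a \<one>\<^bsub>HW\<^esub> \<oplus>\<^bsub>RH\<^esub> rt b \<one>\<^bsub>HW\<^esub>" by (rule rt_add_left[OF one])
    show "rt (a * b) \<one>\<^bsub>HW\<^esub> = rt a \<one>\<^bsub>HW\<^esub> \<otimes>\<^bsub>RH\<^esub> rt b \<one>\<^bsub>HW\<^esub>" by (simp add: rt_mult)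
    show "rt 1 \<one>\<^bsub>HW\<^esub> = \<one>\<^bsub>RH\<^esub>" by (rule rt_one)
  next
    fix x a assume x: "x \<in> carrier RH"
    \<comment> \<open>The elements that commute with a given scalar are closed under sums and
      products and contain the generators.\<close>
    have "carrier RH \<subseteq> {x \<in> carrier RH. x \<otimes>\<^bsub>RH\<^esub> rt a \<one>\<^bsub>HW\<^esub> = rt a \<one>\<^bsub>HW\<^esub> \<otimes>\<^bsub>RH\<^esub> x}"
    proof (rule RH_generated)
      note c = rt_closed[OF one, of a]
      fix x y assume "x \<in> {x \<in> carrier RH. x \<otimes>\<^bsub>RH\<^esub> rt a \<one>\<^bsub>HW\<^esub> = rt a \<one>\<^bsub>HW\<^esub> \<otimes>\<^bsub>RH\<^esub> x}"
        "y \<in> {x \<in> carrier RH. x \<otimes>\<^bsub>RH\<^esub> rt a \<one>\<^bsub>HW\<^esub> = rt a \<one>\<^bsub>HW\<^esub> \<otimes>\<^bsub>RH\<^esub> x}"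
      then have xy: "x \<in> carrier RH" "y \<in> carrier RH" "x \<otimes>\<^bsub>RH\<^esub> rt a \<one>\<^bsub>HW\<^esub> = rt a \<one>\<^bsub>HW\<^esub> \<otimes>\<^bsub>RH\<^esub> x"
        "y \<otimes>\<^bsub>RH\<^esub> rt a \<one>\<^bsub>HW\<^esub> = rt a \<one>\<^bsub>HW\<^esub> \<otimes>\<^bsub>RH\<^esub> y" by auto
      show "x \<oplus>\<^bsub>RH\<^esub> y \<in> {x \<in> carrier RH. x \<otimes>\<^bsub>RH\<^esub> rt a \<one>\<^bsub>HW\<^esub> = rt a \<one>\<^bsub>HW\<^esub> \<otimes>\<^bsub>RH\<^esub> x}"
        using xy c by (simp add: RH.l_distr RH.r_distr)
      have "x \<otimes>\<^bsub>RH\<^esub> y \<otimes>\<^bsub>RH\<^esub> rt a \<one>\<^bsub>HW\<^esub> = x \<otimes>\<^bsub>RH\<^esub> rt a \<one>\<^bsub>HW\<^esub> \<otimes>\<^bsub>RH\<^esub> y"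
        using xy(1,2,4) c by (simp add: RH.m_assoc)
      also have "\<dots> = rt a \<one>\<^bsub>HW\<^esub> \<otimes>\<^bsub>RH\<^esub> (x \<otimes>\<^bsub>RH\<^esub> y)"
        unfolding xy(3) using xy(1,2) c by (simp add: RH.m_assoc)
      finally show "x \<otimes>\<^bsub>RH\<^esub> y \<in> {x \<in> carrier RH. x \<otimes>\<^bsub>RH\<^esub> rt a \<one>\<^bsub>HW\<^esub> = rt a \<one>\<^bsub>HW\<^esub> \<otimes>\<^bsub>RH\<^esub> x}"
        using xy by simp
    qed (auto simp: rt_mult rt_closed R_T_def mult.commute)
    then show "x \<otimes>\<^bsub>RH\<^esub> rt a \<one>\<^bsub>HW\<^esub> = rt a \<one>\<^bsub>HW\<^esub> \<otimes>\<^bsub>RH\<^esub> x" using x by blast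
  next
    fix s assume s: "s \<in> I"
    show "R_T W S s \<in> carrier RH" unfolding R_T_def by (rule rt_closed[OF hT[OF s]])
    have c: "hs (v - vpow (- 1)) \<otimes>\<^bsub>HW\<^esub> hT s \<in> carrier HW" using hT[OF s] by simp
    have "R_T W S s \<otimes>\<^bsub>RH\<^esub> R_T W S s = rt 1 (\<one>\<^bsub>HW\<^esub> \<oplus>\<^bsub>HW\<^esub> hs (v - vpow (- 1)) \<otimes>\<^bsub>HW\<^esub> hT s)"
      unfolding R_T_def rt1[OF hT[OF s] hT[OF s]] hT_square[OF I_gen[OF s]] ..
    also have "\<dots> = \<one>\<^bsub>RH\<^esub> \<oplus>\<^bsub>RH\<^esub> rt (int_laurent_to_R (v - vpow (- 1)) * 1) (hT s)"
      unfolding rt_add_right[OF one c] rt_one rt_balanced[OF hT[OF s]] ..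
    also have "rt (int_laurent_to_R (v - vpow (- 1)) * 1) (hT s) =
        rt (1 + fps_X - inverse (1 + fps_X)) \<one>\<^bsub>HW\<^esub> \<otimes>\<^bsub>RH\<^esub> R_T W S s"
      unfolding int_laurent_to_R_q R_T_def rt_mult[OF one hT[OF s]] using hT[OF s] by simp
    finally show "R_T W S s \<otimes>\<^bsub>RH\<^esub> R_T W S s =
        \<one>\<^bsub>RH\<^esub> \<oplus>\<^bsub>RH\<^esub> rt (1 + fps_X - inverse (1 + fps_X)) \<one>\<^bsub>HW\<^esub> \<otimes>\<^bsub>RH\<^esub> R_T W S s" .
    show "at_v_eq_1 W S (R_T W S s) = Poly_Mapping.single s 1"
      using sp I_gen[OF s] by (simp add: specialization_def)
    fix t assume t: "t \<in> I"
    have "mprod RH (alternating n (R_T W S s) (R_T W S t)) = rt 1 (mprod HW (alternating n (hT s) (hT t)))"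
      if "s \<in> I" "t \<in> I" for n s t
    proof -
      have "alternating n (R_T W S s) (R_T W S t) = map (rt 1) (alternating n (hT s) (hT t))"
        by (simp add: R_T_def map_alternating)
      then show ?thesis using mprod_rt[of "alternating n (hT s) (hT t)"] hT that by auto
    qed
    then show "mprod RH (alternating (ord (s \<otimes> t)) (R_T W S s) (R_T W S t)) =
        mprod RH (alternating (ord (s \<otimes> t)) (R_T W S t) (R_T W S s))"
      using s t hT_braid[OF I_gen[OF s] I_gen[OF t]] by simp
  next
    show "at_v_eq_1 W S \<in> Ring.ring_hom RH QW" using sp by (simp add: specialization_def)
    show "at_v_eq_1 W S (rt a \<one>\<^bsub>HW\<^esub>) = Poly_Mapping.single \<one> (a $ 0)" for a
      using sp by (simp add: specialization_def)
  qed
qed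

text \<open>The element from \<open>tilde_exists\<close> satisfies \<open>is_tilde_w\<close>, and
  every solution of \<open>is_tilde_w\<close> satisfies \<open>is_tilde\<close>, where uniqueness
  holds; so it is the one that \<open>tilde_w\<close> denotes, and it is built with scalars of the
  localization.\<close>

theorem tilde_w_localization:
  "tilde_w W S I \<in> sub_span W S localization_in_R (carrier HW)"
proof -
  interpret HW: ring HW by (rule ring_HW)
  interpret H: hecke_specialization W S I RH "\<lambda>r. rt r \<one>\<^bsub>HW\<^esub>" "R_T W S" "at_v_eq_1 W S"
    by (rule hecke_specialization_R_hecke)
  have gens: "hs ` UNIV \<union> hT ` I \<subseteq> carrier HW" using I_gen by auto
  let ?K = "hecke_sub W S I"
  have K: "subring ?K HW" unfolding hecke_sub_def by (rule HW.generate_ring_is_subring[OF gens])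
  have hK: "hs c \<in> ?K" "s \<in> I \<Longrightarrow> hT s \<in> ?K" for c s
    unfolding hecke_sub_def by (auto intro: generate_ring.incl)
  have Kc: "?K \<subseteq> carrier HW" by (rule subringE(1)[OF K])
  have rt_split: "rt a h = rt a \<one>\<^bsub>HW\<^esub> \<otimes>\<^bsub>RH\<^esub> rt 1 h" if "h \<in> carrier HW" for a h
    using rt_mult[OF HW.one_closed that, of a 1] that by simp
  have neg: "\<ominus>\<^bsub>RH\<^esub> x \<in> range H.Theta" if "x \<in> range H.Theta" for x
  proof -
    have x: "x \<in> carrier RH" using that by (rule H.Theta_closed)
    have "\<ominus>\<^bsub>RH\<^esub> x = rt (- 1) \<one>\<^bsub>HW\<^esub> \<otimes>\<^bsub>RH\<^esub> x"
      using x H.\<iota>_uminus[of 1] by (simp add: H.B.l_minus)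
    then show ?thesis using H.Theta_scale_closed[OF that] by simp
  qed
  \<comment> \<open>The inclusion of R H_I in \<open>range Theta\<close>: first for the image of
    H_I, by induction over the generated ring, and then for the span.\<close>
  have K_Theta: "rt 1 h \<in> range H.Theta" if "h \<in> ?K" for h
    using that unfolding hecke_sub_def
  proof (induction rule: generate_ring.induct)
    case one
    then show ?case using H.Theta_one by (simp add: rt_one)
  next
    case (incl h)
    then consider c where "h = hs c" | s where "s \<in> I" "h = hT s" by auto
    then show ?case
    proof cases
      case 1
      then have "rt 1 h = rt (int_laurent_to_R c) \<one>\<^bsub>HW\<^esub>" using rt_balanced[of "\<one>\<^bsub>HW\<^esub>" c 1] by simp
      then show ?thesis using H.Theta_\<iota> by simp
    next
      case 2
      have "rt 1 (hT s) = R_T W S s" by (simp only: R_T_def)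
      then show ?thesis unfolding 2(2) using H.Theta_T[OF 2(1)] by (simp only:)
    qed
  next
    case (a_inv h)
    then have h: "h \<in> carrier HW" using HW.generate_ring_in_carrier[OF gens] by blast
    have "rt 1 (\<ominus>\<^bsub>HW\<^esub> h) \<oplus>\<^bsub>RH\<^esub> rt 1 h = rt 1 \<zero>\<^bsub>HW\<^esub>"
      using h rt_add_right[of "\<ominus>\<^bsub>HW\<^esub> h" h 1] by (simp add: HW.l_neg)
    also have "rt 1 \<zero>\<^bsub>HW\<^esub> = \<zero>\<^bsub>RH\<^esub>"
      using rt_add_right[of "\<zero>\<^bsub>HW\<^esub>" "\<zero>\<^bsub>HW\<^esub>" 1] rt_closed[of "\<zero>\<^bsub>HW\<^esub>" 1]
        H.B.add.l_cancel_one'[of "rt 1 \<zero>\<^bsub>HW\<^esub>" "rt 1 \<zero>\<^bsub>HW\<^esub>"] by simp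
    finally have "rt 1 (\<ominus>\<^bsub>HW\<^esub> h) = \<ominus>\<^bsub>RH\<^esub> rt 1 h"
      using h rt_closed by (intro H.B.minus_equality[symmetric]) auto
    then show ?case using neg[OF a_inv.IH] by simp
  next
    case (eng_add h k)
    then have "h \<in> carrier HW" "k \<in> carrier HW" using HW.generate_ring_in_carrier[OF gens] by blast+
    then show ?case using H.Theta_add_closed[OF eng_add.IH] by (simp add: rt_add_right)
  next
    case (eng_mult h k)
    then have "h \<in> carrier HW" "k \<in> carrier HW" using HW.generate_ring_in_carrier[OF gens] by blast+
    then show ?case using H.Theta_mult_closed[OF eng_mult.IH] by (simp add: rt_mult)
  qed
  have span_Theta: "x \<in> range H.Theta" if "x \<in> sub_span W S UNIV ?K" for x
    using that unfolding sub_span_def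
  proof (induction rule: generate.induct)
    case one
    then show ?case using H.Theta_zero by simp
  next
    case (incl x)
    then obtain a h where "x = rt a h" "h \<in> ?K" by blast
    then show ?case using rt_split[of h a] Kc K_Theta H.Theta_scale_closed by auto
  next
    case (inv x)
    then obtain a h where "x = rt a h" "h \<in> ?K" by blast
    then have "x \<in> range H.Theta" using rt_split[of h a] Kc K_Theta H.Theta_scale_closed by auto
    then show ?case using neg by (simp add: a_inv_def)
  next
    case (eng x y)
    then show ?case using H.Theta_add_closed by simp
  qed
  from H.tilde_exists obtain x where x: "H.is_tilde x" and gen: "\<forall>Y. Y \<subseteq> carrier RH \<longrightarrow>
      (\<forall>a\<in>localization_in_R. rt a \<one>\<^bsub>HW\<^esub> \<in> Y) \<longrightarrow> (\<forall>s\<in>I. R_T W S s \<in> Y) \<longrightarrow>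
      (\<forall>x\<in>Y. \<forall>y\<in>Y. x \<oplus>\<^bsub>RH\<^esub> y \<in> Y \<and> x \<otimes>\<^bsub>RH\<^esub> y \<in> Y) \<longrightarrow> x \<in> Y"
    by (elim exE conjE)
  note sp = sub_span_properties[of localization_in_R ?K, OF localization_mult localization_1 K]
  \<comment> \<open>The clause about \<open>Y\<close>, taken for the localized span of H_I. It also
    places \<open>x\<close> in R H_I, as the definition of \<open>is_tilde_w\<close>
    demands.\<close>
  have xl: "x \<in> sub_span W S localization_in_R ?K"
  proof (rule gen[THEN spec, THEN mp, THEN mp, THEN mp, THEN mp])
    show "sub_span W S localization_in_R ?K \<subseteq> carrier RH" by (rule sp(1))
    show "\<forall>a\<in>localization_in_R. rt a \<one>\<^bsub>HW\<^esub> \<in> sub_span W S localization_in_R ?K"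
      using sp(2) subringE(3)[OF K] by blast
    show "\<forall>s\<in>I. R_T W S s \<in> sub_span W S localization_in_R ?K"
      unfolding R_T_def using sp(2) hK(2) localization_1 by blast
    show "\<forall>x\<in>sub_span W S localization_in_R ?K. \<forall>y\<in>sub_span W S localization_in_R ?K.
        x \<oplus>\<^bsub>RH\<^esub> y \<in> sub_span W S localization_in_R ?K \<and> x \<otimes>\<^bsub>RH\<^esub> y \<in> sub_span W S localization_in_R ?K"
      using sp(3,4) by blast
  qed
  have tilde: "H.is_tilde y" if y: "is_tilde_w W S I y" for y
  proof -
    have y': "y \<in> sub_span W S UNIV ?K" "y \<otimes>\<^bsub>RH\<^esub> y = \<one>\<^bsub>RH\<^esub>" "at_v_eq_1 W S y = Poly_Mapping.single w0 1"
      "\<And>s. s \<in> I \<Longrightarrow> y \<otimes>\<^bsub>RH\<^esub> R_T W S s \<otimes>\<^bsub>RH\<^esub> inv\<^bsub>RH\<^esub> y = R_T W S (w0 \<otimes> s \<otimes> w0)"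
      using y by (simp_all add: is_tilde_w_def Let_def w0_def)
    have r: "y \<in> range H.Theta" by (rule span_Theta[OF y'(1)])
    have yc: "y \<in> carrier RH" by (rule H.Theta_closed[OF r])
    \<comment> \<open>Being its own inverse, a solution satisfies the conjugation rule in the
      multiplied-out form of \<open>is_tilde\<close>.\<close>
    have i: "inv\<^bsub>RH\<^esub> y = y" using H.B.inv_char[OF yc yc y'(2) y'(2)] .
    have "y \<otimes>\<^bsub>RH\<^esub> R_T W S s = R_T W S (w0 \<otimes> s \<otimes> w0) \<otimes>\<^bsub>RH\<^esub> y" if "s \<in> I" for s
      using y'(4)[OF that, symmetric] y'(2) yc that unfolding i by (simp add: H.B.m_assoc)
    then show ?thesis using r y'(2,3) by (simp add: H.is_tilde_def)
  qed
  have xt: "is_tilde_w W S I x"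
  proof -
    have x': "x \<in> range H.Theta" "x \<otimes>\<^bsub>RH\<^esub> x = \<one>\<^bsub>RH\<^esub>" "at_v_eq_1 W S x = Poly_Mapping.single w0 1"
      "\<And>s. s \<in> I \<Longrightarrow> x \<otimes>\<^bsub>RH\<^esub> R_T W S s = R_T W S (w0 \<otimes> s \<otimes> w0) \<otimes>\<^bsub>RH\<^esub> x"
      using x by (simp_all add: H.is_tilde_def)
    have xc: "x \<in> carrier RH" by (rule H.Theta_closed[OF x'(1)])
    have i: "inv\<^bsub>RH\<^esub> x = x" using H.B.inv_char[OF xc xc x'(2) x'(2)] .
    have "x \<otimes>\<^bsub>RH\<^esub> R_T W S s \<otimes>\<^bsub>RH\<^esub> inv\<^bsub>RH\<^esub> x = R_T W S (w0 \<otimes> s \<otimes> w0)" if "s \<in> I" for s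
      unfolding x'(4)[OF that] i using xc x'(2) w0_conj(1)[OF that] by (simp add: H.B.m_assoc)
    moreover have "x \<in> sub_span W S UNIV ?K" using xl sub_span_mono[of localization_in_R UNIV ?K ?K] by blast
    ultimately show ?thesis using x'(2,3) by (simp add: is_tilde_w_def Let_def w0_def)
  qed
  have "tilde_w W S I = x"
    unfolding tilde_w_def using xt tilde H.tilde_unique x by (intro the_equality) blast+
  then show ?thesis
    using xl sub_span_mono[of localization_in_R localization_in_R ?K "carrier HW"] Kc by auto
qed

end

theorem corollary3p6:
  fixes W :: "('a, 'm) monoid_scheme" and S I :: "'a set"
  assumes "coxeter_system W S" and "finite S"
    and "I \<subseteq> S" and "finite (parabolic W I)"
  shows "tilde_w W S I \<in> sub_span W S localization_in_R (carrier (hecke W S))"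
proof -
  interpret coxeter_system W S by fact
  interpret finite_coxeter_parabolic W S I
    by unfold_locales (use assms in auto)
  show ?thesis by (rule tilde_w_localization)
qed

end
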